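(* Let $\Delta\subseteq M_{\mathbb R}$ be a full-dimensional lattice polyhedron with normal fan $\Sigma:=\mathcal N(\Delta)$, and let $X:=\mathbb P(\Delta)$ be the associated toric variety over $\mathbb C$. Let $S=\{\nabla_i \mid i\in I\}$ be a $\Sigma$-family with $\#I=n$ and union $\nabla=\bigcup_{i\in I}\nabla_i$, and put $\nabla_{I'}:=\bigcap_{i\in I'}\nabla_i$ for $\emptyset\ne I'\subseteq I$, $\nabla_\emptyset:=\nabla$. Fix a total order on $I$. Then the complex $\mathcal C_\bullet^{F_S}$ with its evaluation subcomplexes $\mathcal C_\bullet^{F_S}(m)$ induces a $T$-equivariant exact sequence of direct sums of nef line bundles on $X$ $$0\to \mathcal O_X(\nabla_I)\to \bigoplus_{\#I'=n-1}\mathcal O_X(\nabla_{I'})\to\cdots\to\bigoplus_{i\in I}\mathcal O_X(\nabla_i)\to\mathcal O_X(\nabla)\to 0 ,$$ where the differential sends the summand $\mathcal O_X(\nabla_{I'})$, $I'=\{i_0<\dots<i_p\}$, to $\bigoplus_{j=0}^p\mathcal O_X(\nabla_{I'\setminus\{i_j\}})$, its $j$-th component being $(-1)^j$ times the inclusion of subsheaves $\mathcal O_X(\nabla_{I'})\subseteq\mathcal O_X(\nabla_{I'\setminus\{i_j\}})$.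
   Context: $M$ is a lattice of finite rank, $N=\mathrm{Hom}_{\mathbb Z}(M,\mathbb Z)$, $M_{\mathbb R}=M\otimes\mathbb R$, $N_{\mathbb R}=N\otimes\mathbb R$, with pairing $\langle\cdot,\cdot\rangle$; $T=\mathrm{Spec}\,\mathbb C[M]$ with characters $\chi^m$. A polyhedron is a finite intersection of closed half-spaces in $M_{\mathbb R}$; all polyhedra are assumed to have at least one vertex. A lattice polyhedron has all its vertices in $M$. The tail cone of a polyhedron $\nabla$ is $\{m\in M_{\mathbb R}\mid u+m\in\nabla\ \forall u\in\nabla\}$. For a full-dimensional lattice polyhedron $\Delta$, the (inner) normal fan $\mathcal N(\Delta)$ in $N_{\mathbb R}$ has as maximal cones $\sigma_m=(\mathrm{cone}(\Delta-m))^\vee$ for vertices $m$ of $\Delta$; its support is $\mathrm{tail}(\Delta)^\vee$, and $\mathbb P(\Delta)$ is the toric variety of this fan, with affine charts $U_\sigma=\mathrm{Spec}\,\mathbb C[\sigma^\vee\cap M]$. For a fan $\Sigma$ with full-dimensional convex support, $\mathrm{Pol}^+(\Sigma)$ is the set of lattice polyhedra $\nabla$ compatible with $\Sigma$, i.e. with tail cone $|\Sigma|^\vee$ and such that $v\mapsto\min\langle\nabla,v\rangle$ is linear on every cone of $\Sigma$ (i.e. $\Sigma$ refines the normal fan of $\nabla$), together with the empty set. For nonempty $\nabla\in\mathrm{Pol}^+(\Sigma)$ and $\sigma\in\Sigma$ there is $m_\sigma\in\nabla\cap M$ with $\min\langle\nabla,v\rangle=\langle m_\sigma,v\rangle$ for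 $v\in\sigma$. The nef line bundle $\mathcal O_X(\nabla)$ is the $T$-equivariant subsheaf of $j_*\mathcal O_T$ ($j:T\hookrightarrow X$) with $\Gamma(U_\sigma,\mathcal O_X(\nabla))=\bigoplus_{m\in(\nabla+\sigma^\vee)\cap M}\mathbb C\chi^m=\chi^{m_\sigma}\mathbb C[\sigma^\vee\cap M]$. Put $\mathcal O_X(\emptyset):=0$. An inclusion $\nabla\subseteq\nabla'$ gives $\mathcal O_X(\nabla)\subseteq\mathcal O_X(\nabla')$. A $\Sigma$-family is a finite set $S=\{\nabla_i\mid i\in I\}$ of elements of $\mathrm{Pol}^+(\Sigma)$ such that $\nabla:=\bigcup_i\nabla_i$ is a lattice polyhedron in $\mathrm{Pol}^+(\Sigma)$ and all intersections $\nabla_{I'}$, $\emptyset\neq I'\subseteq I$, are empty or in $\mathrm{Pol}^+(\Sigma)$. The associated contravariant functor (order-reversing map) is $F_S:2^I\to\mathrm{Pol}^+(\Sigma)$, $I'\mapsto\nabla_{I'}$. The complex $\mathcal C^{F_S}_\bullet$ is the subcomplex of the Koszul complex $\bigwedge^\bullet\mathbb C^I$ with $\mathcal C^{F_S}_p=\mathrm{span}\{e_{I'}\mid\#I'=p,\ \nabla_{I'}\ne\emptyset\}$ and differential $d(e_{I'})=\sum_{j=0}^p(-1)^je_{I'\setminus\{i_j\}}$ for $I'=\{i_0<\dots<i_p\}$; for $m\in M_{\mathbb R}$, $\mathcal C^{F_S}_\bullet(m)$ is the subcomplex spanned by the $e_{I'}$ with $m\in\nabla_{I'}$. "Induces" means: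 over $U_\sigma$ and in degree $m\in M$, the sequence of sheaves is the complex spanned by the $e_{I'}$ with $m\in\nabla_{I'}+\sigma^\vee$. *)

theory Defs
  imports
    "HOL-Analysis.Analysis"
    "HOL-Library.Poly_Mapping"
    "HOL-Computational_Algebra.Fraction_Field"
    "HOL-Algebra.Ideal"
begin

section \<open>Lattices, polyhedra and normal fans\<close>

text \<open>
  A lattice \<open>M\<close> of finite rank (rank 0 included) is realised inside a Euclidean space, with
  \<open>M\<^sub>\<real> = span M\<close>. The vector space \<open>N\<^sub>\<real>\<close>, i.e. the dual of \<open>M\<^sub>\<real>\<close>, is identified with \<open>span M\<close> as
  well, the pairing being the restriction of the (nondegenerate) inner product.
\<close>

definition is_lattice :: "'a::euclidean_space set \<Rightarrow> bool" where
  "is_lattice M \<longleftrightarrow>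
    (\<exists>B. independent B \<and> M = {\<Sum>b\<in>B. of_int (k b) *\<^sub>R b | k :: 'a \<Rightarrow> int. True})"

definition dual_cone :: "'a::euclidean_space set \<Rightarrow> 'a set \<Rightarrow> 'a set" where
  "dual_cone M C = {v \<in> span M. \<forall>u\<in>C. 0 \<le> u \<bullet> v}"

definition tail_cone :: "'a::euclidean_space set \<Rightarrow> 'a set \<Rightarrow> 'a set" where
  "tail_cone M D = {m \<in> span M. \<forall>u\<in>D. u + m \<in> D}"

definition lattice_polyhedron :: "'a::euclidean_space set \<Rightarrow> 'a set \<Rightarrow> bool" where
  "lattice_polyhedron M D \<longleftrightarrow>
    polyhedron D \<and> D \<subseteq> span M \<and> (\<exists>m. m extreme_point_of D) \<and> {m. m extreme_point_of D} \<subseteq> M"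

text \<open>
  The inner normal fan: all faces of the cones dual to \<open>cone (D - m)\<close>, \<open>m\<close> a vertex of \<open>D\<close>.
  The empty set, which the library counts as a face, is not a cone of the fan.
\<close>

definition normal_fan :: "'a::euclidean_space set \<Rightarrow> 'a set \<Rightarrow> 'a set set" where
  "normal_fan M D =
    {\<tau>. \<tau> \<noteq> {} \<and>
       (\<exists>m. m extreme_point_of D \<and> \<tau> face_of dual_cone M (cone hull ((\<lambda>u. u - m) ` D)))}"

text \<open>
  \<open>Pol\<^sup>+(\<Sigma>)\<close>; the last clause says that \<open>min \<langle>D, v\<rangle>\<close> is attained for \<open>v \<in> \<sigma>\<close> and equals \<open>l v\<close>.
\<close>

definition nef_polyhedra :: "'a::euclidean_space set \<Rightarrow> 'a set set \<Rightarrow> 'a set set" where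
  "nef_polyhedra M \<Sigma> = insert {} {D. lattice_polyhedron M D \<and>
     tail_cone M D = dual_cone M (\<Union>\<Sigma>) \<and>
     (\<forall>\<sigma>\<in>\<Sigma>. \<exists>l::'a \<Rightarrow> real. linear l \<and>
        (\<forall>v\<in>\<sigma>. (\<exists>u\<in>D. u \<bullet> v = l v) \<and> (\<forall>u\<in>D. l v \<le> u \<bullet> v)))}"

definition sigma_family ::
    "'a::euclidean_space set \<Rightarrow> 'a set set \<Rightarrow> 'i set \<Rightarrow> ('i \<Rightarrow> 'a set) \<Rightarrow> bool" where
  "sigma_family M \<Sigma> I D \<longleftrightarrow>
    finite I \<and>
    (\<forall>i\<in>I. D i \<in> nef_polyhedra M \<Sigma>) \<and>
    lattice_polyhedron M (\<Union>i\<in>I. D i) \<and> (\<Union>i\<in>I. D i) \<in> nef_polyhedra M \<Sigma> \<and>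
    (\<forall>J. J \<subseteq> I \<and> J \<noteq> {} \<longrightarrow> (\<Inter>i\<in>J. D i) \<in> nef_polyhedra M \<Sigma>)"

definition intersection_functor :: "'i set \<Rightarrow> ('i \<Rightarrow> 'a set) \<Rightarrow> 'i set \<Rightarrow> 'a set" where
  "intersection_functor I D J = (if J = {} then (\<Union>i\<in>I. D i) else (\<Inter>i\<in>J. D i))"


section \<open>Koszul-type complexes\<close>

text \<open>
  A chain is given by its coefficients \<open>c J\<close> at \<open>e\<^sub>J\<close>. The coefficient of \<open>d c\<close> at \<open>e\<^sub>J\<close> collects the
  contributions of the sets \<open>insert i J\<close>; removing \<open>i\<close> from \<open>{i\<^sub>0 < \<dots> < i\<^sub>p}\<close> carries the sign \<open>(-1)^j\<close>
  where \<open>i = i\<^sub>j\<close>, i.e. where \<open>j\<close> elements are smaller than \<open>i\<close>. Degrees are integers, so that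
  each complex is continued by zero on both sides.
\<close>

definition koszul_diff ::
    "'i::linorder set \<Rightarrow> ('i set \<Rightarrow> 'c::comm_ring_1) \<Rightarrow> 'i set \<Rightarrow> 'c" where
  "koszul_diff I c J = (\<Sum>i \<in> I - J. (- 1) ^ card {k \<in> insert i J. k < i} * c (insert i J))"

definition functor_complex ::
    "'i set \<Rightarrow> ('i set \<Rightarrow> 'a set) \<Rightarrow> int \<Rightarrow> ('i set \<Rightarrow> complex) set" where
  "functor_complex I F p = {z. \<forall>J. z J \<noteq> 0 \<longrightarrow> J \<subseteq> I \<and> int (card J) = p \<and> F J \<noteq> {}}"

definition evaluation_complex ::
    "'i set \<Rightarrow> ('i set \<Rightarrow> 'a set) \<Rightarrow> 'a \<Rightarrow> int \<Rightarrow> ('i set \<Rightarrow> complex) set" where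
  "evaluation_complex I F m p = {z. \<forall>J. z J \<noteq> 0 \<longrightarrow> J \<subseteq> I \<and> int (card J) = p \<and> m \<in> F J}"


section \<open>The group algebra of a Euclidean space and its quotient field\<close>

text \<open>
  The algebras \<open>\<complex>[\<sigma>\<^sup>\<or> \<inter> M] \<subseteq> \<complex>[M]\<close> are subrings of the group algebra of the ambient space.
  The latter is a copy of \<open>'a \<Rightarrow>\<^sub>0 complex\<close>: the library makes that type an integral domain only
  for linearly ordered exponents.
\<close>

typedef (overloaded) 'a group_algebra = "UNIV :: ('a::euclidean_space \<Rightarrow>\<^sub>0 complex) set"
  morphisms coeffs Group_Algebra by simp

setup_lifting type_definition_group_algebra

instantiation group_algebra :: (euclidean_space) comm_ring_1
begin

lift_definition zero_group_algebra :: "'a group_algebra" is 0 .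
lift_definition one_group_algebra :: "'a group_algebra" is 1 .
lift_definition plus_group_algebra ::
  "'a group_algebra \<Rightarrow> 'a group_algebra \<Rightarrow> 'a group_algebra" is "(+)" .
lift_definition minus_group_algebra ::
  "'a group_algebra \<Rightarrow> 'a group_algebra \<Rightarrow> 'a group_algebra" is "(-)" .
lift_definition uminus_group_algebra :: "'a group_algebra \<Rightarrow> 'a group_algebra" is uminus .
lift_definition times_group_algebra ::
  "'a group_algebra \<Rightarrow> 'a group_algebra \<Rightarrow> 'a group_algebra" is "(*)" .

instance
  by (intro_classes; transfer) (simp_all add: algebra_simps)

end

lemma exists_generic_functional:
  fixes A :: "'a::euclidean_space set"
  assumes "finite A"
  shows "\<exists>w. inj_on (\<lambda>a. a \<bullet> w) A"
proof -
  let ?H = "\<Union>(a, b) \<in> {(a, b). a \<in> A \<and> b \<in> A \<and> a \<noteq> b}. {w. (a - b) \<bullet> w = 0}"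
  have "finite {(a, b). a \<in> A \<and> b \<in> A \<and> a \<noteq> b}"
    by (rule finite_subset[of _ "A \<times> A"]) (use assms in auto)
  then have "negligible ?H"
    by (intro negligible_Union) (auto intro!: negligible_hyperplane)
  then have "?H \<noteq> UNIV"
    using open_not_negligible[of UNIV] by force
  then obtain w where "w \<notin> ?H" by blast
  then have "inj_on (\<lambda>a. a \<bullet> w) A"
    by (auto simp: inj_on_def inner_diff_left)
  then show ?thesis ..
qed

lemma group_algebra_no_zero_divisors:
  fixes f g :: "'a::euclidean_space \<Rightarrow>\<^sub>0 complex"
  assumes "f \<noteq> 0" "g \<noteq> 0"
  shows "f * g \<noteq> 0"
proof -
  let ?A = "Poly_Mapping.keys f" and ?B = "Poly_Mapping.keys g"
  obtain w where w: "inj_on (\<lambda>a. a \<bullet> w) (?A \<union> ?B)"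
    using exists_generic_functional[of "?A \<union> ?B"] by auto
  have ne: "?A \<noteq> {}" "?B \<noteq> {}" using assms by auto
  have "Max ((\<lambda>a. a \<bullet> w) ` ?A) \<in> (\<lambda>a. a \<bullet> w) ` ?A" "Max ((\<lambda>a. a \<bullet> w) ` ?B) \<in> (\<lambda>a. a \<bullet> w) ` ?B"
    using ne by (auto intro!: Max_in)
  then obtain a b where a: "a \<in> ?A" "a \<bullet> w = Max ((\<lambda>a. a \<bullet> w) ` ?A)"
    and b: "b \<in> ?B" "b \<bullet> w = Max ((\<lambda>a. a \<bullet> w) ` ?B)" by (metis (no_types, lifting) imageE)
  have amax: "x \<bullet> w \<le> a \<bullet> w" if "x \<in> ?A" for x using that a by simp
  have bmax: "x \<bullet> w \<le> b \<bullet> w" if "x \<in> ?B" for x using that b by simp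
  have uniq: "x = a \<and> y = b" if "x \<in> ?A" "y \<in> ?B" "x + y = a + b" for x y
  proof -
    have "x \<bullet> w + y \<bullet> w = a \<bullet> w + b \<bullet> w" using that(3) by (metis inner_add_left)
    then have "x \<bullet> w = a \<bullet> w" "y \<bullet> w = b \<bullet> w" using amax[OF that(1)] bmax[OF that(2)] by auto
    then show ?thesis using w that a(1) b(1) by (auto simp: inj_on_def)
  qed
  have "Poly_Mapping.lookup (f * g) (a + b) =
      (\<Sum>x\<in>?A. \<Sum>y\<in>?B. Poly_Mapping.lookup f x * Poly_Mapping.lookup g y when a + b = x + y)"
  proof -
    have in_keys: "(\<Sum>y. Poly_Mapping.lookup g y when k = x + y) =
        (\<Sum>y\<in>?B. Poly_Mapping.lookup g y when k = x + y)" for k x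
      by (rule Sum_any.expand_superset) (auto simp: in_keys_iff when_def)
    have "Poly_Mapping.lookup (f * g) (a + b) =
        (\<Sum>x. Poly_Mapping.lookup f x * (\<Sum>y\<in>?B. Poly_Mapping.lookup g y when a + b = x + y))"
      by (simp add: lookup_mult in_keys)
    also have "\<dots> = (\<Sum>x\<in>?A. Poly_Mapping.lookup f x *
        (\<Sum>y\<in>?B. Poly_Mapping.lookup g y when a + b = x + y))"
      by (rule Sum_any.expand_superset) (auto simp: in_keys_iff)
    finally show ?thesis by (simp add: sum_distrib_left mult_when)
  qed
  also have "\<dots> = (\<Sum>x\<in>?A. \<Sum>y\<in>?B.
      if x = a then (if y = b then Poly_Mapping.lookup f a * Poly_Mapping.lookup g b else 0) else 0)"
    by (intro sum.cong refl) (use uniq in \<open>auto simp: when_def\<close>)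
  also have "\<dots> = (\<Sum>x\<in>?A. if x = a then \<Sum>y\<in>?B.
      if y = b then Poly_Mapping.lookup f a * Poly_Mapping.lookup g b else 0 else 0)"
    by (intro sum.cong refl) auto
  also have "\<dots> = Poly_Mapping.lookup f a * Poly_Mapping.lookup g b"
    using a(1) b(1) by simp
  finally have "Poly_Mapping.lookup (f * g) (a + b) \<noteq> 0"
    using a(1) b(1) by (simp add: in_keys_iff)
  then show ?thesis by auto
qed

instance group_algebra :: (euclidean_space) idom
  by (intro_classes; transfer) (rule group_algebra_no_zero_divisors)

type_synonym 'a rational = "'a group_algebra fract"

definition monomial :: "'a::euclidean_space \<Rightarrow> complex \<Rightarrow> 'a rational" where
  "monomial m a = Fract (Group_Algebra (Poly_Mapping.single m a)) 1"

text \<open>\<open>span_characters S\<close> is the direct sum of the lines \<open>\<complex> \<chi>\<^sup>m\<close>, \<open>m \<in> S\<close>.\<close>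

definition span_characters :: "'a::euclidean_space set \<Rightarrow> 'a group_algebra set" where
  "span_characters S = {f. Poly_Mapping.keys (coeffs f) \<subseteq> S}"


section \<open>The toric variety of a fan\<close>

definition chart_ring :: "'a::euclidean_space set \<Rightarrow> 'a set \<Rightarrow> 'a group_algebra set" where
  "chart_ring M \<sigma> = span_characters (dual_cone M \<sigma> \<inter> M)"

definition ring_on :: "'r::comm_ring_1 set \<Rightarrow> 'r ring" where
  "ring_on A = \<lparr>carrier = A, mult = (*), one = 1, zero = 0, add = (+)\<rparr>"

definition spectrum :: "'r::comm_ring_1 set \<Rightarrow> 'r set set" where
  "spectrum A = {P. primeideal P (ring_on A)}"

definition localize :: "'r::idom set \<Rightarrow> 'r set \<Rightarrow> 'r fract set" where
  "localize G S = {Fract g s | g s. g \<in> G \<and> s \<in> S}"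

text \<open>
  The variety is integral and separated, so a point is determined by its local ring inside the
  function field. We let the point of \<open>Spec (chart_ring M \<sigma>)\<close> given by a prime \<open>P\<close> \<^emph>\<open>be\<close> this local
  ring: the charts are then glued automatically, two points of different charts being identified
  iff they have the same local ring. The topology is generated by the Zariski-open sets of
  the charts.
\<close>

definition point :: "'a::euclidean_space set \<Rightarrow> 'a set \<Rightarrow> 'a group_algebra set \<Rightarrow> 'a rational set"
  where "point M \<sigma> P = localize (chart_ring M \<sigma>) (chart_ring M \<sigma> - P)"

definition basic_open ::
    "'a::euclidean_space set \<Rightarrow> 'a set \<Rightarrow> 'a group_algebra \<Rightarrow> 'a rational set set" where
  "basic_open M \<sigma> f = point M \<sigma> ` {P \<in> spectrum (chart_ring M \<sigma>). f \<notin> P}"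

definition chart :: "'a::euclidean_space set \<Rightarrow> 'a set \<Rightarrow> 'a rational set set" where
  "chart M \<sigma> = point M \<sigma> ` spectrum (chart_ring M \<sigma>)"

definition toric_variety :: "'a::euclidean_space set \<Rightarrow> 'a set set \<Rightarrow> 'a rational set topology" where
  "toric_variety M \<Sigma> =
    topology_generated_by {basic_open M \<sigma> f | \<sigma> f. \<sigma> \<in> \<Sigma> \<and> f \<in> chart_ring M \<sigma>}"


section \<open>Sheaves on the toric variety\<close>

text \<open>
  The space is irreducible. All sheaves below are subsheaves of the constant sheaf of rational
  functions or finite direct sums of such: they are given by their sets of sections in one fixed
  group, with \<open>{0}\<close> as sections over the empty set and with inclusions as restriction maps
  between nonempty open sets.
\<close>

definition structure_sheaf :: "'a::euclidean_space rational set set \<Rightarrow> 'a rational set" where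
  "structure_sheaf U = {f. (U = {} \<longrightarrow> f = 0) \<and> (\<forall>x\<in>U. f \<in> x)}"

definition chart_module ::
    "'a::euclidean_space set \<Rightarrow> 'a set \<Rightarrow> 'a set \<Rightarrow> 'a group_algebra set" where
  "chart_module M \<sigma> D = span_characters ((D + dual_cone M \<sigma>) \<inter> M)"

text \<open>
  \<open>\<O>\<^sub>X(D)\<close>: the sheaf which on the affine chart of \<open>\<sigma>\<close> is associated with the module
  \<open>chart_module M \<sigma> D\<close>, so its stalk at the point of a prime \<open>P\<close> is the localization of
  this module at \<open>P\<close>.
\<close>

definition toric_sheaf ::
    "'a::euclidean_space set \<Rightarrow> 'a set set \<Rightarrow> 'a set \<Rightarrow> 'a rational set set \<Rightarrow> 'a rational set" where
  "toric_sheaf M \<Sigma> D U = {f. (U = {} \<longrightarrow> f = 0) \<and>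
     (\<forall>\<sigma>\<in>\<Sigma>. \<forall>P\<in>spectrum (chart_ring M \<sigma>). point M \<sigma> P \<in> U \<longrightarrow>
        f \<in> localize (chart_module M \<sigma> D) (chart_ring M \<sigma> - P))}"

definition line_bundle ::
    "'a::euclidean_space rational set topology \<Rightarrow>
     ('a rational set set \<Rightarrow> 'a rational set) \<Rightarrow> bool" where
  "line_bundle X L \<longleftrightarrow>
    (\<forall>x\<in>topspace X. \<exists>V. openin X V \<and> x \<in> V \<and>
       (\<exists>g. g \<noteq> 0 \<and> (\<forall>W. openin X W \<and> W \<subseteq> V \<longrightarrow> L W = (\<lambda>h. g * h) ` structure_sheaf W)))"

text \<open>Globally generated line bundles are nef; on toric varieties as here the converse holds.\<close>

definition globally_generated ::
    "'a::euclidean_space rational set topology \<Rightarrow>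
     ('a rational set set \<Rightarrow> 'a rational set) \<Rightarrow> bool" where
  "globally_generated X L \<longleftrightarrow>
    (\<forall>U. openin X U \<longrightarrow> (\<forall>s\<in>L U. \<forall>x\<in>U. \<exists>V A h. openin X V \<and> x \<in> V \<and> V \<subseteq> U \<and>
       finite A \<and> A \<subseteq> L (topspace X) \<and> (\<forall>g\<in>A. h g \<in> structure_sheaf V) \<and>
       s = (\<Sum>g\<in>A. h g * g)))"

definition direct_sum_sheaf ::
    "'i set \<Rightarrow> ('i set \<Rightarrow> 'x set \<Rightarrow> 'k::zero set) \<Rightarrow> int \<Rightarrow> 'x set \<Rightarrow> ('i set \<Rightarrow> 'k) set" where
  "direct_sum_sheaf I L p U =
    {c. \<forall>J. if J \<subseteq> I \<and> int (card J) = p then c J \<in> L J U else c J = 0}"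

text \<open>Exactness of \<open>F \<longlonglongrightarrow> G \<longlonglongrightarrow> H\<close>: kernel and image sheaf in the middle coincide.\<close>

definition sheaf_exact ::
    "'x topology \<Rightarrow> ('x set \<Rightarrow> 'b set) \<Rightarrow> ('b \<Rightarrow> 'c) \<Rightarrow> ('x set \<Rightarrow> 'c set) \<Rightarrow>
     ('c \<Rightarrow> ('j \<Rightarrow> 'k::zero)) \<Rightarrow> ('x set \<Rightarrow> ('j \<Rightarrow> 'k) set) \<Rightarrow> bool" where
  "sheaf_exact X F d G e H \<longleftrightarrow>
    (\<forall>U. openin X U \<longrightarrow> d ` F U \<subseteq> G U \<and> e ` G U \<subseteq> H U \<and> (\<forall>s\<in>F U. e (d s) = (\<lambda>_. 0)) \<and>
       (\<forall>s\<in>G U. e s = (\<lambda>_. 0) \<longrightarrow>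
          (\<forall>x\<in>U. \<exists>V. openin X V \<and> x \<in> V \<and> V \<subseteq> U \<and> (\<exists>t\<in>F V. d t = s))))"


section \<open>The torus action\<close>

text \<open>The closed points of the torus, \<open>Hom(M, \<complex>\<^sup>*)\<close>; values outside \<open>M\<close> are irrelevant.\<close>

definition torus :: "'a::euclidean_space set \<Rightarrow> ('a \<Rightarrow> complex) set" where
  "torus M = {t. (\<forall>m\<in>M. t m \<noteq> 0) \<and> (\<forall>m\<in>M. \<forall>m'\<in>M. t (m + m') = t m * t m')}"

definition scale :: "('a::euclidean_space \<Rightarrow> complex) \<Rightarrow> 'a group_algebra \<Rightarrow> 'a group_algebra" where
  "scale t f = Group_Algebra (Poly_Mapping.mapp (\<lambda>m c. t m * c) (coeffs f))"

text \<open>The extension of \<open>\<chi>\<^sup>m \<mapsto> t(m) \<chi>\<^sup>m\<close> to the quotient field of \<open>\<complex>[M]\<close>.\<close>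

definition torus_act ::
    "'a::euclidean_space set \<Rightarrow> ('a \<Rightarrow> complex) \<Rightarrow> 'a rational \<Rightarrow> 'a rational" where
  "torus_act M t q = (THE r. \<exists>f\<in>span_characters M. \<exists>g\<in>span_characters M.
     g \<noteq> 0 \<and> q = Fract f g \<and> r = Fract (scale t f) (scale t g))"

definition translate ::
    "'a::euclidean_space set \<Rightarrow> ('a \<Rightarrow> complex) \<Rightarrow> 'a rational set set \<Rightarrow> 'a rational set set" where
  "translate M t U = (\<lambda>x. torus_act M t ` x) ` U"

definition torus_equivariant ::
    "'a::euclidean_space set \<Rightarrow> 'a rational set topology \<Rightarrow>
     ('a rational set set \<Rightarrow> 'a rational set) \<Rightarrow> bool" where
  "torus_equivariant M X L \<longleftrightarrow>
    (\<forall>t\<in>torus M. \<forall>U. openin X U \<longrightarrow> L (translate M t U) = torus_act M t ` L U)"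

end

(*
  In degree m and over the chart of sigma, the sequence is the complex spanned by the e_J with
  F J + sigma^dual containing m, that is, with F J meeting the closed convex set m - sigma^dual. So
  its exactness is a statement about the nerve of the closed convex sets
  A_i = D_i Int (m - sigma^dual), whose union is convex: the augmented complex of this nerve is
  acyclic. Intersecting with the convex hull of finitely many points makes the A_i compact. If the
  nerve has a largest simplex, its complex is a cone. Otherwise two simplices J, K do not span a
  simplex; a hyperplane strictly separates the intersections of the A_i over J and over K, and
  intersecting all A_i with the two closed half-spaces and with the hyperplane gives three smaller
  nerves, from which the given one is assembled by Mayer-Vietoris.

  For a nonempty D in Pol^+(Sigma), a linear functional in the relative interior of sigma is
  minimized on D at a vertex m_sigma, and this vertex is then minimal for all of sigma. Hence on the
  chart of sigma the sheaf of D is generated by the global section chi^(m_sigma).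
*)
theory Submission
  imports Defs
begin

section \<open>Koszul complexes of set families\<close>

text \<open>Acyclicity of a nerve is proved for inhomogeneous chains, with the empty simplex
  standing for the union. The augmentation then needs no separate treatment in the Mayer-Vietoris
  step, and the hypothesis on the union becomes convexity of the set attached to the empty simplex:
  two points of the union on either side of the hyperplane yield one on it. Degrees are restored
  afterwards by truncation. The nerve statement concerns one exponent and one chart, whereas the
  sheaves are defined through local rings. At a point, the finitely many components of a section
  have a common denominator; the numerators involve finitely many exponents, and the resulting lift
  is a section wherever that denominator is invertible. Moreover a point, being a local ring, can
  come from several charts, each of which imposes a condition on sections; the conditions agree
  because the monomials of the minimal vertices of two charts differ by a unit of the local ring.
  The ambient group algebra has exponents outside the lattice, where a torus element is arbitrary,
  so the torus action is controlled only on fractions of elements of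
  \<open>span_characters M\<close>.\<close>

lemma koszul_diff_add:
  "koszul_diff I (\<lambda>J. a J + b J) = (\<lambda>J. koszul_diff I a J + koszul_diff I b J)"
  by (simp add: koszul_diff_def fun_eq_iff distrib_left sum.distrib)

lemma koszul_diff_diff:
  "koszul_diff I (\<lambda>J. a J - b J) = (\<lambda>J. koszul_diff I a J - koszul_diff I b J)"
  by (simp add: koszul_diff_def fun_eq_iff right_diff_distrib sum_subtractf)

lemma koszul_diff_zero [simp]: "koszul_diff I (\<lambda>J. 0) = (\<lambda>J. 0)"
  by (simp add: koszul_diff_def fun_eq_iff)

text \<open>The position of \<open>k\<close> moves up by one exactly when the inserted
  \<open>i\<close> is smaller. This single sign change is behind both the vanishing of the squared
  differential and the contraction of a simplex.\<close>

lemma koszul_sign_insert: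
  fixes i k :: "'i::linorder"
  assumes "finite J" "i \<notin> J" "k \<notin> J" "i \<noteq> k"
  shows "(- 1::'c::comm_ring_1) ^ card {l \<in> insert k (insert i J). l < k} =
         (if i < k then - 1 else 1) * (- 1) ^ card {l \<in> insert k J. l < k}"
proof -
  have "{l \<in> insert k (insert i J). l < k} =
      (if i < k then insert i {l \<in> insert k J. l < k} else {l \<in> insert k J. l < k})"
    using assms by auto
  then show ?thesis using assms by (simp add: card_insert_if)
qed

text \<open>Removing \<open>i\<close> and \<open>k\<close> in the two possible orders gives opposite
  signs, so the double sum cancels in pairs. Finiteness of the support matters because signs are
  read off from \<open>card\<close>, which is 0 on infinite sets.\<close>

lemma koszul_diff_koszul_diff:
  fixes c :: "'i::linorder set \<Rightarrow> 'c::comm_ring_1"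
  assumes "finite I" "\<And>J. c J \<noteq> 0 \<Longrightarrow> finite J"
  shows "koszul_diff I (koszul_diff I c) J = 0"
proof (cases "finite J")
  case True
  define s where "s J i = (- 1 :: 'c) ^ card {k \<in> insert i J. k < i}" for J and i :: 'i
  define f where "f i k = s J i * (s (insert i J) k * c (insert k (insert i J)))" for i k
  have anti: "f k i = - f i k" if "i \<in> I - J" "k \<in> I - J" "i \<noteq> k" for i k
  proof -
    have "s (insert i J) k = (if i < k then - 1 else 1) * s J k"
      unfolding s_def using koszul_sign_insert[of J i k, where 'c='c] that True by simp
    moreover have "s (insert k J) i = (if k < i then - 1 else 1) * s J i"
      unfolding s_def using koszul_sign_insert[of J k i, where 'c='c] that True by simp
    ultimately show ?thesis
      using that by (auto simp: f_def insert_commute)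
  qed
  have "koszul_diff I (koszul_diff I c) J = (\<Sum>i\<in>I - J. \<Sum>k\<in>I - insert i J. f i k)"
    by (simp add: koszul_diff_def sum_distrib_left f_def s_def)
  also have "\<dots> = (\<Sum>i\<in>I - J. \<Sum>k\<in>{k\<in>I - J. k \<noteq> i}. f i k)"
    by (intro sum.cong) auto
  \<comment> \<open>After splitting by the order of \<open>i\<close> and \<open>k\<close>,
    exchanging the summations in the second half turns it into the negative of the first.\<close>
  also have "\<dots> = (\<Sum>i\<in>I - J. (\<Sum>k\<in>{k\<in>I - J. k < i}. f i k) + (\<Sum>k\<in>{k\<in>I - J. i < k}. f i k))"
  proof (intro sum.cong refl)
    fix i
    have "{k\<in>I - J. k \<noteq> i} = {k\<in>I - J. k < i} \<union> {k\<in>I - J. i < k}" by auto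
    then show "(\<Sum>k\<in>{k\<in>I - J. k \<noteq> i}. f i k) =
       (\<Sum>k\<in>{k\<in>I - J. k < i}. f i k) + (\<Sum>k\<in>{k\<in>I - J. i < k}. f i k)"
      using assms by (simp, subst sum.union_disjoint) auto
  qed
  also have "\<dots> = (\<Sum>i\<in>I - J. \<Sum>k\<in>{k\<in>I - J. k < i}. f i k) +
      (\<Sum>i\<in>I - J. \<Sum>k\<in>{k\<in>I - J. i < k}. f i k)"
    by (simp add: sum.distrib)
  also have "(\<Sum>i\<in>I - J. \<Sum>k\<in>{k\<in>I - J. i < k}. f i k) =
      (\<Sum>k\<in>I - J. \<Sum>i\<in>{i\<in>I - J. i < k}. f i k)"
    using assms by (intro sum.swap_restrict) auto
  also have "\<dots> = (\<Sum>k\<in>I - J. \<Sum>i\<in>{i\<in>I - J. i < k}. - f k i)"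
    by (intro sum.cong refl anti) auto
  finally show ?thesis by (simp add: sum_negf)
next
  case False
  \<comment> \<open>Every coefficient entering at an infinite \<open>J\<close> sits at an infinite
    set, hence is zero.\<close>
  have "c (insert k (insert i J)) = 0" for i k
    using assms(2)[of "insert k (insert i J)"] False by (simp only: finite_insert) blast
  then have "koszul_diff I c (insert i J) = 0" for i by (simp add: koszul_diff_def)
  then show ?thesis by (simp add: koszul_diff_def)
qed

lemma koszul_diff_supported:
  assumes "\<forall>J. c J \<noteq> 0 \<longrightarrow> J \<in> N" "\<forall>K\<in>N. \<forall>J\<subseteq>K. J \<in> N"
    and "koszul_diff I c J \<noteq> 0"
  shows "J \<in> N"
proof -
  obtain i where "c (insert i J) \<noteq> 0"
    using assms(3) unfolding koszul_diff_def by (metis (no_types, lifting) mult_zero_right sum.neutral)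
  then show ?thesis using assms(1,2) by blast
qed

text \<open>For a simplicial complex \<open>N\<close> this is vanishing of reduced homology with
  complex coefficients, the empty simplex spanning the augmentation. All degrees are treated
  together; \<open>acyclic_family_degree\<close> recovers the graded version.\<close>

definition acyclic_family :: "'i::linorder set \<Rightarrow> 'i set set \<Rightarrow> bool" where
  "acyclic_family I N \<longleftrightarrow>
    (\<forall>z::'i set \<Rightarrow> complex. (\<forall>J. z J \<noteq> 0 \<longrightarrow> J \<in> N) \<and> koszul_diff I z = (\<lambda>_. 0) \<longrightarrow>
       (\<exists>y. (\<forall>J. y J \<noteq> 0 \<longrightarrow> J \<in> N) \<and> koszul_diff I y = z))"

lemma acyclic_familyD:
  assumes "acyclic_family I N" "\<forall>J. z J \<noteq> 0 \<longrightarrow> J \<in> N" "koszul_diff I z = (\<lambda>_. 0)"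
  shows "\<exists>y::'i::linorder set \<Rightarrow> complex. (\<forall>J. y J \<noteq> 0 \<longrightarrow> J \<in> N) \<and> koszul_diff I y = z"
  using assms unfolding acyclic_family_def by simp

text \<open>A nonempty simplex is a cone over a vertex \<open>i\<close>: wedging a cycle with the
  basis vector of \<open>i\<close> gives a chain bounded by that cycle. For \<open>T = {}\<close>
  the augmentation class would survive.\<close>

lemma acyclic_family_simplex:
  assumes "finite I" "T \<subseteq> I" "T \<noteq> {}"
  shows "acyclic_family I (Pow T)"
  unfolding acyclic_family_def
proof (intro allI impI)
  fix z :: "'a set \<Rightarrow> complex"
  assume "(\<forall>J. z J \<noteq> 0 \<longrightarrow> J \<in> Pow T) \<and> koszul_diff I z = (\<lambda>_. 0)"
  then have zT: "\<And>J. z J \<noteq> 0 \<Longrightarrow> J \<subseteq> T" and dz: "\<And>J. koszul_diff I z J = 0" by auto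
  \<comment> \<open>The least vertex always occupies position 0, so removing it costs no sign, and
    inserting it reverses the sign attached to every other vertex.\<close>
  define i where "i = Min T"
  have finT: "finite T" using assms finite_subset by auto
  have iT: "i \<in> T" and imin: "\<And>k. k \<in> T \<Longrightarrow> i \<le> k" using assms finT by (auto simp: i_def)
  define y where "y J = (if i \<in> J then z (J - {i}) else 0)" for J
  have yT: "y J \<noteq> 0 \<Longrightarrow> J \<in> Pow T" for J
    using zT[of "J - {i}"] iT by (auto simp: y_def split: if_splits)
  have "koszul_diff I y J = z J" for J
  proof (cases "J \<subseteq> T")
    case False
    then have "y (insert k J) = 0" for k using yT[of "insert k J"] by auto
    then show ?thesis using False zT[of J] by (auto simp: koszul_diff_def)
  next
    case JT: True
    then have finJ: "finite J" using finT finite_subset by auto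
    show ?thesis
    proof (cases "i \<in> J")
      case False
      \<comment> \<open>Only \<open>k = i\<close> contributes, since \<open>y\<close> vanishes on
        sets without \<open>i\<close>.\<close>
      have "koszul_diff I y J =
          (\<Sum>k\<in>I - J. if k = i then (-1) ^ card {l \<in> insert i J. l < i} * z J else 0)"
        unfolding koszul_diff_def y_def using False by (intro sum.cong) auto
      also have "{l \<in> insert i J. l < i} = {}" using JT imin by force
      finally show ?thesis using False iT assms by (simp add: subset_iff)
    next
      case True
      \<comment> \<open>The cycle condition at \<open>J'\<close> expresses \<open>z J\<close> by the
        coefficients of \<open>z\<close> at the sets \<open>insert k J'\<close>. The same
        coefficients make up the boundary of \<open>y\<close> at \<open>J\<close>, each with the
        opposite sign because of the extra least element \<open>i\<close>.\<close>
      define J' where "J' = J - {i}"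
      have J: "J = insert i J'" "i \<notin> J'" "finite J'" using True finJ by (auto simp: J'_def)
      have "{l \<in> insert i J'. l < i} = {}" using JT J imin by force
      then have e: "(-1::complex) ^ card {l \<in> insert i J'. l < i} * z (insert i J') = z J"
        using J(1) by (simp only: card.empty power_0 mult_1)
      have "I - J' = insert i (I - J)" using J iT assms by auto
      then have "koszul_diff I z J' =
          z J + (\<Sum>k\<in>I - J. (- 1) ^ card {l \<in> insert k J'. l < k} * z (insert k J'))"
        unfolding koszul_diff_def using assms(1) \<open>i \<in> J\<close> e by simp
      moreover have "koszul_diff I y J =
          (\<Sum>k\<in>I - J. - ((- 1) ^ card {l \<in> insert k J'. l < k} * z (insert k J')))"
        unfolding koszul_diff_def
      proof (intro sum.cong refl)
        fix k assume k: "k \<in> I - J"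
        have y: "y (insert k J) = z (insert k J')"
          using J k by (auto simp: y_def insert_Diff_if)
        show "(- 1) ^ card {l \<in> insert k J. l < k} * y (insert k J) =
            - ((- 1) ^ card {l \<in> insert k J'. l < k} * z (insert k J'))"
        proof (cases "k \<in> T")
          case True
          then have "i < k" using imin[of k] k iT \<open>i \<in> J\<close> by (auto simp: order_le_less)
          then show ?thesis
            using koszul_sign_insert[of J' i k, where 'c=complex] J k y by simp
        next
          case False
          then have "z (insert k J') = 0" using zT[of "insert k J'"] by auto
          then show ?thesis using y by simp
        qed
      qed
      moreover have "y' = z'" if "w = z' + s" "y' = - s" "w = 0" for y' z' w s :: complex
        using that by (simp add: add_eq_0_iff)
      ultimately show ?thesis unfolding sum_negf using dz[of J'] by blast
    qed
  qed
  then show "\<exists>y. (\<forall>J. y J \<noteq> 0 \<longrightarrow> J \<in> Pow T) \<and> koszul_diff I y = z" using yT by blast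
qed

lemma acyclic_family_empty: "acyclic_family I {}"
  unfolding acyclic_family_def by (metis empty_iff ext)

text \<open>The Mayer-Vietoris argument on chains. A cycle is split as \<open>a + b\<close> with
  \<open>a\<close> on \<open>A\<close> and \<open>b\<close> on \<open>B\<close>; the boundary of
  \<open>a\<close> is a cycle on \<open>A \<inter> B\<close> and bounds some \<open>v\<close> there.
  Then \<open>a - v\<close> and \<open>b + v\<close> are cycles on \<open>A\<close> and on
  \<open>B\<close>, and their bounding chains add up to one for \<open>a + b\<close>.\<close>

lemma acyclic_family_Un:
  assumes I: "finite I" "A \<subseteq> Pow I"
    and A: "acyclic_family I A" "\<forall>K\<in>A. \<forall>J\<subseteq>K. J \<in> A"
    and B: "acyclic_family I B" "\<forall>K\<in>B. \<forall>J\<subseteq>K. J \<in> B"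
    and AB: "acyclic_family I (A \<inter> B)"
  shows "acyclic_family I (A \<union> B)"
  unfolding acyclic_family_def
proof (intro allI impI)
  fix z :: "'a set \<Rightarrow> complex"
  assume "(\<forall>J. z J \<noteq> 0 \<longrightarrow> J \<in> A \<union> B) \<and> koszul_diff I z = (\<lambda>_. 0)"
  then have zs: "\<And>J. z J \<noteq> 0 \<Longrightarrow> J \<in> A \<union> B" and dz: "koszul_diff I z = (\<lambda>_. 0)" by auto
  define a where "a J = (if J \<in> A then z J else 0)" for J
  define b where "b J = (if J \<in> A then 0 else z J)" for J
  have as: "\<And>J. a J \<noteq> 0 \<Longrightarrow> J \<in> A" by (auto simp: a_def split: if_splits)
  have bs: "\<And>J. b J \<noteq> 0 \<Longrightarrow> J \<in> B" using zs by (auto simp: b_def split: if_splits)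
  have z: "z = (\<lambda>J. a J + b J)" by (auto simp: a_def b_def)
  have db: "koszul_diff I b J = - koszul_diff I a J" for J
    using dz z koszul_diff_add[of I a b] by (metis add.commute add_eq_0_iff)
  \<comment> \<open>The boundary of \<open>a\<close> is minus that of \<open>b\<close>, and both
    families are closed under subsets, so its support lies in each of them.\<close>
  have das: "\<forall>J. koszul_diff I a J \<noteq> 0 \<longrightarrow> J \<in> A \<inter> B"
  proof (intro allI impI IntI)
    fix J assume J: "koszul_diff I a J \<noteq> 0"
    show "J \<in> A" using koszul_diff_supported[of a A I J] as A(2) J by simp
    have "koszul_diff I b J \<noteq> 0" using db J by simp
    then show "J \<in> B" using koszul_diff_supported[of b B I J] bs B(2) by simp
  qed
  have "finite J" if "a J \<noteq> 0" for J using that as I finite_subset by (metis PowD subsetD)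
  then have "koszul_diff I (koszul_diff I a) = (\<lambda>_. 0)"
    using koszul_diff_koszul_diff[OF I(1), of a] by auto
  from acyclic_familyD[OF AB das this]
  obtain v where vs: "\<forall>J. v J \<noteq> 0 \<longrightarrow> J \<in> A \<inter> B" and v: "koszul_diff I v = koszul_diff I a"
    by blast
  have "a J - v J \<noteq> 0 \<longrightarrow> J \<in> A" for J using as[of J] vs by (cases "a J = 0") auto
  then have 1: "\<forall>J. a J - v J \<noteq> 0 \<longrightarrow> J \<in> A" by simp
  have "koszul_diff I (\<lambda>J. a J - v J) = (\<lambda>_. 0)" using v by (simp add: koszul_diff_diff)
  from acyclic_familyD[OF A(1) 1 this]
  obtain p where ps: "\<forall>J. p J \<noteq> 0 \<longrightarrow> J \<in> A" and p: "koszul_diff I p = (\<lambda>J. a J - v J)"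
    by blast
  have "b J + v J \<noteq> 0 \<longrightarrow> J \<in> B" for J using bs[of J] vs by (cases "b J = 0") auto
  then have 2: "\<forall>J. b J + v J \<noteq> 0 \<longrightarrow> J \<in> B" by simp
  have "koszul_diff I (\<lambda>J. b J + v J) = (\<lambda>_. 0)" using v db by (simp add: koszul_diff_add)
  from acyclic_familyD[OF B(1) 2 this]
  obtain q where qs: "\<forall>J. q J \<noteq> 0 \<longrightarrow> J \<in> B" and q: "koszul_diff I q = (\<lambda>J. b J + v J)"
    by blast
  have "koszul_diff I (\<lambda>J. p J + q J) = z" using p q z by (simp add: koszul_diff_add)
  moreover have "J \<in> A \<union> B" if "p J + q J \<noteq> 0" for J
    using ps qs that by (cases "p J = 0") auto
  ultimately show "\<exists>y. (\<forall>J. y J \<noteq> 0 \<longrightarrow> J \<in> A \<union> B) \<and> koszul_diff I y = z"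
    by (intro exI[of _ "\<lambda>J. p J + q J"]) simp
qed

section \<open>Nerves of convex covers\<close>

text \<open>Because \<open>intersection_functor\<close> assigns the union to \<open>{}\<close>, the
  empty simplex belongs to the nerve exactly when some member is nonempty. The nerve is thus already
  augmented.\<close>

definition nerve :: "'i set \<Rightarrow> ('i \<Rightarrow> 'a set) \<Rightarrow> 'i set set" where
  "nerve I A = {J. J \<subseteq> I \<and> intersection_functor I A J \<noteq> {}}"

lemma intersection_functor_antimono:
  assumes "J \<subseteq> K" "K \<subseteq> I"
  shows "intersection_functor I A K \<subseteq> intersection_functor I A J"
  using assms unfolding intersection_functor_def by auto

lemma nerve_downward_closed:
  assumes "K \<in> nerve I A" "J \<subseteq> K"
  shows "J \<in> nerve I A"
  using assms intersection_functor_antimono[of J K I A] unfolding nerve_def by blast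

lemma finite_nerve: "finite I \<Longrightarrow> finite (nerve I A)"
  unfolding nerve_def by simp

lemma intersection_functor_Int:
  "intersection_functor I (\<lambda>i. A i \<inter> H) J = intersection_functor I A J \<inter> H"
  unfolding intersection_functor_def by auto

lemma convex_intersection_functor:
  assumes "\<And>i. i \<in> I \<Longrightarrow> convex (A i)" "convex (\<Union>i\<in>I. A i)" "J \<subseteq> I"
  shows "convex (intersection_functor I A J)"
  using assms unfolding intersection_functor_def by (auto intro!: convex_INT)

text \<open>The induction runs over the number of simplices. Compactness provides strict separation
  of two disjoint intersections, and strictness makes each half-space lose one of the two chosen
  simplices.\<close>

lemma acyclic_nerve_compact:
  fixes A :: "'i::linorder \<Rightarrow> 'a::euclidean_space set"
  assumes "finite I" "\<And>i. i \<in> I \<Longrightarrow> compact (A i)" "\<And>i. i \<in> I \<Longrightarrow> convex (A i)"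
    and "convex (\<Union>i\<in>I. A i)"
  shows "acyclic_family I (nerve I A)"
  using assms(2-)
proof (induction "card (nerve I A)" arbitrary: A rule: less_induct)
  case less
  let ?N = "nerve I A" and ?F = "intersection_functor I A"
  have finN: "finite ?N" using assms(1) finite_nerve by blast
  have convF: "convex (?F J)" if "J \<subseteq> I" for J
    by (intro convex_intersection_functor less.prems that)
  show ?case
  proof (cases "\<exists>J\<in>?N. \<exists>K\<in>?N. J \<union> K \<notin> ?N")
    case True
    then obtain J K where JK: "J \<in> ?N" "K \<in> ?N" "J \<union> K \<notin> ?N" by blast
    \<comment> \<open>If one of them were empty, the union would be the other one, which is a
      simplex.\<close>
    have ne: "J \<noteq> {}" "K \<noteq> {}" and sub: "J \<subseteq> I" "K \<subseteq> I" using JK by (auto simp: nerve_def)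
    have "?F J \<inter> ?F K = ?F (J \<union> K)" using ne by (auto simp: intersection_functor_def)
    then have disj: "?F J \<inter> ?F K = {}" using JK sub by (auto simp: nerve_def)
    have comp: "compact (?F S)" if "S \<noteq> {}" "S \<subseteq> I" for S
    proof -
      obtain i where i: "i \<in> S" using \<open>S \<noteq> {}\<close> by blast
      have "?F S = A i \<inter> (\<Inter>i\<in>S. A i)" using i that by (auto simp: intersection_functor_def)
      moreover have "closed (\<Inter>i\<in>S. A i)"
        using that less.prems(1) compact_imp_closed by (intro closed_INT) auto
      moreover have "compact (A i)" using i that less.prems(1) by blast
      ultimately show ?thesis by (simp only: compact_Int_closed)
    qed
    have "?F K \<noteq> {}" using JK(2) by (simp add: nerve_def)
    with separating_hyperplane_closed_compact[OF convF[OF sub(1)]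
        compact_imp_closed[OF comp[OF ne(1) sub(1)]] convF[OF sub(2)] comp[OF ne(2) sub(2)]]
    obtain w b where w: "\<forall>x\<in>?F J. w \<bullet> x < b" "\<forall>x\<in>?F K. w \<bullet> x > b"
      using disj by blast
    define Hl where "Hl = {x. w \<bullet> x \<le> b}"
    define Hg where "Hg = {x. w \<bullet> x \<ge> b}"
    have H: "convex Hl" "closed Hl" "convex Hg" "closed Hg"
      by (auto simp: Hl_def Hg_def convex_halfspace_le convex_halfspace_ge closed_halfspace_le closed_halfspace_ge)
    have IH: "acyclic_family I (nerve I (\<lambda>i. A i \<inter> H))"
      if "nerve I (\<lambda>i. A i \<inter> H) \<subset> ?N" "convex H" "closed H" for H
    proof (rule less.hyps)
      show "card (nerve I (\<lambda>i. A i \<inter> H)) < card ?N" using that(1) finN psubset_card_mono by blast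
      have "(\<Union>i\<in>I. A i \<inter> H) = (\<Union>i\<in>I. A i) \<inter> H" by auto
      then show "convex (\<Union>i\<in>I. A i \<inter> H)" using less.prems that convex_Int by metis
    qed (use less.prems that in \<open>auto intro: convex_Int\<close>)
    have sub_nerve: "nerve I (\<lambda>i. A i \<inter> H) \<subseteq> ?N" for H
      by (auto simp: nerve_def intersection_functor_Int)
    have "?F J \<inter> Hg = {}" "?F K \<inter> Hl = {}" using w by (auto simp: Hl_def Hg_def)
    then have Jl: "J \<notin> nerve I (\<lambda>i. A i \<inter> Hg)" and Kl: "K \<notin> nerve I (\<lambda>i. A i \<inter> Hl)"
      by (simp_all add: nerve_def intersection_functor_Int)
    \<comment> \<open>This identifies the third nerve with the intersection required by
      Mayer-Vietoris: a connected set meeting both half-spaces meets the hyperplane. For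
      \<open>S = {}\<close> the connected set is the whole union, and here its convexity is
      used.\<close>
    have int: "nerve I (\<lambda>i. A i \<inter> (Hl \<inter> Hg)) =
        nerve I (\<lambda>i. A i \<inter> Hl) \<inter> nerve I (\<lambda>i. A i \<inter> Hg)"
    proof (intro equalityI subsetI)
      fix S assume S: "S \<in> nerve I (\<lambda>i. A i \<inter> Hl) \<inter> nerve I (\<lambda>i. A i \<inter> Hg)"
      then have "S \<subseteq> I" by (auto simp: nerve_def)
      obtain x y where "x \<in> ?F S" "w \<bullet> x \<le> b" "y \<in> ?F S" "b \<le> w \<bullet> y"
        using S by (auto simp: nerve_def intersection_functor_Int Hl_def Hg_def)
      then obtain u where "u \<in> ?F S" "w \<bullet> u = b"
        using connected_ivt_hyperplane[of "?F S" x y w b] convex_connected convF[OF \<open>S \<subseteq> I\<close>] by auto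
      then show "S \<in> nerve I (\<lambda>i. A i \<inter> (Hl \<inter> Hg))"
        using \<open>S \<subseteq> I\<close> by (auto simp: nerve_def intersection_functor_Int Hl_def Hg_def)
    qed (auto simp: nerve_def intersection_functor_Int)
    have "Hl \<union> Hg = UNIV" by (auto simp: Hl_def Hg_def)
    then have "?F S = (?F S \<inter> Hl) \<union> (?F S \<inter> Hg)" for S by blast
    then have un: "?N = nerve I (\<lambda>i. A i \<inter> Hl) \<union> nerve I (\<lambda>i. A i \<inter> Hg)"
      unfolding nerve_def intersection_functor_Int by blast
    show ?thesis
      unfolding un
    proof (rule acyclic_family_Un[OF assms(1)])
      \<comment> \<open>The half-space \<open>Hl\<close> loses \<open>K\<close>, \<open>Hg\<close>
        loses \<open>J\<close>, and the hyperplane loses both, so all three nerves are strictly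
        smaller.\<close>
      have "nerve I (\<lambda>i. A i \<inter> Hl) \<subset> ?N" using Kl JK(2) sub_nerve by blast
      then show "acyclic_family I (nerve I (\<lambda>i. A i \<inter> Hl))" using IH H by blast
      have "nerve I (\<lambda>i. A i \<inter> Hg) \<subset> ?N" using Jl JK(1) sub_nerve by blast
      then show "acyclic_family I (nerve I (\<lambda>i. A i \<inter> Hg))" using IH H by blast
      have "nerve I (\<lambda>i. A i \<inter> (Hl \<inter> Hg)) \<subset> ?N" using int Jl JK sub_nerve by blast
      then show "acyclic_family I (nerve I (\<lambda>i. A i \<inter> Hl) \<inter> nerve I (\<lambda>i. A i \<inter> Hg))"
        using IH[of "Hl \<inter> Hg"] H int by (simp add: convex_Int closed_Int)
      show "nerve I (\<lambda>i. A i \<inter> Hl) \<subseteq> Pow I" by (auto simp: nerve_def)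
    qed (use nerve_downward_closed in blast)+
  next
    case False
    show ?thesis
    proof (cases "?N = {}")
      case True
      then show ?thesis by (simp add: acyclic_family_empty)
    next
      case ne: False
      \<comment> \<open>Closure under binary unions yields a largest simplex, and the nerve consists
        of its subsets.\<close>
      have "\<Union>S \<in> ?N" if "finite S" "S \<noteq> {}" "S \<subseteq> ?N" for S
        using that by (induction rule: finite_ne_induct) (use False in simp_all)
      then have T: "\<Union>?N \<in> ?N" using finN ne by blast
      then have N: "?N = Pow (\<Union>?N)" using nerve_downward_closed by blast
      \<comment> \<open>The power set of \<open>{}\<close> would not be acyclic. It cannot occur: if
        the empty simplex is present, some \<open>A i\<close> is nonempty and \<open>{i}\<close> is
        a simplex as well.\<close>
      have "\<Union>?N \<noteq> {}"
      proof -
        have "{} \<in> ?N" using N by blast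
        then obtain i where "i \<in> I" "A i \<noteq> {}" by (auto simp: nerve_def intersection_functor_def)
        then have "{i} \<in> ?N" by (auto simp: nerve_def intersection_functor_def)
        then show ?thesis by blast
      qed
      then show ?thesis
        using acyclic_family_simplex[OF assms(1), of "\<Union>?N"] T N by (auto simp: nerve_def)
    qed
  qed
qed

text \<open>The reduction to compact sets keeps the nerve: the convex hull is taken over one witness
  point for each simplex, including the empty one, so every intersection that was nonempty still
  is.\<close>

proposition acyclic_nerve:
  fixes A :: "'i::linorder \<Rightarrow> 'a::euclidean_space set"
  assumes "finite I" "\<And>i. i \<in> I \<Longrightarrow> closed (A i)" "\<And>i. i \<in> I \<Longrightarrow> convex (A i)"
    and "convex (\<Union>i\<in>I. A i)"
  shows "acyclic_family I (nerve I A)"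
proof -
  let ?F = "intersection_functor I A"
  have "\<forall>J\<in>nerve I A. \<exists>x. x \<in> ?F J" by (auto simp: nerve_def)
  then obtain p where p: "\<And>J. J \<in> nerve I A \<Longrightarrow> p J \<in> ?F J" by metis
  define K where "K = convex hull (p ` nerve I A)"
  have K: "compact K" "convex K"
    using assms(1) finite_nerve[of I A] by (auto simp: K_def finite_imp_compact_convex_hull)
  have pK: "\<And>J. J \<in> nerve I A \<Longrightarrow> p J \<in> K" unfolding K_def by (simp add: hull_inc)
  have "?F J \<inter> K \<noteq> {}" if "J \<in> nerve I A" for J using p[OF that] pK[OF that] by blast
  then have "nerve I (\<lambda>i. A i \<inter> K) = nerve I A"
    unfolding nerve_def intersection_functor_Int by blast
  moreover have "acyclic_family I (nerve I (\<lambda>i. A i \<inter> K))"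
  proof (rule acyclic_nerve_compact[OF assms(1)])
    have "(\<Union>i\<in>I. A i \<inter> K) = (\<Union>i\<in>I. A i) \<inter> K" by auto
    then show "convex (\<Union>i\<in>I. A i \<inter> K)" using assms K convex_Int by metis
  qed (use assms K in \<open>auto intro: convex_Int simp: closed_Int_compact\<close>)
  ultimately show ?thesis by simp
qed

section \<open>Vertices of polyhedra\<close>

text \<open>Descent on the dimension of the face. A relative boundary point has a supporting
  hyperplane that cuts out a smaller nonempty face; a face without relative boundary is an affine
  subspace, and it is a single point because a closed convex set with an extreme point contains no
  line.\<close>

lemma nonempty_face_extreme_point:
  fixes D :: "'a::euclidean_space set"
  assumes "closed D" "convex D" "e extreme_point_of D" "G face_of D" "G \<noteq> {}"
  shows "\<exists>m\<in>G. m extreme_point_of D"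
  using assms(4,5)
\<comment> \<open>Affine dimension is at least -1, so the shift by one makes \<open>nat\<close>
  preserve strict inequalities.\<close>
proof (induction "nat (aff_dim G + 1)" arbitrary: G rule: less_induct)
  case less
  have G: "closed G" "convex G" "G \<subseteq> D"
    using less.prems assms(1,2) face_of_imp_closed face_of_imp_convex face_of_imp_subset by blast+
  show ?case
  proof (cases "rel_interior G = G")
    case True
    \<comment> \<open>A nonempty set that is open and closed in its connected affine hull fills the
      hull.\<close>
    then have "openin (top_of_set (affine hull G)) G" by (simp add: rel_interior_eq)
    moreover have "closedin (top_of_set (affine hull G)) G"
      using G(1) by (simp add: closed_subset hull_subset)
    moreover have "connected (affine hull G)" by (simp add: affine_imp_convex convex_connected)
    ultimately have "G = affine hull G"
      using less.prems(2) unfolding connected_clopen by blast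
    then have aff: "affine G" by (metis affine_affine_hull)
    obtain a where a: "a \<in> G" using less.prems by blast
    have "b = a" if b: "b \<in> G" for b
    proof (rule ccontr)
      assume "b \<noteq> a"
      define d where "d = b - a"
      have line: "a + t *\<^sub>R d \<in> D" for t
      proof -
        have "(1 - t) *\<^sub>R a + t *\<^sub>R b \<in> G" using aff a b unfolding affine_def by simp
        then show ?thesis using G(3) by (auto simp: d_def algebra_simps)
      qed
      have eD: "e \<in> D" using assms(3) by (simp add: extreme_point_of_def)
      \<comment> \<open>A direction of lineality at \<open>a\<close> is one at \<open>e\<close>: join \<open>e\<close> to far away points of the line.\<close>
      have shift: "e + t *\<^sub>R d \<in> D" for t
      proof -
        have "e + t *\<^sub>R d + inverse (real (Suc n)) *\<^sub>R (a - e) \<in> D" for n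
        proof -
          let ?s = "inverse (real (Suc n))"
          have "(1 - ?s) *\<^sub>R e + ?s *\<^sub>R (a + (t * real (Suc n)) *\<^sub>R d) \<in> D"
            using assms(2) eD line[of "t * real (Suc n)"] by (intro convexD) (auto simp: field_simps)
          moreover have "?s * (t * real (Suc n)) = t" by (simp add: field_simps del: of_nat_Suc)
          ultimately show ?thesis by (simp add: algebra_simps del: of_nat_Suc)
        qed
        moreover have "(\<lambda>n. e + t *\<^sub>R d + inverse (real (Suc n)) *\<^sub>R (a - e))
            \<longlonglongrightarrow> e + t *\<^sub>R d + 0 *\<^sub>R (a - e)"
          by (intro tendsto_intros LIMSEQ_inverse_real_of_nat)
        ultimately have "e + t *\<^sub>R d + 0 *\<^sub>R (a - e) \<in> D"
          by (rule closed_sequentially[OF assms(1)])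
        then show ?thesis by simp
      qed
      have "e \<in> open_segment (e + (-1) *\<^sub>R d) (e + 1 *\<^sub>R d)"
        unfolding in_segment
      proof
        show "e + (-1) *\<^sub>R d \<noteq> e + 1 *\<^sub>R d"
        proof
          assume "e + (-1) *\<^sub>R d = e + 1 *\<^sub>R d"
          then have "2 *\<^sub>R d = 0" by (simp add: scaleR_2 eq_neg_iff_add_eq_0 neg_eq_iff_add_eq_0)
          then show False using \<open>b \<noteq> a\<close> by (simp add: d_def)
        qed
        show "\<exists>u>0. u < 1 \<and> e = (1 - u) *\<^sub>R (e + (-1) *\<^sub>R d) + u *\<^sub>R (e + 1 *\<^sub>R d)"
          by (rule exI[of _ "1/2"]) (simp add: algebra_simps flip: scaleR_left.add)
      qed
      then show False using assms(3) shift unfolding extreme_point_of_def by blast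
    qed
    then have "G = {a}" using a by blast
    then show ?thesis using less.prems(1) by (simp add: face_of_singleton)
  next
    case False
    then obtain x where x: "x \<in> G" "x \<notin> rel_interior G" using rel_interior_subset by blast
    obtain w where w: "\<And>y. y \<in> G \<Longrightarrow> w \<bullet> x \<le> w \<bullet> y" "\<And>y. y \<in> rel_interior G \<Longrightarrow> w \<bullet> x < w \<bullet> y"
      by (rule supporting_hyperplane_rel_boundary[OF G(2) x]) metis
    define G' where "G' = G \<inter> {y. w \<bullet> y = w \<bullet> x}"
    have face: "G' face_of G"
      unfolding G'_def by (rule face_of_Int_supporting_hyperplane_ge[OF G(2) w(1)])
    have "G' \<noteq> {}" using x by (auto simp: G'_def)
    have "rel_interior G \<noteq> {}" using rel_interior_eq_empty[OF G(2)] less.prems(2) by simp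
    then obtain y where "y \<in> rel_interior G" by blast
    then have "y \<in> G" "y \<notin> G'" using w(2)[of y] rel_interior_subset[of G] by (auto simp: G'_def)
    then have "G' \<noteq> G" by blast
    then have "aff_dim G' < aff_dim G" using face_of_aff_dim_lt[OF G(2) face] by simp
    then have "nat (aff_dim G' + 1) < nat (aff_dim G + 1)"
      using aff_dim_geq[of G'] by linarith
    moreover have "G' face_of D" using face less.prems face_of_trans by blast
    ultimately show ?thesis using less.hyps[of G'] \<open>G' \<noteq> {}\<close> by (auto simp: G'_def)
  qed
qed

text \<open>With \<open>m\<close> a vertex minimal at a relative interior point \<open>z\<close>,
  the function \<open>m \<bullet> v - l v\<close> is linear, nonnegative on \<sigma> and zero at
  \<open>z\<close>. Such a function vanishes on all of \<sigma>, so \<open>m\<close> is minimal for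
  every \<open>v\<close> in \<sigma>.\<close>

lemma vertex_minimizing_on_cone:
  assumes D: "lattice_polyhedron M D" and \<sigma>: "convex \<sigma>" "\<sigma> \<noteq> {}" and l: "linear l"
    and min: "\<And>v. v \<in> \<sigma> \<Longrightarrow> \<exists>u\<in>D. u \<bullet> v = l v" "\<And>u v. v \<in> \<sigma> \<Longrightarrow> u \<in> D \<Longrightarrow> l v \<le> u \<bullet> v"
  obtains m where "m \<in> D" "m \<in> M" "\<And>u v. u \<in> D \<Longrightarrow> v \<in> \<sigma> \<Longrightarrow> m \<bullet> v \<le> u \<bullet> v"
proof -
  obtain z where z: "z \<in> rel_interior \<sigma>" using \<sigma> rel_interior_eq_empty by blast
  then have z\<sigma>: "z \<in> \<sigma>" using rel_interior_subset by blast
  have D': "closed D" "convex D"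
    using D by (simp_all add: lattice_polyhedron_def polyhedron_imp_closed polyhedron_imp_convex)
  obtain e where e: "e extreme_point_of D" using D unfolding lattice_polyhedron_def by blast
  define G where "G = D \<inter> {u. z \<bullet> u = l z}"
  have "G face_of D"
    unfolding G_def using min(2)[OF z\<sigma>]
    by (intro face_of_Int_supporting_hyperplane_ge D') (simp add: inner_commute)
  moreover have "G \<noteq> {}" using min(1)[OF z\<sigma>] by (auto simp: G_def inner_commute)
  ultimately obtain m where m: "m \<in> G" "m extreme_point_of D"
    using nonempty_face_extreme_point[OF D' e] by blast
  have mD: "m \<in> D" and mz: "m \<bullet> z = l z" using m by (auto simp: G_def inner_commute)
  have "m \<in> M" using m(2) D unfolding lattice_polyhedron_def by blast
  moreover have "m \<bullet> v \<le> u \<bullet> v" if u: "u \<in> D" and v: "v \<in> \<sigma>" for u v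
  proof -
    \<comment> \<open>The segment from \<open>v\<close> to \<open>z\<close> can be prolonged beyond
      \<open>z\<close> inside \<sigma>. At its end the coefficient \<open>1 - c\<close> of
      \<open>v\<close> is negative, so the inequality there reverses into the one wanted at
      \<open>v\<close>.\<close>
    obtain c where c: "c > 1" "(1 - c) *\<^sub>R v + c *\<^sub>R z \<in> \<sigma>"
      using z convex_rel_interior_iff[OF \<sigma>] v by auto
    have "l ((1 - c) *\<^sub>R v + c *\<^sub>R z) \<le> m \<bullet> ((1 - c) *\<^sub>R v + c *\<^sub>R z)" by (rule min(2)[OF c(2) mD])
    then have "(1 - c) * l v \<le> (1 - c) * (m \<bullet> v)"
      using mz l by (simp add: linear_add linear_scale inner_add_right)
    then have "m \<bullet> v \<le> l v" using c(1) by (simp add: mult_le_cancel_left)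
    then show ?thesis using min(2)[OF v u] by simp
  qed
  ultimately show ?thesis using that mD by blast
qed

lemma convex_dual_cone: "convex (dual_cone M C)"
proof -
  have "dual_cone M C = span M \<inter> (\<Inter>u\<in>C. {v. u \<bullet> v \<ge> 0})" by (auto simp: dual_cone_def)
  then show ?thesis
    by (simp only:) (intro convex_Int convex_INT convex_halfspace_ge subspace_imp_convex subspace_span)
qed

lemma closed_dual_cone: "closed (dual_cone M C)"
proof -
  have "dual_cone M C = span M \<inter> (\<Inter>u\<in>C. {v. u \<bullet> v \<ge> 0})" by (auto simp: dual_cone_def)
  then show ?thesis
    by (simp only:) (intro closed_INT ballI closed_Int closed_halfspace_ge closed_span)
qed

lemma normal_fan_cone:
  assumes "\<sigma> \<in> normal_fan M D"
  shows "convex \<sigma>" "\<sigma> \<noteq> {}"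
  using assms unfolding normal_fan_def by (auto intro: face_of_imp_convex)

lemma nef_polyhedra_vertex:
  assumes "D \<in> nef_polyhedra M (normal_fan M \<Delta>)" "D \<noteq> {}" "\<sigma> \<in> normal_fan M \<Delta>"
  obtains m where "m \<in> D" "m \<in> M" "\<And>u v. u \<in> D \<Longrightarrow> v \<in> \<sigma> \<Longrightarrow> m \<bullet> v \<le> u \<bullet> v"
proof -
  have D: "lattice_polyhedron M D" using assms by (auto simp: nef_polyhedra_def)
  have "\<exists>l::'a \<Rightarrow> real. linear l \<and> (\<forall>v\<in>\<sigma>. (\<exists>u\<in>D. u \<bullet> v = l v) \<and> (\<forall>u\<in>D. l v \<le> u \<bullet> v))"
    using assms unfolding nef_polyhedra_def by blast
  then obtain l :: "'a \<Rightarrow> real" where l: "linear l"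
      "\<forall>v\<in>\<sigma>. (\<exists>u\<in>D. u \<bullet> v = l v) \<and> (\<forall>u\<in>D. l v \<le> u \<bullet> v)"
    by auto
  show ?thesis
    by (rule vertex_minimizing_on_cone[OF D normal_fan_cone[OF assms(3)] l(1)])
      (use l(2) that in auto)
qed

lemma nef_polyhedra_closed_convex:
  assumes "D \<in> nef_polyhedra M \<Sigma>"
  shows "closed D" "convex D" "D \<subseteq> span M"
  using assms by (auto simp: nef_polyhedra_def lattice_polyhedron_def polyhedron_imp_closed polyhedron_imp_convex)

lemma sigma_family_acyclic:
  assumes S: "sigma_family M \<Sigma> I D"
  shows "acyclic_family I {J. J \<subseteq> I \<and> x \<in> intersection_functor I D J + dual_cone M \<sigma>}"
proof -
  let ?H = "(\<lambda>v. x - v) ` dual_cone M \<sigma>"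
  have "?H = (+) x ` uminus ` dual_cone M \<sigma>" by (simp add: image_image)
  then have H: "closed ?H" "convex ?H"
    by (simp_all only: closed_translation closed_negations closed_dual_cone
        convex_translation convex_negations convex_dual_cone)
  have "x \<in> B + dual_cone M \<sigma> \<longleftrightarrow> B \<inter> ?H \<noteq> {}" for B
  proof
    assume "x \<in> B + dual_cone M \<sigma>"
    then obtain b c where "b \<in> B" "c \<in> dual_cone M \<sigma>" "x = b + c" by (auto elim: set_plus_elim)
    then have "b \<in> B \<inter> ?H" by (auto intro!: image_eqI[of _ _ c])
    then show "B \<inter> ?H \<noteq> {}" by blast
  next
    assume "B \<inter> ?H \<noteq> {}"
    then obtain c where "c \<in> dual_cone M \<sigma>" "x - c \<in> B" by auto
    then show "x \<in> B + dual_cone M \<sigma>" using set_plus_intro[of "x - c" B c] by simp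
  qed
  then have "{J. J \<subseteq> I \<and> x \<in> intersection_functor I D J + dual_cone M \<sigma>} =
      nerve I (\<lambda>i. D i \<inter> ?H)"
    by (simp add: nerve_def intersection_functor_Int)
  moreover have "acyclic_family I (nerve I (\<lambda>i. D i \<inter> ?H))"
  proof (rule acyclic_nerve)
    have "(\<Union>i\<in>I. D i \<inter> ?H) = (\<Union>i\<in>I. D i) \<inter> ?H" by auto
    \<comment> \<open>A \<Sigma>-family has a polyhedron as its union; this supplies the convexity
      on which the nerve argument depends.\<close>
    moreover have "convex (\<Union>i\<in>I. D i)"
      by (rule nef_polyhedra_closed_convex(2)[of _ M \<Sigma>]) (use S in \<open>simp add: sigma_family_def\<close>)
    ultimately show "convex (\<Union>i\<in>I. D i \<inter> ?H)"
      using H by (simp only: convex_Int)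
  next
    fix i assume "i \<in> I"
    then have "D i \<in> nef_polyhedra M \<Sigma>" using S by (simp add: sigma_family_def)
    then show "closed (D i \<inter> ?H)" "convex (D i \<inter> ?H)"
      using H nef_polyhedra_closed_convex(1,2)[of "D i" M \<Sigma>] by (simp_all only: convex_Int closed_Int)
  next
    show "finite I" using S by (simp add: sigma_family_def)
  qed
  ultimately show ?thesis by simp
qed

lemma intersection_functor_nef:
  assumes "sigma_family M \<Sigma> I D" "J \<subseteq> I"
  shows "intersection_functor I D J \<in> nef_polyhedra M \<Sigma>"
  using assms by (auto simp: sigma_family_def intersection_functor_def)

section \<open>Prime ideals of subrings\<close>

text \<open>Together with \<open>ideal_of\<close>, an elementary description on bare subsets of a
  type-class ring. The records behind \<open>spectrum\<close> are met only in the bridge lemmas up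
  to \<open>spectrum_iff\<close>.\<close>

definition is_subring :: "'r::comm_ring_1 set \<Rightarrow> bool" where
  "is_subring A \<longleftrightarrow> 1 \<in> A \<and> (\<forall>a\<in>A. - a \<in> A) \<and> (\<forall>a\<in>A. \<forall>b\<in>A. a + b \<in> A \<and> a * b \<in> A)"

lemma is_subring_zero: "is_subring A \<Longrightarrow> 0 \<in> A"
  unfolding is_subring_def by (metis add.right_inverse)

lemma cring_ring_on:
  assumes "is_subring A"
  shows "cring (ring_on A)"
proof (rule cringI)
  show "abelian_group (ring_on A)"
    by (rule abelian_groupI)
      (use assms is_subring_zero[OF assms] in \<open>auto simp: ring_on_def is_subring_def algebra_simps
        intro!: bexI[of _ "- _"]\<close>)
  show "comm_monoid (ring_on A)"
    by (rule comm_monoidI)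
      (use assms in \<open>auto simp: ring_on_def is_subring_def algebra_simps\<close>)
qed (simp add: ring_on_def algebra_simps)

definition ideal_of :: "'r::comm_ring_1 set \<Rightarrow> 'r set \<Rightarrow> bool" where
  "ideal_of A P \<longleftrightarrow> P \<subseteq> A \<and> 0 \<in> P \<and> (\<forall>a\<in>P. \<forall>b\<in>P. a + b \<in> P) \<and> (\<forall>a\<in>P. \<forall>x\<in>A. a * x \<in> P)"

lemma ideal_ring_on_iff:
  assumes A: "is_subring A"
  shows "ideal P (ring_on A) \<longleftrightarrow> ideal_of A P"
proof
  assume "ideal P (ring_on A)"
  then interpret ideal P "ring_on A" .
  show "ideal_of A P"
    unfolding ideal_of_def
    using a_subset additive_subgroup.zero_closed[OF is_additive_subgroup]
      additive_subgroup.a_closed[OF is_additive_subgroup] I_r_closed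
    by (auto simp: ring_on_def)
next
  assume P: "ideal_of A P"
  interpret R: cring "ring_on A" by (rule cring_ring_on[OF A])
  have neg: "- a \<in> P" if "a \<in> P" for a
  proof -
    have "- 1 \<in> A" using A by (auto simp: is_subring_def)
    then have "a * - 1 \<in> P" using P that unfolding ideal_of_def by blast
    then show ?thesis by simp
  qed
  show "ideal P (ring_on A)"
  proof (rule idealI)
    show "subgroup P (add_monoid (ring_on A))"
    proof
      fix a assume a: "a \<in> P"
      then have "a \<in> A" "- a \<in> A" using neg P by (auto simp: ideal_of_def)
      then have "\<ominus>\<^bsub>ring_on A\<^esub> a = - a"
        by (intro R.minus_equality) (auto simp: ring_on_def)
      then show "inv\<^bsub>add_monoid (ring_on A)\<^esub> a \<in> P" using neg[OF a] by (simp add: a_inv_def)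
    qed (use P in \<open>auto simp: ring_on_def ideal_of_def\<close>)
  qed (use P R.ring_axioms in \<open>auto simp: ring_on_def ideal_of_def mult.commute\<close>)
qed

text \<open>Properness of the prime can be tested on 1 alone, since an ideal containing 1 is the
  whole ring.\<close>

lemma spectrum_iff:
  assumes A: "is_subring A"
  shows "P \<in> spectrum A \<longleftrightarrow>
    ideal_of A P \<and> 1 \<notin> P \<and> (\<forall>a\<in>A. \<forall>b\<in>A. a * b \<in> P \<longrightarrow> a \<in> P \<or> b \<in> P)"
proof
  assume "P \<in> spectrum A"
  then have "primeideal P (ring_on A)" by (simp add: spectrum_def)
  then interpret primeideal P "ring_on A" .
  have P: "ideal_of A P" using ideal_ring_on_iff[OF A] is_ideal by simp
  have "1 \<notin> P"
  proof
    assume "1 \<in> P"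
    then have "x \<in> P" if "x \<in> A" for x using P that unfolding ideal_of_def by (metis mult_1)
    then show False using I_notcarr P by (auto simp: ring_on_def ideal_of_def)
  qed
  then show "ideal_of A P \<and> 1 \<notin> P \<and> (\<forall>a\<in>A. \<forall>b\<in>A. a * b \<in> P \<longrightarrow> a \<in> P \<or> b \<in> P)"
    using P I_prime by (auto simp: ring_on_def)
next
  assume P: "ideal_of A P \<and> 1 \<notin> P \<and> (\<forall>a\<in>A. \<forall>b\<in>A. a * b \<in> P \<longrightarrow> a \<in> P \<or> b \<in> P)"
  have "primeideal P (ring_on A)"
  proof (rule primeidealI)
    show "ideal P (ring_on A)" using ideal_ring_on_iff[OF A] P by simp
    show "cring (ring_on A)" by (rule cring_ring_on[OF A])
    show "carrier (ring_on A) \<noteq> P" using A P by (auto simp: ring_on_def is_subring_def)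
  qed (use P in \<open>auto simp: ring_on_def\<close>)
  then show "P \<in> spectrum A" by (simp add: spectrum_def)
qed

text \<open>By Zorn there is a maximal ideal above \<open>J\<close> among those avoiding 1, and such
  an ideal is prime.\<close>

lemma ideal_le_prime:
  assumes A: "is_subring A" and J: "ideal_of A J" "1 \<notin> J"
  obtains P where "P \<in> spectrum A" "J \<subseteq> P"
proof -
  define S where "S = {K. ideal_of A K \<and> J \<subseteq> K \<and> 1 \<notin> K}"
  have chain: "\<Union>C \<in> S" if C: "C \<noteq> {}" "subset.chain S C" for C
  proof -
    have CS: "\<And>K. K \<in> C \<Longrightarrow> ideal_of A K \<and> J \<subseteq> K \<and> 1 \<notin> K"
      using C(2) by (auto simp: subset.chain_def S_def)
    have add: "a + b \<in> \<Union>C" if ab: "a \<in> \<Union>C" "b \<in> \<Union>C" for a b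
    proof -
      obtain K L where KL: "K \<in> C" "L \<in> C" "a \<in> K" "b \<in> L" using ab by blast
      then have "K \<subseteq> L \<or> L \<subseteq> K" using C(2) unfolding subset_chain_def by blast
      then have "a + b \<in> K \<or> a + b \<in> L" using CS KL unfolding ideal_of_def by (meson subsetD)
      then show ?thesis using KL by blast
    qed
    have "ideal_of A (\<Union>C)"
      unfolding ideal_of_def
    proof (intro conjI)
      show "\<Union>C \<subseteq> A" using CS unfolding ideal_of_def by blast
      show "0 \<in> \<Union>C" using CS C(1) unfolding ideal_of_def by blast
      show "\<forall>a\<in>\<Union>C. \<forall>b\<in>\<Union>C. a + b \<in> \<Union>C" using add by blast
      show "\<forall>a\<in>\<Union>C. \<forall>x\<in>A. a * x \<in> \<Union>C" using CS unfolding ideal_of_def by blast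
    qed
    moreover have "J \<subseteq> \<Union>C" using CS C(1) by blast
    moreover have "1 \<notin> \<Union>C" using CS by blast
    ultimately show ?thesis by (simp add: S_def)
  qed
  have "S \<noteq> {}" using J by (auto simp: S_def)
  then have "\<exists>P\<in>S. \<forall>K\<in>S. P \<subseteq> K \<longrightarrow> K = P"
    using subset_Zorn_nonempty[of S] chain by simp
  then obtain P where PS: "P \<in> S" and max: "\<And>K. K \<in> S \<Longrightarrow> P \<subseteq> K \<Longrightarrow> K = P"
    by blast
  have P: "ideal_of A P" "J \<subseteq> P" "1 \<notin> P" using PS by (auto simp: S_def)
  have Psub: "P \<subseteq> A" and P0: "0 \<in> P" and Padd: "\<And>a b. a \<in> P \<Longrightarrow> b \<in> P \<Longrightarrow> a + b \<in> P"
    and Pmult: "\<And>a x. a \<in> P \<Longrightarrow> x \<in> A \<Longrightarrow> a * x \<in> P"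
    using P(1) by (auto simp: ideal_of_def)
  have A': "\<And>a b. a \<in> A \<Longrightarrow> b \<in> A \<Longrightarrow> a + b \<in> A" "\<And>a b. a \<in> A \<Longrightarrow> b \<in> A \<Longrightarrow> a * b \<in> A" "1 \<in> A" "0 \<in> A"
    using A is_subring_zero[OF A] by (auto simp: is_subring_def)
  have "a \<in> P \<or> b \<in> P" if a: "a \<in> A" and b: "b \<in> A" and ab: "a * b \<in> P" for a b
  proof (rule ccontr)
    assume n: "\<not> (a \<in> P \<or> b \<in> P)"
    \<comment> \<open>The ideal generated by \<open>P\<close> and \<open>a\<close>. It is strictly
      larger than \<open>P\<close>, so by maximality it contains 1; multiplying the resulting
      equation by \<open>b\<close> puts \<open>b\<close> into \<open>P\<close>.\<close>
    define K where "K = {p + a * x | p x. p \<in> P \<and> x \<in> A}"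
    have PK: "P \<subseteq> K"
    proof
      fix p assume "p \<in> P"
      then show "p \<in> K" unfolding K_def using A'(4) by (intro CollectI exI[of _ p] exI[of _ 0]) simp
    qed
    have aK: "a \<in> K" unfolding K_def using P0 A'(3) by (intro CollectI exI[of _ 0] exI[of _ 1]) simp
    have "ideal_of A K"
      unfolding ideal_of_def
    proof (intro conjI ballI)
      show "K \<subseteq> A" using Psub A' a by (auto simp: K_def)
      show "0 \<in> K" using PK P0 by blast
    next
      fix u v assume "u \<in> K" "v \<in> K"
      then obtain p x q y where "u = p + a * x" "v = q + a * y" "p \<in> P" "q \<in> P" "x \<in> A" "y \<in> A"
        by (auto simp: K_def)
      then have "u + v = (p + q) + a * (x + y)" "p + q \<in> P" "x + y \<in> A"
        using Padd A' by (auto simp: algebra_simps)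
      then show "u + v \<in> K" unfolding K_def by blast
    next
      fix u y assume "u \<in> K" and y: "y \<in> A"
      then obtain p x where "u = p + a * x" "p \<in> P" "x \<in> A" by (auto simp: K_def)
      then have "u * y = p * y + a * (x * y)" "p * y \<in> P" "x * y \<in> A"
        using Pmult A' y by (auto simp: algebra_simps)
      then show "u * y \<in> K" unfolding K_def by blast
    qed
    then have "1 \<in> K" using max[of K] PK aK n P(2) by (auto simp: S_def)
    then obtain p x where px: "1 = p + a * x" "p \<in> P" "x \<in> A" by (auto simp: K_def)
    have "b = p * b + a * b * x" using px(1) by (metis distrib_right mult.assoc mult.commute mult_1)
    moreover have "p * b + a * b * x \<in> P" using Padd Pmult px b ab by blast
    ultimately show False using n by simp
  qed
  then have "P \<in> spectrum A" using spectrum_iff[OF A] P by blast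
  then show thesis using that P(2) by blast
qed

text \<open>Guarantees that charts are nonempty, so that the convention of zero sections over the
  empty set does not apply to them.\<close>

lemma spectrum_nonempty:
  assumes "is_subring (A :: 'r::idom set)"
  obtains P where "P \<in> spectrum A"
proof (rule ideal_le_prime[OF assms])
  show "ideal_of A {0}" using is_subring_zero[OF assms] by (auto simp: ideal_of_def)
qed auto

section \<open>Localizations\<close>

lemma localize_zero: "S \<noteq> {} \<Longrightarrow> localize {0} S = {0}"
  by (auto simp: localize_def fract_collapse)

lemma localize_mono: "G \<subseteq> H \<Longrightarrow> localize G S \<subseteq> localize H S"
  by (auto simp: localize_def)

lemma localize_mult_image:
  "localize ((\<lambda>f. g * f) ` G) S = (\<lambda>h. Fract g 1 * h) ` localize G S"
proof (intro equalityI subsetI)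
  fix x assume "x \<in> localize ((\<lambda>f. g * f) ` G) S"
  then obtain f s where "x = Fract (g * f) s" "f \<in> G" "s \<in> S" by (auto simp: localize_def)
  then have "x = Fract g 1 * Fract f s" "Fract f s \<in> localize G S" by (auto simp: localize_def)
  then show "x \<in> (\<lambda>h. Fract g 1 * h) ` localize G S" by blast
next
  fix x assume "x \<in> (\<lambda>h. Fract g 1 * h) ` localize G S"
  then obtain f s where "x = Fract (g * f) s" "f \<in> G" "s \<in> S" by (auto simp: localize_def)
  then show "x \<in> localize ((\<lambda>f. g * f) ` G) S" unfolding localize_def by blast
qed

lemma spectrum_multiplicative:
  assumes A: "is_subring A" and P: "P \<in> spectrum A"
  shows "1 \<in> A - P" "\<And>s t. s \<in> A - P \<Longrightarrow> t \<in> A - P \<Longrightarrow> s * t \<in> A - P"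
    "0 \<notin> A - P" "P \<subseteq> A"
  using P A unfolding spectrum_iff[OF A] ideal_of_def is_subring_def by auto

lemma localize_embed:
  assumes A: "is_subring A" and P: "P \<in> spectrum A" and "f \<in> G"
  shows "Fract f 1 \<in> localize G (A - P)"
  using spectrum_multiplicative(1)[OF A P] assms(3) by (auto simp: localize_def)

lemma localize_mult:
  assumes A: "is_subring A" and P: "P \<in> spectrum A"
    and GH: "\<And>f g. f \<in> G \<Longrightarrow> g \<in> H \<Longrightarrow> f * g \<in> K"
    and "x \<in> localize G (A - P)" "y \<in> localize H (A - P)"
  shows "x * y \<in> localize K (A - P)"
proof -
  obtain f s g t where "x = Fract f s" "y = Fract g t" "f \<in> G" "g \<in> H" "s \<in> A - P" "t \<in> A - P"
    using assms(4,5) by (auto simp: localize_def)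
  then show ?thesis
    using GH[of f g] spectrum_multiplicative(2)[OF A P, of s t] unfolding localize_def by auto
qed

lemma localize_add:
  assumes A: "is_subring A" and P: "P \<in> spectrum A"
    and G: "\<And>f g. f \<in> G \<Longrightarrow> g \<in> G \<Longrightarrow> f + g \<in> G" "\<And>f g. f \<in> G \<Longrightarrow> g \<in> A \<Longrightarrow> f * g \<in> G"
    and "x \<in> localize G (A - P)" "y \<in> localize G (A - P)"
  shows "x + y \<in> localize G (A - P)"
proof -
  obtain f s g t where *: "x = Fract f s" "y = Fract g t" "f \<in> G" "g \<in> G" "s \<in> A - P" "t \<in> A - P"
    using assms(5,6) by (auto simp: localize_def)
  have "s \<noteq> 0" "t \<noteq> 0" using * spectrum_multiplicative(3)[OF A P] by metis+
  then have "x + y = Fract (f * t + g * s) (s * t)" using * by simp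
  moreover have "f * t + g * s \<in> G" using * G by blast
  moreover have "s * t \<in> A - P" using spectrum_multiplicative(2)[OF A P] * by blast
  ultimately show ?thesis unfolding localize_def by blast
qed

lemma localize_uminus:
  assumes "\<And>f. f \<in> G \<Longrightarrow> - f \<in> G" "x \<in> localize G S"
  shows "- x \<in> localize G (S :: 'r::idom set)"
proof -
  obtain f s where "x = Fract f s" "f \<in> G" "s \<in> S" using assms(2) by (auto simp: localize_def)
  then show ?thesis using assms(1)[of f] unfolding localize_def by auto
qed

text \<open>Over one denominator the differential of a tuple of germs can be computed on the
  numerators.\<close>

lemma common_denominator:
  assumes A: "is_subring (A :: 'r::idom set)" and P: "P \<in> spectrum A"
    and G: "\<And>j f g. j \<in> T \<Longrightarrow> f \<in> G j \<Longrightarrow> g \<in> A \<Longrightarrow> f * g \<in> G j"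
    and "finite T" "\<And>j. j \<in> T \<Longrightarrow> x j \<in> localize (G j) (A - P)"
  shows "\<exists>h\<in>A - P. \<forall>j\<in>T. \<exists>g\<in>G j. x j = Fract g h"
  using assms(4,5,3)
proof (induction T rule: finite_induct)
  case empty
  then show ?case using spectrum_multiplicative(1)[OF A P] by blast
next
  case (insert j T)
  then have "\<exists>h\<in>A - P. \<forall>j\<in>T. \<exists>g\<in>G j. x j = Fract g h" by simp
  then obtain h where h: "h \<in> A - P" "\<forall>j\<in>T. \<exists>g\<in>G j. x j = Fract g h" by blast
  obtain f s where fs: "f \<in> G j" "s \<in> A - P" "x j = Fract f s"
    using insert.prems(1)[of j] by (auto simp: localize_def)
  have nz: "h \<noteq> 0" "s \<noteq> 0" using h fs spectrum_multiplicative(3)[OF A P] by metis+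
  have "\<exists>g\<in>G k. x k = Fract g (h * s)" if k: "k \<in> insert j T" for k
  proof (cases "k = j")
    case True
    have "f * h \<in> G j" using insert.prems(2)[of j f h] fs h by blast
    moreover have "x j = Fract (f * h) (h * s)" using fs nz by (simp add: eq_fract)
    ultimately show ?thesis using True by blast
  next
    case False
    then obtain g where g: "g \<in> G k" "x k = Fract g h" using h k by blast
    have "g * s \<in> G k" using insert.prems(2)[of k g s] k g fs by blast
    moreover have "x k = Fract (g * s) (h * s)" using g nz by (simp add: eq_fract)
    ultimately show ?thesis by blast
  qed
  then show ?case using spectrum_multiplicative(2)[OF A P h(1) fs(2)] by blast
qed

text \<open>An integral domain is the intersection of its localizations at primes: the denominators
  of \<open>q\<close> form an ideal contained in no prime, hence the unit ideal.\<close>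

lemma Inter_localizations:
  assumes A: "is_subring (A :: 'r::idom set)"
    and q: "\<And>P. P \<in> spectrum A \<Longrightarrow> q \<in> localize A (A - P)"
  obtains f where "f \<in> A" "q = Fract f 1"
proof -
  have A': "\<And>a b. a \<in> A \<Longrightarrow> b \<in> A \<Longrightarrow> a + b \<in> A" "\<And>a b. a \<in> A \<Longrightarrow> b \<in> A \<Longrightarrow> a * b \<in> A" "1 \<in> A" "0 \<in> A"
    using A is_subring_zero[OF A] by (auto simp: is_subring_def)
  \<comment> \<open>The ideal of all \<open>a\<close> for which \<open>a * q\<close> lies in
    \<open>A\<close>; \<open>1 \<in> J\<close> is the claim.\<close>
  define J where "J = {a \<in> A. \<exists>f\<in>A. Fract a 1 * q = Fract f 1}"
  have "ideal_of A J"
    unfolding ideal_of_def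
  proof (intro conjI ballI)
    show "J \<subseteq> A" by (auto simp: J_def)
    show "0 \<in> J" using A' by (auto simp: J_def fract_collapse intro!: bexI[of _ 0])
  next
    fix a b assume "a \<in> J" "b \<in> J"
    then obtain f g where "f \<in> A" "g \<in> A" "Fract a 1 * q = Fract f 1" "Fract b 1 * q = Fract g 1"
        "a \<in> A" "b \<in> A"
      by (auto simp: J_def)
    moreover from this have "Fract (a + b) 1 * q = Fract (f + g) 1"
      using distrib_right[of "Fract a 1" "Fract b 1" q] by simp
    ultimately show "a + b \<in> J" using A' by (auto simp: J_def)
  next
    fix a b assume "a \<in> J" and b: "b \<in> A"
    then obtain f where "f \<in> A" "Fract a 1 * q = Fract f 1" "a \<in> A"
      by (auto simp: J_def)
    moreover from this have "Fract (a * b) 1 * q = Fract (f * b) 1"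
      using mult.assoc[of "Fract b 1" "Fract a 1" q] by (simp add: mult.commute)
    ultimately show "a * b \<in> J" using A' b by (auto simp: J_def)
  qed
  have "1 \<in> J"
  proof (rule ccontr)
    assume "1 \<notin> J"
    then obtain P where P: "P \<in> spectrum A" "J \<subseteq> P"
      using ideal_le_prime[OF A \<open>ideal_of A J\<close>] by blast
    obtain f s where fs: "q = Fract f s" "f \<in> A" "s \<in> A - P" using q[OF P(1)] by (auto simp: localize_def)
    then have "s \<noteq> 0" using spectrum_multiplicative(3)[OF A P(1)] by metis
    then have "Fract s 1 * q = Fract f 1" using fs by (simp add: eq_fract)
    then have "s \<in> J" using fs by (auto simp: J_def)
    then show False using fs P(2) by blast
  qed
  then show thesis using that by (auto simp: J_def fract_collapse)
qed

section \<open>Line bundles on the toric variety\<close>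

definition character :: "'a::euclidean_space \<Rightarrow> 'a group_algebra" where
  "character m = Group_Algebra (Poly_Mapping.single m 1)"

lemma coeffs_Group_Algebra [simp]: "coeffs (Group_Algebra p) = p"
  by (simp add: Group_Algebra_inverse)

lemma character_mult: "character a * character b = character (a + b)"
  by (rule coeffs_inject[THEN iffD1]) (simp add: character_def times_group_algebra.rep_eq mult_single)

lemma character_zero: "character 0 = 1"
  by (rule coeffs_inject[THEN iffD1]) (simp add: character_def one_group_algebra.rep_eq)

lemma character_nonzero [simp]: "character m \<noteq> 0"
proof
  assume "character m = 0"
  then have "character m * character (- m) = 0" by simp
  then show False by (simp add: character_mult character_zero)
qed

lemma monomial_one: "monomial m 1 = Fract (character m) 1"
  by (simp add: monomial_def character_def)

lemma monomial_mult_one: "monomial a 1 * monomial b 1 = monomial (a + b) 1"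
  by (simp add: monomial_one character_mult)

lemma monomial_nonzero: "monomial m 1 \<noteq> 0"
  by (simp add: monomial_one fract_expand eq_fract)

lemma character_mem_span: "m \<in> S \<Longrightarrow> character m \<in> span_characters S"
  by (simp add: span_characters_def character_def)

lemma span_characters_zero: "0 \<in> span_characters S"
  by (simp add: span_characters_def zero_group_algebra.rep_eq)

lemma span_characters_add:
  "f \<in> span_characters S \<Longrightarrow> g \<in> span_characters S \<Longrightarrow> f + g \<in> span_characters S"
  using Poly_Mapping.keys_add[of "coeffs f" "coeffs g"]
  by (auto simp: span_characters_def plus_group_algebra.rep_eq)

lemma span_characters_uminus: "f \<in> span_characters S \<Longrightarrow> - f \<in> span_characters S"
  by (simp add: span_characters_def uminus_group_algebra.rep_eq)

lemma span_characters_mult: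
  assumes "f \<in> span_characters S" "g \<in> span_characters T" "\<And>a b. a \<in> S \<Longrightarrow> b \<in> T \<Longrightarrow> a + b \<in> U"
  shows "f * g \<in> span_characters U"
  using Poly_Mapping.keys_mult[of "coeffs f" "coeffs g"] assms
  by (fastforce simp: span_characters_def times_group_algebra.rep_eq)

lemma span_characters_mono: "S \<subseteq> T \<Longrightarrow> span_characters S \<subseteq> span_characters T"
  by (auto simp: span_characters_def)

lemma span_characters_empty: "span_characters {} = {0}"
proof -
  have "f = 0" if "coeffs f = 0" for f :: "'a group_algebra"
    using that by (intro coeffs_inject[THEN iffD1]) (simp add: zero_group_algebra.rep_eq)
  then show ?thesis by (auto simp: span_characters_def zero_group_algebra.rep_eq)
qed

lemma dual_cone_zero: "0 \<in> dual_cone M C"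
  by (simp add: dual_cone_def span_zero)

lemma dual_cone_add: "u \<in> dual_cone M C \<Longrightarrow> v \<in> dual_cone M C \<Longrightarrow> u + v \<in> dual_cone M C"
  by (simp add: dual_cone_def span_add inner_add_right)

lemma chart_module_mono: "D \<subseteq> E \<Longrightarrow> chart_module M \<sigma> D \<subseteq> chart_module M \<sigma> E"
  unfolding chart_module_def by (intro span_characters_mono) (auto elim!: set_plus_elim intro: set_plus_intro)

section \<open>Chart rings, chart modules and their stalks\<close>

locale lattice_space =
  fixes M :: "'a::euclidean_space set"
  assumes lattice: "is_lattice M"
begin

lemma lattice_closed: "0 \<in> M" "a \<in> M \<Longrightarrow> b \<in> M \<Longrightarrow> a + b \<in> M" "a \<in> M \<Longrightarrow> - a \<in> M"
proof -
  obtain B where B: "M = {\<Sum>b\<in>B. of_int (k b) *\<^sub>R b | k :: 'a \<Rightarrow> int. True}"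
    using lattice unfolding is_lattice_def by auto
  show "0 \<in> M" unfolding B by (intro CollectI exI[of _ "\<lambda>_. 0"]) simp
  show "a + b \<in> M" if "a \<in> M" "b \<in> M"
  proof -
    obtain k l :: "'a \<Rightarrow> int" where kl: "a = (\<Sum>b\<in>B. of_int (k b) *\<^sub>R b)" "b = (\<Sum>b\<in>B. of_int (l b) *\<^sub>R b)"
      using \<open>a \<in> M\<close> \<open>b \<in> M\<close> unfolding B by auto
    show ?thesis
      unfolding B kl by (intro CollectI exI[of _ "\<lambda>x. k x + l x"]) (simp add: sum.distrib scaleR_add_left)
  qed
  show "- a \<in> M" if "a \<in> M"
  proof -
    obtain k :: "'a \<Rightarrow> int" where k: "a = (\<Sum>b\<in>B. of_int (k b) *\<^sub>R b)"
      using \<open>a \<in> M\<close> unfolding B by auto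
    show ?thesis
      unfolding B k by (intro CollectI exI[of _ "\<lambda>x. - k x"]) (simp add: sum_negf)
  qed
qed

lemma lattice_diff: "a \<in> M \<Longrightarrow> b \<in> M \<Longrightarrow> a - b \<in> M"
  using lattice_closed(2)[of a "- b"] lattice_closed(3) by simp

lemma is_subring_chart_ring: "is_subring (chart_ring M \<sigma>)"
  unfolding is_subring_def chart_ring_def
proof (intro conjI ballI)
  show "1 \<in> span_characters (dual_cone M \<sigma> \<inter> M)"
    using character_mem_span[of 0 "dual_cone M \<sigma> \<inter> M"]
    by (simp add: character_zero dual_cone_zero lattice_closed)
qed (auto intro: span_characters_uminus span_characters_add
    intro!: span_characters_mult dual_cone_add lattice_closed)

lemma chart_module_mult:
  assumes "f \<in> chart_module M \<sigma> D" "g \<in> chart_ring M \<sigma>"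
  shows "f * g \<in> chart_module M \<sigma> D"
  unfolding chart_module_def
proof (rule span_characters_mult)
  show "f \<in> span_characters ((D + dual_cone M \<sigma>) \<inter> M)" "g \<in> span_characters (dual_cone M \<sigma> \<inter> M)"
    using assms by (auto simp: chart_module_def chart_ring_def)
  fix a b assume a: "a \<in> (D + dual_cone M \<sigma>) \<inter> M" and b: "b \<in> dual_cone M \<sigma> \<inter> M"
  then obtain u v where "a = u + v" "u \<in> D" "v \<in> dual_cone M \<sigma>" by (auto elim: set_plus_elim)
  then have "a + b \<in> D + dual_cone M \<sigma>"
    using set_plus_intro[of u D "v + b" "dual_cone M \<sigma>"] dual_cone_add[of v M \<sigma> b] b
    by (simp add: add.assoc)
  then show "a + b \<in> (D + dual_cone M \<sigma>) \<inter> M" using a b lattice_closed by auto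
qed

lemma chart_module_add:
  "f \<in> chart_module M \<sigma> D \<Longrightarrow> g \<in> chart_module M \<sigma> D \<Longrightarrow> f + g \<in> chart_module M \<sigma> D"
  by (simp add: chart_module_def span_characters_add)

lemma chart_module_uminus: "f \<in> chart_module M \<sigma> D \<Longrightarrow> - f \<in> chart_module M \<sigma> D"
  by (simp add: chart_module_def span_characters_uminus)

lemma character_diff_mem_chart_ring:
  assumes "u \<in> M" "m \<in> M" "\<forall>v\<in>\<sigma>. m \<bullet> v \<le> u \<bullet> v"
  shows "character (u - m) \<in> chart_ring M \<sigma>"
proof -
  have "u - m \<in> M" using assms lattice_diff by blast
  moreover from this have "u - m \<in> dual_cone M \<sigma>"
    using assms(3) by (simp add: dual_cone_def span_base inner_diff_right inner_commute)
  ultimately show ?thesis unfolding chart_ring_def by (intro character_mem_span) simp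
qed

text \<open>Minimality of \<open>m\<close> on \<sigma> places \<open>D\<close> inside
  \<open>m + dual_cone M \<sigma>\<close>, so the exponents allowed in the module are exactly the
  translates by \<open>m\<close> of those of the ring. The module is free of rank one on the
  character of \<open>m\<close>.\<close>

lemma chart_module_shift:
  assumes m: "m \<in> D" "m \<in> M" and D: "D \<subseteq> span M" "\<forall>u\<in>D. \<forall>v\<in>\<sigma>. m \<bullet> v \<le> u \<bullet> v"
  shows "chart_module M \<sigma> D = (\<lambda>f. character m * f) ` chart_ring M \<sigma>"
proof (intro equalityI subsetI)
  fix f assume "f \<in> chart_module M \<sigma> D"
  then have f: "f \<in> span_characters ((D + dual_cone M \<sigma>) \<inter> M)" by (simp add: chart_module_def)
  have "character (- m) * f \<in> chart_ring M \<sigma>"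
    unfolding chart_ring_def
  proof (rule span_characters_mult[OF character_mem_span[of "- m" "{- m}"] f])
    fix a b assume a: "a \<in> {- m}" and b: "b \<in> (D + dual_cone M \<sigma>) \<inter> M"
    then obtain u c where uc: "b = u + c" "u \<in> D" "c \<in> dual_cone M \<sigma>" by (auto elim: set_plus_elim)
    have "w \<bullet> m \<le> w \<bullet> u" if "w \<in> \<sigma>" for w
      using D(2) uc(2) that by (metis inner_commute)
    moreover have "u - m \<in> span M" using D(1) m(1) uc(2) by (auto intro!: span_diff)
    ultimately have "u - m \<in> dual_cone M \<sigma>" by (simp add: dual_cone_def inner_diff_right)
    from dual_cone_add[OF this uc(3)] show "a + b \<in> dual_cone M \<sigma> \<inter> M"
      using a b m(2) uc(1) lattice_diff[of b m] by (simp add: algebra_simps)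
  qed simp
  moreover have "f = character m * (character (- m) * f)"
    by (simp add: character_mult character_zero flip: mult.assoc)
  ultimately show "f \<in> (\<lambda>f. character m * f) ` chart_ring M \<sigma>" by (rule rev_image_eqI)
next
  fix f assume "f \<in> (\<lambda>f. character m * f) ` chart_ring M \<sigma>"
  then obtain g where g: "f = character m * g" "g \<in> chart_ring M \<sigma>" by blast
  have "m \<in> D + dual_cone M \<sigma>" using set_plus_intro[OF m(1) dual_cone_zero] by simp
  then have "character m \<in> chart_module M \<sigma> D"
    using m(2) unfolding chart_module_def by (intro character_mem_span) simp
  then show "f \<in> chart_module M \<sigma> D" using g chart_module_mult by simp
qed

text \<open>The condition that \<open>toric_sheaf\<close> imposes at the point of \<open>P\<close>.
  For nef \<open>D\<close> and cones of the fan it depends only on the point and not on the chart,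
  by \<open>stalk_cong\<close>.\<close>

definition stalk :: "'a set \<Rightarrow> 'a set \<Rightarrow> 'a group_algebra set \<Rightarrow> 'a rational set" where
  "stalk \<sigma> D P = localize (chart_module M \<sigma> D) (chart_ring M \<sigma> - P)"

lemma stalk_shift:
  assumes "m \<in> D" "m \<in> M" "D \<subseteq> span M" "\<forall>u\<in>D. \<forall>v\<in>\<sigma>. m \<bullet> v \<le> u \<bullet> v"
  shows "stalk \<sigma> D P = (\<lambda>h. monomial m 1 * h) ` point M \<sigma> P"
  unfolding stalk_def point_def chart_module_shift[OF assms] localize_mult_image monomial_one ..

lemma stalk_empty:
  assumes "P \<in> spectrum (chart_ring M \<sigma>)"
  shows "stalk \<sigma> {} P = {0}"
proof -
  have "{} + dual_cone M \<sigma> = {}" by (auto elim: set_plus_elim)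
  then have "chart_module M \<sigma> {} = {0}" by (simp add: chart_module_def span_characters_empty)
  moreover have "chart_ring M \<sigma> - P \<noteq> {}"
    using spectrum_multiplicative(1)[OF is_subring_chart_ring assms] by blast
  ultimately show ?thesis by (simp add: stalk_def localize_zero)
qed

lemma point_embed:
  assumes "P \<in> spectrum (chart_ring M \<sigma>)" "f \<in> chart_ring M \<sigma>"
  shows "Fract f 1 \<in> point M \<sigma> P"
  unfolding point_def by (rule localize_embed[OF is_subring_chart_ring assms])

lemma point_mult:
  assumes "P \<in> spectrum (chart_ring M \<sigma>)" "x \<in> point M \<sigma> P" "y \<in> point M \<sigma> P"
  shows "x * y \<in> point M \<sigma> P"
  using localize_mult[OF is_subring_chart_ring assms(1) _ assms(2,3)[unfolded point_def]]
    is_subring_chart_ring[of \<sigma>] by (simp add: point_def is_subring_def)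

end

section \<open>The sheaves of nef polyhedra as line bundles\<close>

locale normal_fan_space = lattice_space M for M :: "'a::euclidean_space set" +
  fixes \<Delta> :: "'a set" and \<Sigma> :: "'a set set"
  assumes fan: "\<Sigma> = normal_fan M \<Delta>"
begin

lemma nef_vertex:
  assumes "D \<in> nef_polyhedra M \<Sigma>" "D \<noteq> {}" "\<sigma> \<in> \<Sigma>"
  obtains m where "m \<in> D" "m \<in> M" "\<forall>u\<in>D. \<forall>v\<in>\<sigma>. m \<bullet> v \<le> u \<bullet> v"
proof (rule nef_polyhedra_vertex[of D M \<Delta> \<sigma>])
  show "D \<in> nef_polyhedra M (normal_fan M \<Delta>)" "D \<noteq> {}" "\<sigma> \<in> normal_fan M \<Delta>"
    using assms by (simp_all add: fan)
qed (use that in blast)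

text \<open>
  The generators \<open>\<chi>\<^sup>m\<close> and \<open>\<chi>\<^sup>m\<^sup>'\<close> of the two modules differ by a unit of the common local ring: each
  of \<open>m\<close>, \<open>m'\<close> lies in \<open>D\<close>, so \<open>m - m'\<close> is nonnegative on \<open>\<sigma>'\<close> and \<open>m' - m\<close> is nonnegative on \<open>\<sigma>\<close>.
\<close>
lemma stalk_cong:
  assumes D: "D \<in> nef_polyhedra M \<Sigma>" and "\<sigma> \<in> \<Sigma>" "\<sigma>' \<in> \<Sigma>"
    and P: "P \<in> spectrum (chart_ring M \<sigma>)" "P' \<in> spectrum (chart_ring M \<sigma>')"
    and eq: "point M \<sigma> P = point M \<sigma>' P'"
  shows "stalk \<sigma> D P = stalk \<sigma>' D P'"
proof (cases "D = {}")
  case True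
  then show ?thesis using stalk_empty P by simp
next
  case False
  obtain m where m: "m \<in> D" "m \<in> M" "\<forall>u\<in>D. \<forall>v\<in>\<sigma>. m \<bullet> v \<le> u \<bullet> v"
    using nef_vertex[OF D False \<open>\<sigma> \<in> \<Sigma>\<close>] by blast
  obtain m' where m': "m' \<in> D" "m' \<in> M" "\<forall>u\<in>D. \<forall>v\<in>\<sigma>'. m' \<bullet> v \<le> u \<bullet> v"
    using nef_vertex[OF D False \<open>\<sigma>' \<in> \<Sigma>\<close>] by blast
  note Ds = nef_polyhedra_closed_convex(3)[OF D]
  have 1: "monomial (m - m') 1 \<in> point M \<sigma>' P'"
    unfolding monomial_one
    by (intro point_embed P character_diff_mem_chart_ring) (use m m' in simp_all)
  have 2: "monomial (m' - m) 1 \<in> point M \<sigma> P"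
    unfolding monomial_one
    by (intro point_embed P character_diff_mem_chart_ring) (use m m' in simp_all)
  have "(\<lambda>h. monomial m 1 * h) ` point M \<sigma> P = (\<lambda>h. monomial m' 1 * h) ` point M \<sigma>' P'"
  proof (intro equalityI subsetI; elim imageE)
    fix x h assume "x = monomial m 1 * h" "h \<in> point M \<sigma> P"
    then have "x = monomial m' 1 * (monomial (m - m') 1 * h)"
        "monomial (m - m') 1 * h \<in> point M \<sigma>' P'"
      using point_mult[OF P(2) 1] eq by (simp_all add: monomial_mult_one flip: mult.assoc)
    then show "x \<in> (\<lambda>h. monomial m' 1 * h) ` point M \<sigma>' P'" by blast
  next
    fix x h assume "x = monomial m' 1 * h" "h \<in> point M \<sigma>' P'"
    then have "x = monomial m 1 * (monomial (m' - m) 1 * h)"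
        "monomial (m' - m) 1 * h \<in> point M \<sigma> P"
      using point_mult[OF P(1) 2] eq by (simp_all add: monomial_mult_one flip: mult.assoc)
    then show "x \<in> (\<lambda>h. monomial m 1 * h) ` point M \<sigma> P" by blast
  qed
  then show ?thesis using stalk_shift[OF m(1,2) Ds m(3)] stalk_shift[OF m'(1,2) Ds m'(3)] by simp
qed

abbreviation (input) "X \<equiv> toric_variety M \<Sigma>"

lemma toric_sheafD:
  assumes "f \<in> toric_sheaf M \<Sigma> D U" "\<sigma> \<in> \<Sigma>" "P \<in> spectrum (chart_ring M \<sigma>)" "point M \<sigma> P \<in> U"
  shows "f \<in> stalk \<sigma> D P"
  using assms by (auto simp: toric_sheaf_def stalk_def)

lemma toric_sheaf_empty_open: "f \<in> toric_sheaf M \<Sigma> D {} \<Longrightarrow> f = 0"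
  by (simp add: toric_sheaf_def)

text \<open>The definition tests every chart through a point; by \<open>stalk_cong\<close> a single
  chart for each point suffices.\<close>

lemma toric_sheafI:
  assumes D: "D \<in> nef_polyhedra M \<Sigma>" and "U = {} \<Longrightarrow> f = 0"
    and f: "\<And>x. x \<in> U \<Longrightarrow>
      \<exists>\<sigma>\<in>\<Sigma>. \<exists>P\<in>spectrum (chart_ring M \<sigma>). x = point M \<sigma> P \<and> f \<in> stalk \<sigma> D P"
  shows "f \<in> toric_sheaf M \<Sigma> D U"
  unfolding toric_sheaf_def
proof (intro CollectI conjI ballI impI)
  fix \<sigma> P assume *: "\<sigma> \<in> \<Sigma>" "P \<in> spectrum (chart_ring M \<sigma>)" "point M \<sigma> P \<in> U"
  then obtain \<sigma>' P' where "\<sigma>' \<in> \<Sigma>" "P' \<in> spectrum (chart_ring M \<sigma>')"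
      "point M \<sigma> P = point M \<sigma>' P'" "f \<in> stalk \<sigma>' D P'"
    using f by blast
  then have "f \<in> stalk \<sigma> D P" using stalk_cong[OF D *(1) _ *(2)] by blast
  then show "f \<in> localize (chart_module M \<sigma> D) (chart_ring M \<sigma> - P)" by (simp add: stalk_def)
qed (use assms(2) in simp)

lemma topspace_toric_variety:
  "x \<in> topspace X \<longleftrightarrow> (\<exists>\<sigma>\<in>\<Sigma>. \<exists>P\<in>spectrum (chart_ring M \<sigma>). x = point M \<sigma> P)"
proof
  assume "x \<in> topspace X"
  then show "\<exists>\<sigma>\<in>\<Sigma>. \<exists>P\<in>spectrum (chart_ring M \<sigma>). x = point M \<sigma> P"
    by (auto simp: toric_variety_def basic_open_def)
next
  assume "\<exists>\<sigma>\<in>\<Sigma>. \<exists>P\<in>spectrum (chart_ring M \<sigma>). x = point M \<sigma> P"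
  then obtain \<sigma> P where *: "\<sigma> \<in> \<Sigma>" "P \<in> spectrum (chart_ring M \<sigma>)" "x = point M \<sigma> P" by blast
  have "1 \<in> chart_ring M \<sigma> - P" by (rule spectrum_multiplicative(1)[OF is_subring_chart_ring *(2)])
  then have "x \<in> basic_open M \<sigma> 1" "1 \<in> chart_ring M \<sigma>" using * by (auto simp: basic_open_def)
  then show "x \<in> topspace X" using *(1) by (auto simp: toric_variety_def)
qed

lemma openin_basic_open: "\<sigma> \<in> \<Sigma> \<Longrightarrow> f \<in> chart_ring M \<sigma> \<Longrightarrow> openin X (basic_open M \<sigma> f)"
  unfolding toric_variety_def by (rule topology_generated_by_Basis) blast

lemma openin_chart: "\<sigma> \<in> \<Sigma> \<Longrightarrow> openin X (chart M \<sigma>)"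
proof -
  assume \<sigma>: "\<sigma> \<in> \<Sigma>"
  have "{P \<in> spectrum (chart_ring M \<sigma>). 1 \<notin> P} = spectrum (chart_ring M \<sigma>)"
    using spectrum_multiplicative(1)[OF is_subring_chart_ring] by blast
  then have "chart M \<sigma> = basic_open M \<sigma> 1" by (simp add: chart_def basic_open_def)
  moreover have "1 \<in> chart_ring M \<sigma>" using is_subring_chart_ring by (simp add: is_subring_def)
  ultimately show ?thesis using openin_basic_open \<sigma> by simp
qed

text \<open>The trivialization over a chart: every stalk there is the local ring multiplied by one
  fixed monomial, so the same holds for sections over every subset of the chart.\<close>

lemma toric_sheaf_on_chart:
  assumes D: "D \<in> nef_polyhedra M \<Sigma>" and \<sigma>: "\<sigma> \<in> \<Sigma>" and W: "W \<subseteq> chart M \<sigma>"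
    and m: "m \<in> D" "m \<in> M" "\<forall>u\<in>D. \<forall>v\<in>\<sigma>. m \<bullet> v \<le> u \<bullet> v"
  shows "toric_sheaf M \<Sigma> D W = (\<lambda>h. monomial m 1 * h) ` structure_sheaf W"
proof -
  let ?g = "monomial m 1"
  note st = stalk_shift[OF m(1,2) nef_polyhedra_closed_convex(3)[OF D] m(3)]
  have Wp: "\<exists>P\<in>spectrum (chart_ring M \<sigma>). x = point M \<sigma> P" if "x \<in> W" for x
    using that W by (auto simp: chart_def)
  show ?thesis
  proof (intro equalityI subsetI)
    fix f assume f: "f \<in> toric_sheaf M \<Sigma> D W"
    have "inverse ?g * f \<in> x" if "x \<in> W" for x
    proof -
      obtain P where P: "P \<in> spectrum (chart_ring M \<sigma>)" "x = point M \<sigma> P" using Wp \<open>x \<in> W\<close> by blast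
      then have "f \<in> stalk \<sigma> D P" using toric_sheafD[OF f \<sigma>] \<open>x \<in> W\<close> by blast
      then obtain h where "h \<in> point M \<sigma> P" "f = ?g * h" unfolding st by blast
      then show ?thesis using P monomial_nonzero[of m] by (simp flip: mult.assoc)
    qed
    moreover have "inverse ?g * f = 0" if "W = {}"
      using that toric_sheaf_empty_open f by simp
    ultimately have "inverse ?g * f \<in> structure_sheaf W" by (simp add: structure_sheaf_def)
    moreover have "f = ?g * (inverse ?g * f)" using monomial_nonzero[of m] by (simp flip: mult.assoc)
    ultimately show "f \<in> (\<lambda>h. ?g * h) ` structure_sheaf W" by (rule rev_image_eqI)
  next
    fix f assume "f \<in> (\<lambda>h. ?g * h) ` structure_sheaf W"
    then obtain h where h: "f = ?g * h" "h \<in> structure_sheaf W" by blast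
    show "f \<in> toric_sheaf M \<Sigma> D W"
    proof (rule toric_sheafI[OF D])
      show "f = 0" if "W = {}" using h that by (simp add: structure_sheaf_def)
      fix x assume x: "x \<in> W"
      then obtain P where P: "P \<in> spectrum (chart_ring M \<sigma>)" "x = point M \<sigma> P" using Wp by blast
      have "h \<in> point M \<sigma> P" using h(2) x P(2) by (simp add: structure_sheaf_def)
      then have "f \<in> stalk \<sigma> D P" unfolding st h(1) by (rule imageI)
      then show "\<exists>\<sigma>\<in>\<Sigma>. \<exists>P\<in>spectrum (chart_ring M \<sigma>). x = point M \<sigma> P \<and> f \<in> stalk \<sigma> D P"
        using \<sigma> P by blast
    qed
  qed
qed

lemma line_bundle_toric_sheaf:
  assumes D: "D \<in> nef_polyhedra M \<Sigma>" "D \<noteq> {}"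
  shows "line_bundle X (toric_sheaf M \<Sigma> D)"
  unfolding line_bundle_def
proof
  fix x assume "x \<in> topspace X"
  then obtain \<sigma> P where P: "\<sigma> \<in> \<Sigma>" "P \<in> spectrum (chart_ring M \<sigma>)" "x = point M \<sigma> P"
    using topspace_toric_variety by blast
  obtain m where m: "m \<in> D" "m \<in> M" "\<forall>u\<in>D. \<forall>v\<in>\<sigma>. m \<bullet> v \<le> u \<bullet> v"
    using nef_vertex[OF D P(1)] by blast
  have "x \<in> chart M \<sigma>" using P by (auto simp: chart_def)
  moreover have "\<forall>W. openin X W \<and> W \<subseteq> chart M \<sigma> \<longrightarrow>
      toric_sheaf M \<Sigma> D W = (\<lambda>h. monomial m 1 * h) ` structure_sheaf W"
    using toric_sheaf_on_chart[OF D(1) P(1) _ m] by simp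
  ultimately show "\<exists>V. openin X V \<and> x \<in> V \<and> (\<exists>g. g \<noteq> 0 \<and> (\<forall>W. openin X W \<and> W \<subseteq> V \<longrightarrow>
      toric_sheaf M \<Sigma> D W = (\<lambda>h. g * h) ` structure_sheaf W))"
    using openin_chart[OF P(1)] monomial_nonzero[of m]
    by (intro exI[of _ "chart M \<sigma>"] conjI exI[of _ "monomial m 1"])
qed

lemma toric_sheaf_restrict:
  "f \<in> toric_sheaf M \<Sigma> D U \<Longrightarrow> V \<subseteq> U \<Longrightarrow> V \<noteq> {} \<Longrightarrow> f \<in> toric_sheaf M \<Sigma> D V"
  by (auto simp: toric_sheaf_def)

lemma globally_generated_toric_sheaf:
  assumes D: "D \<in> nef_polyhedra M \<Sigma>" "D \<noteq> {}"
  shows "globally_generated X (toric_sheaf M \<Sigma> D)"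
  unfolding globally_generated_def
proof (intro allI impI ballI)
  fix U s x assume U: "openin X U" and s: "s \<in> toric_sheaf M \<Sigma> D U" and x: "x \<in> U"
  have "x \<in> topspace X" using U x openin_subset by blast
  then obtain \<sigma> P where P: "\<sigma> \<in> \<Sigma>" "P \<in> spectrum (chart_ring M \<sigma>)" "x = point M \<sigma> P"
    using topspace_toric_variety by blast
  obtain m where m: "m \<in> D" "m \<in> M" "\<forall>u\<in>D. \<forall>v\<in>\<sigma>. m \<bullet> v \<le> u \<bullet> v"
    using nef_vertex[OF D P(1)] by blast
  define V where "V = U \<inter> chart M \<sigma>"
  have V: "openin X V" "V \<subseteq> U" "V \<subseteq> chart M \<sigma>" using U openin_chart[OF P(1)] by (auto simp: V_def)
  have xV: "x \<in> V" using x P by (auto simp: V_def chart_def)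
  have "s \<in> toric_sheaf M \<Sigma> D V" using toric_sheaf_restrict[OF s V(2)] xV by blast
  then obtain h where h: "s = monomial m 1 * h" "h \<in> structure_sheaf V"
    unfolding toric_sheaf_on_chart[OF D(1) P(1) V(3) m] by blast
  \<comment> \<open>The generator on the chart of \<open>x\<close> is a global section: since
    \<open>m\<close> lies in \<open>D\<close> itself, its character belongs to the module of every
    chart.\<close>
  have "monomial m 1 \<in> toric_sheaf M \<Sigma> D (topspace X)"
  proof (rule toric_sheafI[OF D(1)])
    show "monomial m 1 = 0" if "topspace X = {}" using that \<open>x \<in> topspace X\<close> by simp
    fix y assume "y \<in> topspace X"
    then obtain \<sigma>' P' where P': "\<sigma>' \<in> \<Sigma>" "P' \<in> spectrum (chart_ring M \<sigma>')" "y = point M \<sigma>' P'"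
      using topspace_toric_variety by blast
    have "m \<in> D + dual_cone M \<sigma>'" using set_plus_intro[OF m(1) dual_cone_zero] by simp
    then have "character m \<in> chart_module M \<sigma>' D"
      using m(2) unfolding chart_module_def by (intro character_mem_span) simp
    then have "monomial m 1 \<in> stalk \<sigma>' D P'"
      unfolding monomial_one stalk_def by (rule localize_embed[OF is_subring_chart_ring P'(2)])
    then show "\<exists>\<sigma>\<in>\<Sigma>. \<exists>P\<in>spectrum (chart_ring M \<sigma>). y = point M \<sigma> P \<and> monomial m 1 \<in> stalk \<sigma> D P"
      using P' by blast
  qed
  then show "\<exists>V A h. openin X V \<and> x \<in> V \<and> V \<subseteq> U \<and> finite A \<and> A \<subseteq> toric_sheaf M \<Sigma> D (topspace X) \<and>
      (\<forall>g\<in>A. h g \<in> structure_sheaf V) \<and> s = (\<Sum>g\<in>A. h g * g)"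
    using V xV h
    by (intro exI[of _ V] exI[of _ "{monomial m 1}"] exI[of _ "\<lambda>_. h"]) (simp add: mult.commute)
qed

text \<open>Openness ensures that a nonempty \<open>U\<close> contains a genuine point of the
  variety, where the stalk is zero; elements of \<open>U\<close> that are not points impose no
  condition.\<close>

lemma toric_sheaf_of_empty:
  assumes "openin X U"
  shows "toric_sheaf M \<Sigma> {} U = {0}"
proof (intro equalityI subsetI)
  fix f assume f: "f \<in> toric_sheaf M \<Sigma> {} U"
  show "f \<in> {0}"
  proof (cases "U = {}")
    case True
    then show ?thesis using f toric_sheaf_empty_open by simp
  next
    case False
    then obtain x where x: "x \<in> U" "x \<in> topspace X" using openin_subset[OF assms] by blast
    then obtain \<sigma> P where P: "\<sigma> \<in> \<Sigma>" "P \<in> spectrum (chart_ring M \<sigma>)" "x = point M \<sigma> P"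
      using topspace_toric_variety by blast
    then have "f \<in> stalk \<sigma> {} P" using toric_sheafD[OF f] x by blast
    then show ?thesis using stalk_empty[OF P(2)] by simp
  qed
next
  fix f :: "'a rational" assume "f \<in> {0}"
  then have "f = 0" by simp
  show "f \<in> toric_sheaf M \<Sigma> {} U"
    unfolding toric_sheaf_def
  proof (intro CollectI conjI ballI impI)
    fix \<sigma> P assume "P \<in> spectrum (chart_ring M \<sigma>)"
    then show "f \<in> localize (chart_module M \<sigma> {}) (chart_ring M \<sigma> - P)"
      using stalk_empty[of P \<sigma>] \<open>f = 0\<close> by (simp add: stalk_def)
  qed (use \<open>f = 0\<close> in simp)
qed

lemma structure_sheaf_chart:
  "structure_sheaf (chart M \<sigma>) = (\<lambda>f. Fract f 1) ` chart_ring M \<sigma>"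
proof (intro equalityI subsetI)
  fix q assume q: "q \<in> structure_sheaf (chart M \<sigma>)"
  have "q \<in> localize (chart_ring M \<sigma>) (chart_ring M \<sigma> - P)" if "P \<in> spectrum (chart_ring M \<sigma>)" for P
    using q that by (auto simp: structure_sheaf_def chart_def point_def)
  then obtain f where "f \<in> chart_ring M \<sigma>" "q = Fract f 1"
    using Inter_localizations[OF is_subring_chart_ring[of \<sigma>], of q] by blast
  then show "q \<in> (\<lambda>f. Fract f 1) ` chart_ring M \<sigma>" by blast
next
  fix q assume "q \<in> (\<lambda>f. Fract f 1) ` chart_ring M \<sigma>"
  then obtain f where f: "f \<in> chart_ring M \<sigma>" "q = Fract f 1" by blast
  have "chart M \<sigma> \<noteq> {}"
    using spectrum_nonempty[OF is_subring_chart_ring[of \<sigma>]] unfolding chart_def by blast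
  then show "q \<in> structure_sheaf (chart M \<sigma>)"
    using point_embed f by (auto simp: structure_sheaf_def chart_def)
qed

text \<open>Checks the stalkwise definition against the intended one: over a chart the sections are
  the prescribed module. The trivialization reduces this to the structure sheaf, where
  \<open>Inter_localizations\<close> applies.\<close>

proposition toric_sheaf_chart:
  assumes D: "D \<in> nef_polyhedra M \<Sigma>" and \<sigma>: "\<sigma> \<in> \<Sigma>"
  shows "toric_sheaf M \<Sigma> D (chart M \<sigma>) = (\<lambda>f. Fract f 1) ` chart_module M \<sigma> D"
proof (cases "D = {}")
  case True
  have "{} + dual_cone M \<sigma> = {}" by (auto elim: set_plus_elim)
  then have "chart_module M \<sigma> {} = {0}" by (simp add: chart_module_def span_characters_empty)
  then show ?thesis using True toric_sheaf_of_empty[OF openin_chart[OF \<sigma>]] by (simp add: fract_collapse)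
next
  case False
  obtain m where m: "m \<in> D" "m \<in> M" "\<forall>u\<in>D. \<forall>v\<in>\<sigma>. m \<bullet> v \<le> u \<bullet> v"
    using nef_vertex[OF D False \<sigma>] by blast
  show ?thesis
    unfolding toric_sheaf_on_chart[OF D \<sigma> subset_refl m] structure_sheaf_chart
      chart_module_shift[OF m(1,2) nef_polyhedra_closed_convex(3)[OF D] m(3)] image_image monomial_one
    by simp
qed

end

section \<open>Exactness\<close>

text \<open>The differential uses only sums and signs, so it commutes with every additive map.
  Additivity is assumed only on a subgroup \<open>K\<close>, because \<open>torus_act\<close> is
  controlled only on part of its type.\<close>

lemma koszul_diff_additive:
  fixes I :: "'i::linorder set" and K :: "'k::comm_ring_1 set" and \<phi> :: "'k \<Rightarrow> 'l::comm_ring_1"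
  assumes "0 \<in> K" "\<phi> 0 = 0"
    and "\<And>x. x \<in> K \<Longrightarrow> - x \<in> K \<and> \<phi> (- x) = - \<phi> x"
    and "\<And>x y. x \<in> K \<Longrightarrow> y \<in> K \<Longrightarrow> x + y \<in> K \<and> \<phi> (x + y) = \<phi> x + \<phi> y"
    and "\<And>J. c J \<in> K"
  shows "koszul_diff I (\<lambda>J. \<phi> (c J)) = (\<lambda>J. \<phi> (koszul_diff I c J))"
proof
  fix J
  have sign: "(- 1) ^ n * x \<in> K \<and> \<phi> ((- 1) ^ n * x) = (- 1) ^ n * \<phi> x" if "x \<in> K" for n x
    using that assms(3) by (simp add: minus_one_power_iff)
  have sum: "sum f A \<in> K \<and> \<phi> (sum f A) = (\<Sum>i\<in>A. \<phi> (f i))" if "\<And>i. f i \<in> K" for A and f :: "'i \<Rightarrow> 'k"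
    by (induction A rule: infinite_finite_induct) (use assms(1,2,4) that in auto)
  show "koszul_diff I (\<lambda>J. \<phi> (c J)) J = \<phi> (koszul_diff I c J)"
    unfolding koszul_diff_def using sum sign assms(5) by simp
qed

lemma koszul_diff_Fract:
  assumes "h \<noteq> 0"
  shows "koszul_diff I (\<lambda>J. Fract (g J) h) = (\<lambda>J. Fract (koszul_diff I g J) h)"
  by (rule koszul_diff_additive[of UNIV]) (use assms in \<open>auto simp: fract_collapse eq_fract algebra_simps\<close>)

lemma koszul_diff_lookup:
  "koszul_diff I (\<lambda>J. Poly_Mapping.lookup (coeffs (g J)) m) =
    (\<lambda>J. Poly_Mapping.lookup (coeffs (koszul_diff I g J)) m)"
  by (rule koszul_diff_additive[of UNIV])
    (auto simp: zero_group_algebra.rep_eq uminus_group_algebra.rep_eq plus_group_algebra.rep_eq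
      lookup_add)

lemma koszul_diff_monomial:
  "koszul_diff I (\<lambda>J. monomial m (z J)) = (\<lambda>J. monomial m (koszul_diff I z J))"
proof (rule koszul_diff_additive[of UNIV])
  have "Group_Algebra (Poly_Mapping.single m 0) = 0"
    by (rule coeffs_inject[THEN iffD1]) (simp add: zero_group_algebra.rep_eq)
  then show "monomial m 0 = 0" by (simp add: monomial_def fract_collapse)
  have "Group_Algebra (Poly_Mapping.single m (- x)) = - Group_Algebra (Poly_Mapping.single m x)" for x
    by (rule coeffs_inject[THEN iffD1]) (simp add: uminus_group_algebra.rep_eq single_uminus)
  then show "- x \<in> UNIV \<and> monomial m (- x) = - monomial m x" for x by (simp add: monomial_def)
  have "Group_Algebra (Poly_Mapping.single m (x + y)) =
      Group_Algebra (Poly_Mapping.single m x) + Group_Algebra (Poly_Mapping.single m y)" for x y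
    by (rule coeffs_inject[THEN iffD1]) (simp add: plus_group_algebra.rep_eq single_add)
  then show "x + y \<in> UNIV \<and> monomial m (x + y) = monomial m x + monomial m y" for x y
    by (simp add: monomial_def)
qed auto

definition finite_sum_characters :: "'a::euclidean_space set \<Rightarrow> ('a \<Rightarrow> complex) \<Rightarrow> 'a group_algebra" where
  "finite_sum_characters A c = (\<Sum>m\<in>A. Group_Algebra (Poly_Mapping.single m (c m)))"

lemma lookup_finite_sum_characters:
  assumes "finite A"
  shows "Poly_Mapping.lookup (coeffs (finite_sum_characters A c)) k = (if k \<in> A then c k else 0)"
proof -
  have "coeffs (finite_sum_characters A c) = (\<Sum>m\<in>A. Poly_Mapping.single m (c m))"
    unfolding finite_sum_characters_def
    by (induction A rule: infinite_finite_induct)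
      (simp_all add: zero_group_algebra.rep_eq plus_group_algebra.rep_eq)
  then show ?thesis using assms by (simp add: lookup_sum lookup_single when_def)
qed

lemma Fract_finite_sum_characters:
  "Fract (finite_sum_characters A c) 1 = (\<Sum>m\<in>A. monomial m (c m))"
  unfolding finite_sum_characters_def
proof (induction A rule: infinite_finite_induct)
  case (insert m A)
  have "Fract (f + g) 1 = Fract f 1 + Fract g 1" for f g :: "'a group_algebra" by simp
  then show ?case using insert by (simp add: monomial_def del: add_fract)
qed (simp_all add: fract_collapse)

lemma finite_sum_characters_mem:
  assumes "finite A" "\<And>m. m \<in> A \<Longrightarrow> c m \<noteq> 0 \<Longrightarrow> m \<in> S"
  shows "finite_sum_characters A c \<in> span_characters S"
  using assms by (auto simp: span_characters_def in_keys_iff lookup_finite_sum_characters split: if_splits)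

lemma group_algebra_eqI:
  assumes "\<And>m. Poly_Mapping.lookup (coeffs f) m = Poly_Mapping.lookup (coeffs g) m"
  shows "f = g"
  using assms coeffs_inject poly_mapping_eqI by metis

text \<open>The differential lowers degree by one, so the part of a bounding chain in degree
  \<open>p + 1\<close> alone accounts for a homogeneous \<open>z\<close> of degree
  \<open>p\<close>.\<close>

lemma acyclic_family_degree:
  fixes z :: "'i::linorder set \<Rightarrow> complex"
  assumes "acyclic_family I N" "N \<subseteq> Pow I" "finite I"
    and z: "\<forall>J. z J \<noteq> 0 \<longrightarrow> J \<in> N \<and> int (card J) = p" and dz: "koszul_diff I z = (\<lambda>_. 0)"
  shows "\<exists>y. (\<forall>J. y J \<noteq> 0 \<longrightarrow> J \<in> N \<and> int (card J) = p + 1) \<and> koszul_diff I y = z"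
proof -
  have "\<forall>J. z J \<noteq> 0 \<longrightarrow> J \<in> N" using z by simp
  from acyclic_familyD[OF assms(1) this dz] obtain y
    where y: "\<forall>J. y J \<noteq> 0 \<longrightarrow> J \<in> N" and dy: "koszul_diff I y = z" by blast
  define y' where "y' J = (if int (card J) = p + 1 then y J else 0)" for J
  have "koszul_diff I y' J = z J" for J
  proof (cases "finite J")
    case True
    show ?thesis
    proof (cases "int (card J) = p")
      case True
      then have "koszul_diff I y' J = koszul_diff I y J"
        unfolding koszul_diff_def y'_def using \<open>finite J\<close> by (intro sum.cong) auto
      then show ?thesis using dy by simp
    next
      case False
      then have "koszul_diff I y' J = 0"
        unfolding koszul_diff_def y'_def using \<open>finite J\<close> by (intro sum.neutral) auto
      then show ?thesis using False z by metis
    qed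
  next
    case False
    \<comment> \<open>Infinite sets have \<open>card\<close> 0 and could be mistaken for sets of
      degree 0; they carry no coefficient because \<open>N\<close> consists of subsets of the finite
      \<open>I\<close>.\<close>
    then have "\<not> insert i J \<subseteq> I" for i using assms(3) finite_subset by auto
    then have "y (insert i J) = 0" for i using y assms(2) by blast
    then have "koszul_diff I y' J = 0" "koszul_diff I y J = 0"
      unfolding koszul_diff_def y'_def by (auto intro!: sum.neutral)
    then show ?thesis using dy by simp
  qed
  then have "koszul_diff I y' = z" by auto
  moreover have "\<forall>J. y' J \<noteq> 0 \<longrightarrow> J \<in> N \<and> int (card J) = p + 1" using y by (simp add: y'_def)
  ultimately show ?thesis by (intro exI[of _ y']) simp
qed

lemma evaluation_complex_exact:
  assumes S: "sigma_family M \<Sigma> I D"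
    and z: "z \<in> evaluation_complex I (\<lambda>J. intersection_functor I D J + dual_cone M \<sigma>) m p"
    and dz: "koszul_diff I z = (\<lambda>_. 0)"
  shows "\<exists>y \<in> evaluation_complex I (\<lambda>J. intersection_functor I D J + dual_cone M \<sigma>) m (p + 1).
    koszul_diff I y = z"
proof -
  let ?N = "{J. J \<subseteq> I \<and> m \<in> intersection_functor I D J + dual_cone M \<sigma>}"
  have "\<exists>y. (\<forall>J. y J \<noteq> 0 \<longrightarrow> J \<in> ?N \<and> int (card J) = p + 1) \<and> koszul_diff I y = z"
  proof (rule acyclic_family_degree[OF sigma_family_acyclic[OF S] _ _ _ dz])
    show "finite I" using S by (simp add: sigma_family_def)
    show "\<forall>J. z J \<noteq> 0 \<longrightarrow> J \<in> ?N \<and> int (card J) = p" using z by (simp add: evaluation_complex_def)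
  qed auto
  then obtain y where "\<forall>J. y J \<noteq> 0 \<longrightarrow> J \<in> ?N \<and> int (card J) = p + 1" "koszul_diff I y = z" by blast
  then show ?thesis by (intro bexI[of _ y]) (simp_all add: evaluation_complex_def)
qed

lemma evaluation_complex_diff:
  assumes "finite I" and F: "F = intersection_functor I D"
    and z: "z \<in> evaluation_complex I (\<lambda>J. F J + C) m p"
  shows "koszul_diff I z \<in> evaluation_complex I (\<lambda>J. F J + C) m (p - 1)"
  unfolding evaluation_complex_def
proof (intro CollectI allI impI)
  fix J assume ne: "koszul_diff I z J \<noteq> 0"
  have "\<exists>i\<in>I - J. z (insert i J) \<noteq> 0"
  proof (rule ccontr)
    assume "\<not> ?thesis"
    then have "koszul_diff I z J = 0" unfolding koszul_diff_def by (intro sum.neutral) simp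
    then show False using ne by simp
  qed
  then obtain i where i: "i \<in> I - J" "z (insert i J) \<noteq> 0" by blast
  then have *: "insert i J \<subseteq> I" "int (card (insert i J)) = p" "m \<in> F (insert i J) + C"
    using z unfolding evaluation_complex_def by blast+
  have "finite J" using *(1) assms(1) finite_subset by auto
  moreover have "F (insert i J) + C \<subseteq> F J + C"
    unfolding F by (intro set_plus_mono2 intersection_functor_antimono *(1)) auto
  ultimately show "J \<subseteq> I \<and> int (card J) = p - 1 \<and> m \<in> F J + C" using * i(1) by auto
qed

section \<open>Exactness and chart sections of the sequence of a \<Sigma>-family\<close>

context normal_fan_space
begin

lemma toric_sheaf_zero: "0 \<in> toric_sheaf M \<Sigma> D U"
proof -
  have "0 \<in> localize (chart_module M \<sigma> D) (chart_ring M \<sigma> - P)" if "P \<in> spectrum (chart_ring M \<sigma>)" for \<sigma> P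
    using localize_embed[OF is_subring_chart_ring that, of 0 "chart_module M \<sigma> D"]
    by (simp add: chart_module_def span_characters_zero fract_collapse)
  then show ?thesis by (simp add: toric_sheaf_def)
qed

lemma toric_sheaf_add:
  "f \<in> toric_sheaf M \<Sigma> D U \<Longrightarrow> g \<in> toric_sheaf M \<Sigma> D U \<Longrightarrow> f + g \<in> toric_sheaf M \<Sigma> D U"
  unfolding toric_sheaf_def
  by (auto intro!: localize_add is_subring_chart_ring intro: chart_module_add chart_module_mult)

lemma toric_sheaf_uminus: "f \<in> toric_sheaf M \<Sigma> D U \<Longrightarrow> - f \<in> toric_sheaf M \<Sigma> D U"
  unfolding toric_sheaf_def by (auto intro!: localize_uminus intro: chart_module_uminus)

lemma toric_sheaf_sum: "(\<And>i. i \<in> A \<Longrightarrow> f i \<in> toric_sheaf M \<Sigma> D U) \<Longrightarrow> sum f A \<in> toric_sheaf M \<Sigma> D U"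
  by (induction A rule: infinite_finite_induct) (auto intro: toric_sheaf_zero toric_sheaf_add)

lemma toric_sheaf_mono: "D \<subseteq> E \<Longrightarrow> toric_sheaf M \<Sigma> D U \<subseteq> toric_sheaf M \<Sigma> E U"
  unfolding toric_sheaf_def using localize_mono[OF chart_module_mono[of D E]] by blast

context
  fixes I :: "'i::linorder set" and D :: "'i \<Rightarrow> 'a set" and F L C
  assumes S: "sigma_family M \<Sigma> I D"
  defines F_def: "F \<equiv> intersection_functor I D"
    and L_def: "L \<equiv> \<lambda>J. toric_sheaf M \<Sigma> (F J)"
    and C_def: "C \<equiv> direct_sum_sheaf I L"
begin

lemma finite_index: "finite I"
  using S by (simp add: sigma_family_def)

lemma finite_index_subset: "J \<subseteq> I \<Longrightarrow> finite J"
  by (rule finite_subset[OF _ finite_index])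

lemma F_nef: "J \<subseteq> I \<Longrightarrow> F J \<in> nef_polyhedra M \<Sigma>"
  unfolding F_def by (rule intersection_functor_nef[OF S])

lemma direct_sum_mem: "c \<in> C p U \<Longrightarrow> J \<subseteq> I \<Longrightarrow> int (card J) = p \<Longrightarrow> c J \<in> toric_sheaf M \<Sigma> (F J) U"
  unfolding C_def L_def direct_sum_sheaf_def by (auto dest: spec[of _ J])

lemma direct_sum_zero: "c \<in> C p U \<Longrightarrow> \<not> (J \<subseteq> I \<and> int (card J) = p) \<Longrightarrow> c J = 0"
  unfolding C_def L_def direct_sum_sheaf_def by (auto dest: spec[of _ J])

lemma direct_sumI:
  assumes "\<And>J. J \<subseteq> I \<Longrightarrow> int (card J) = p \<Longrightarrow> c J \<in> toric_sheaf M \<Sigma> (F J) U"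
    and "\<And>J. \<not> (J \<subseteq> I \<and> int (card J) = p) \<Longrightarrow> c J = 0"
  shows "c \<in> C p U"
  using assms unfolding C_def L_def direct_sum_sheaf_def by simp

lemma direct_sum_diff:
  assumes c: "c \<in> C (p + 1) U"
  shows "koszul_diff I c \<in> C p U"
proof (rule direct_sumI)
  fix J assume J: "J \<subseteq> I" "int (card J) = p"
  show "koszul_diff I c J \<in> toric_sheaf M \<Sigma> (F J) U"
    unfolding koszul_diff_def
  proof (rule toric_sheaf_sum)
    fix i assume i: "i \<in> I - J"
    have "finite J" using J finite_index_subset by simp
    then have "c (insert i J) \<in> toric_sheaf M \<Sigma> (F (insert i J)) U"
      using i J by (intro direct_sum_mem[OF c]) auto
    moreover have "F (insert i J) \<subseteq> F J"
      unfolding F_def using i J by (intro intersection_functor_antimono) auto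
    ultimately have "c (insert i J) \<in> toric_sheaf M \<Sigma> (F J) U" using toric_sheaf_mono by blast
    then show "(- 1) ^ card {k \<in> insert i J. k < i} * c (insert i J) \<in> toric_sheaf M \<Sigma> (F J) U"
      using toric_sheaf_uminus by (simp add: minus_one_power_iff)
  qed
next
  fix J assume J: "\<not> (J \<subseteq> I \<and> int (card J) = p)"
  have "c (insert i J) = 0" if "i \<in> I - J" for i
  proof (rule direct_sum_zero[OF c])
    show "\<not> (insert i J \<subseteq> I \<and> int (card (insert i J)) = p + 1)"
    proof
      assume *: "insert i J \<subseteq> I \<and> int (card (insert i J)) = p + 1"
      then have "finite J" using finite_index_subset by simp
      then show False using * J that by simp
    qed
  qed
  then show "koszul_diff I c J = 0" by (simp add: koszul_diff_def)
qed

text \<open>Modules and differential are graded by exponents. In each exponent a cycle bounds by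
  \<open>evaluation_complex_exact\<close>, and the finitely many exponents occurring in
  \<open>g\<close> are then summed up.\<close>

lemma chart_module_exact:
  assumes g: "\<And>J. J \<subseteq> I \<Longrightarrow> int (card J) = p \<Longrightarrow> g J \<in> chart_module M \<sigma> (F J)"
    and g0: "\<And>J. \<not> (J \<subseteq> I \<and> int (card J) = p) \<Longrightarrow> g J = 0"
    and dg: "koszul_diff I g = (\<lambda>_. 0)"
  shows "\<exists>y. (\<forall>J. J \<subseteq> I \<and> int (card J) = p + 1 \<longrightarrow> y J \<in> chart_module M \<sigma> (F J)) \<and>
    (\<forall>J. \<not> (J \<subseteq> I \<and> int (card J) = p + 1) \<longrightarrow> y J = 0) \<and> koszul_diff I y = g"
proof -
  let ?E = "evaluation_complex I (\<lambda>J. F J + dual_cone M \<sigma>)"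
  define z where "z m J = Poly_Mapping.lookup (coeffs (g J)) m" for m J
  define A where "A = (\<Union>J\<in>Pow I. Poly_Mapping.keys (coeffs (g J)))"
  have finA: "finite A" using finite_index by (simp add: A_def)
  have keys: "m \<in> F J + dual_cone M \<sigma> \<and> m \<in> M \<and> J \<subseteq> I \<and> int (card J) = p" if "z m J \<noteq> 0" for m J
  proof -
    have "g J \<noteq> 0" using that by (auto simp: z_def zero_group_algebra.rep_eq)
    then have J: "J \<subseteq> I \<and> int (card J) = p" using g0[of J] by argo
    then have "g J \<in> chart_module M \<sigma> (F J)" using g by simp
    moreover have "m \<in> Poly_Mapping.keys (coeffs (g J))" using that by (simp add: z_def in_keys_iff)
    ultimately show ?thesis using J by (auto simp: chart_module_def span_characters_def)
  qed
  have zA: "z m J = 0" if "m \<notin> A" for m J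
  proof (rule ccontr)
    assume "z m J \<noteq> 0"
    then have "J \<subseteq> I" "m \<in> Poly_Mapping.keys (coeffs (g J))" using keys by (simp_all add: z_def in_keys_iff)
    then show False using that by (auto simp: A_def)
  qed
  have AM: "A \<subseteq> M"
  proof
    fix m assume "m \<in> A"
    then obtain J where "z m J \<noteq> 0" by (auto simp: A_def z_def in_keys_iff)
    then show "m \<in> M" using keys by blast
  qed
  have "\<exists>y. y \<in> ?E m (p + 1) \<and> koszul_diff I y = z m" for m
  proof -
    have "z m \<in> ?E m p" using keys[of m] by (simp add: evaluation_complex_def)
    moreover have "koszul_diff I (z m) = (\<lambda>_. 0)"
      unfolding z_def koszul_diff_lookup dg by (simp add: zero_group_algebra.rep_eq)
    ultimately show ?thesis
      using evaluation_complex_exact[OF S, of "z m" \<sigma> m p] unfolding F_def by blast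
  qed
  then have "\<exists>Y. \<forall>m. Y m \<in> ?E m (p + 1) \<and> koszul_diff I (Y m) = z m" by (intro choice) blast
  then obtain Y where Y: "\<And>m. Y m \<in> ?E m (p + 1)" and dY: "\<And>m. koszul_diff I (Y m) = z m" by blast
  \<comment> \<open>Bounding chains were chosen for all exponents, but only those in
    \<open>A\<close> enter; this keeps \<open>y\<close> finitely supported, and outside
    \<open>A\<close> the components of \<open>g\<close> vanish anyway.\<close>
  define y where "y J = finite_sum_characters A (\<lambda>m. Y m J)" for J
  have Yne: "J \<subseteq> I \<and> int (card J) = p + 1 \<and> m \<in> F J + dual_cone M \<sigma>" if "Y m J \<noteq> 0" for m J
    using Y[of m] that by (simp add: evaluation_complex_def)
  have "y J \<in> chart_module M \<sigma> (F J)" for J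
    unfolding y_def chart_module_def
    by (rule finite_sum_characters_mem[OF finA]) (use Yne AM in blast)
  moreover have "y J = 0" if "\<not> (J \<subseteq> I \<and> int (card J) = p + 1)" for J
  proof (rule group_algebra_eqI)
    fix m
    have "Y m J = 0" using Yne[of m J] that by blast
    then show "Poly_Mapping.lookup (coeffs (y J)) m = Poly_Mapping.lookup (coeffs 0) m"
      by (simp add: y_def lookup_finite_sum_characters[OF finA] zero_group_algebra.rep_eq)
  qed
  moreover have "koszul_diff I y = g"
  proof (intro ext group_algebra_eqI)
    fix J m
    have "Poly_Mapping.lookup (coeffs (koszul_diff I y J)) m =
        koszul_diff I (\<lambda>J. if m \<in> A then Y m J else 0) J"
      using koszul_diff_lookup[of I y m]
      by (simp add: y_def lookup_finite_sum_characters[OF finA] fun_eq_iff)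
    also have "\<dots> = z m J" using dY zA by (cases "m \<in> A") simp_all
    finally show "Poly_Mapping.lookup (coeffs (koszul_diff I y J)) m =
        Poly_Mapping.lookup (coeffs (g J)) m" by (simp add: z_def)
  qed
  ultimately show ?thesis by (intro exI[of _ y]) simp
qed

text \<open>The local lift is found in the chart modules: the numerators of a cycle over a common
  denominator \<open>h\<close> form a cycle, since \<open>h\<close> is nonzero in a domain; a
  bounding family of numerators is divided by \<open>h\<close> again.\<close>

lemma sheaf_exact_koszul: "sheaf_exact X (C (p + 1)) (koszul_diff I) (C p) (koszul_diff I) (C (p - 1))"
  unfolding sheaf_exact_def
proof (intro allI impI conjI ballI)
  fix U
  show "koszul_diff I ` C (p + 1) U \<subseteq> C p U" using direct_sum_diff by blast
  show "koszul_diff I ` C p U \<subseteq> C (p - 1) U" using direct_sum_diff[of _ "p - 1"] by auto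
next
  fix U s assume s: "s \<in> C (p + 1) U"
  have "finite J" if "s J \<noteq> 0" for J
  proof -
    have "J \<subseteq> I" using direct_sum_zero[OF s, of J] that by argo
    then show ?thesis by (rule finite_index_subset)
  qed
  then show "koszul_diff I (koszul_diff I s) = (\<lambda>_. 0)"
    using koszul_diff_koszul_diff[OF finite_index, of s] by auto
next
  fix U s x assume U: "openin X U" and s: "s \<in> C p U" and ds: "koszul_diff I s = (\<lambda>_. 0)" and x: "x \<in> U"
  have "x \<in> topspace X" using U x openin_subset by blast
  then obtain \<sigma> P where P: "\<sigma> \<in> \<Sigma>" "P \<in> spectrum (chart_ring M \<sigma>)" "x = point M \<sigma> P"
    using topspace_toric_variety by blast
  define T where "T = {J. J \<subseteq> I \<and> int (card J) = p}"
  have finT: "finite T" using finite_index by (simp add: T_def)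
  have "\<exists>h\<in>chart_ring M \<sigma> - P. \<forall>J\<in>T. \<exists>g\<in>chart_module M \<sigma> (F J). s J = Fract g h"
  proof (rule common_denominator[OF is_subring_chart_ring P(2) chart_module_mult finT])
    fix J assume "J \<in> T"
    then have "s J \<in> toric_sheaf M \<Sigma> (F J) U" using direct_sum_mem[OF s] by (simp add: T_def)
    then show "s J \<in> localize (chart_module M \<sigma> (F J)) (chart_ring M \<sigma> - P)"
      using toric_sheafD[OF _ P(1,2)] P(3) x by (simp add: stalk_def)
  qed
  then obtain h where h: "h \<in> chart_ring M \<sigma> - P"
    and "\<forall>J\<in>T. \<exists>g. g \<in> chart_module M \<sigma> (F J) \<and> s J = Fract g h" by blast
  then obtain g' where g': "\<forall>J\<in>T. g' J \<in> chart_module M \<sigma> (F J) \<and> s J = Fract (g' J) h"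
    using bchoice by metis
  \<comment> \<open>Extension by zero lets \<open>s\<close> be the tuple of fractions with
    denominator \<open>h\<close> at every index set, not only in degree \<open>p\<close>.\<close>
  define g where "g J = (if J \<in> T then g' J else 0)" for J
  have h0: "h \<noteq> 0" using h spectrum_multiplicative(3)[OF is_subring_chart_ring P(2)] by metis
  have sg: "s = (\<lambda>J. Fract (g J) h)"
    using g' direct_sum_zero[OF s] by (auto simp: g_def T_def fract_collapse)
  have "Fract (koszul_diff I g J) h = 0" for J
    using ds h0 unfolding sg by (simp add: koszul_diff_Fract fun_eq_iff)
  then have "koszul_diff I g = (\<lambda>_. 0)" using h0 by (simp add: fract_expand eq_fract fun_eq_iff)
  moreover have "g J \<in> chart_module M \<sigma> (F J)" if "J \<subseteq> I" "int (card J) = p" for J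
    using g' that by (simp add: g_def T_def)
  moreover have "g J = 0" if "\<not> (J \<subseteq> I \<and> int (card J) = p)" for J
    using that by (auto simp: g_def T_def)
  ultimately have "\<exists>y. (\<forall>J. J \<subseteq> I \<and> int (card J) = p + 1 \<longrightarrow> y J \<in> chart_module M \<sigma> (F J)) \<and>
      (\<forall>J. \<not> (J \<subseteq> I \<and> int (card J) = p + 1) \<longrightarrow> y J = 0) \<and> koszul_diff I y = g"
    by (intro chart_module_exact)
  then obtain y where y: "\<forall>J. J \<subseteq> I \<and> int (card J) = p + 1 \<longrightarrow> y J \<in> chart_module M \<sigma> (F J)"
    "\<forall>J. \<not> (J \<subseteq> I \<and> int (card J) = p + 1) \<longrightarrow> y J = 0" "koszul_diff I y = g" by blast
  define t where "t J = Fract (y J) h" for J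
  \<comment> \<open>On this neighbourhood \<open>h\<close> lies outside every prime, so fractions
    with denominator \<open>h\<close> belong to the stalks at all of its points.\<close>
  define V where "V = U \<inter> basic_open M \<sigma> h"
  have V: "openin X V" "V \<subseteq> U" using U openin_basic_open[OF P(1)] h by (auto simp: V_def)
  have xV: "x \<in> V" using x P h by (auto simp: V_def basic_open_def)
  have dt: "koszul_diff I t = s" unfolding t_def sg koszul_diff_Fract[OF h0] y(3) ..
  have "t \<in> C (p + 1) V"
  proof (rule direct_sumI)
    fix J assume J: "J \<subseteq> I" "int (card J) = p + 1"
    show "t J \<in> toric_sheaf M \<Sigma> (F J) V"
    proof (rule toric_sheafI[OF F_nef[OF J(1)]])
      fix x' assume "x' \<in> V"
      then obtain P' where P': "P' \<in> spectrum (chart_ring M \<sigma>)" "h \<notin> P'" "x' = point M \<sigma> P'"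
        by (auto simp: V_def basic_open_def)
      then have "t J \<in> stalk \<sigma> (F J) P'"
        unfolding stalk_def localize_def t_def using y(1) J h by blast
      then show "\<exists>\<sigma>\<in>\<Sigma>. \<exists>P\<in>spectrum (chart_ring M \<sigma>). x' = point M \<sigma> P \<and> t J \<in> stalk \<sigma> (F J) P"
        using P(1) P' by blast
    qed (use xV in blast)
  qed (use y(2) in \<open>simp add: t_def fract_collapse\<close>)
  then show "\<exists>V. openin X V \<and> x \<in> V \<and> V \<subseteq> U \<and> (\<exists>t\<in>C (p + 1) V. koszul_diff I t = s)"
    using V xV dt by blast
qed

text \<open>By \<open>toric_sheaf_chart\<close> each component over a chart is an element of the
  group algebra; collecting its coefficients at one exponent \<open>m\<close> over all index sets
  gives the chain \<open>z m\<close>.\<close>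

lemma chart_sections:
  assumes \<sigma>: "\<sigma> \<in> \<Sigma>"
  shows "C p (chart M \<sigma>) = {\<lambda>J. \<Sum>m\<in>A. monomial m (z m J) | A z. finite A \<and> A \<subseteq> M \<and>
     (\<forall>m\<in>A. z m \<in> evaluation_complex I (\<lambda>J. F J + dual_cone M \<sigma>) m p)}" (is "_ = ?R")
proof (intro equalityI subsetI)
  fix c assume c: "c \<in> C p (chart M \<sigma>)"
  have "\<exists>f. (J \<subseteq> I \<and> int (card J) = p \<longrightarrow> f \<in> chart_module M \<sigma> (F J)) \<and>
      (\<not> (J \<subseteq> I \<and> int (card J) = p) \<longrightarrow> f = 0) \<and> c J = Fract f 1" for J
  proof (cases "J \<subseteq> I \<and> int (card J) = p")
    case True
    then have "c J \<in> (\<lambda>f. Fract f 1) ` chart_module M \<sigma> (F J)"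
      using direct_sum_mem[OF c, of J] toric_sheaf_chart[OF F_nef \<sigma>] by simp
    then show ?thesis using True by blast
  next
    case False
    then show ?thesis using direct_sum_zero[OF c, of J] by (intro exI[of _ 0]) (auto simp: fract_collapse)
  qed
  then have "\<exists>f. \<forall>J. (J \<subseteq> I \<and> int (card J) = p \<longrightarrow> f J \<in> chart_module M \<sigma> (F J)) \<and>
      (\<not> (J \<subseteq> I \<and> int (card J) = p) \<longrightarrow> f J = 0) \<and> c J = Fract (f J) 1"
    by (intro choice allI)
  then obtain f where "\<forall>J. (J \<subseteq> I \<and> int (card J) = p \<longrightarrow> f J \<in> chart_module M \<sigma> (F J)) \<and>
      (\<not> (J \<subseteq> I \<and> int (card J) = p) \<longrightarrow> f J = 0) \<and> c J = Fract (f J) 1"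
    by (rule exE)
  then have f: "J \<subseteq> I \<and> int (card J) = p \<Longrightarrow> f J \<in> chart_module M \<sigma> (F J)"
    "\<not> (J \<subseteq> I \<and> int (card J) = p) \<Longrightarrow> f J = 0" "c J = Fract (f J) 1" for J by simp_all
  define A where "A = (\<Union>J\<in>Pow I. Poly_Mapping.keys (coeffs (f J)))"
  define z where "z m J = Poly_Mapping.lookup (coeffs (f J)) m" for m J
  have finA: "finite A" using finite_index by (simp add: A_def)
  have keys: "m \<in> F J + dual_cone M \<sigma> \<and> m \<in> M \<and> J \<subseteq> I \<and> int (card J) = p \<and> m \<in> A" if "z m J \<noteq> 0" for m J
  proof -
    have "f J \<noteq> 0" using that by (auto simp: z_def zero_group_algebra.rep_eq)
    then have J: "J \<subseteq> I \<and> int (card J) = p" using f(2)[of J] by argo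
    moreover have m: "m \<in> Poly_Mapping.keys (coeffs (f J))" using that by (simp add: z_def in_keys_iff)
    moreover have "m \<in> A" using J m by (auto simp: A_def)
    ultimately show ?thesis using f(1)[OF J] by (auto simp: chart_module_def span_characters_def)
  qed
  have "A \<subseteq> M"
  proof
    fix m assume "m \<in> A"
    then obtain J where "z m J \<noteq> 0" by (auto simp: A_def z_def in_keys_iff)
    then show "m \<in> M" using keys by blast
  qed
  moreover have "\<forall>m\<in>A. z m \<in> evaluation_complex I (\<lambda>J. F J + dual_cone M \<sigma>) m p"
    using keys by (simp add: evaluation_complex_def)
  moreover have "c = (\<lambda>J. \<Sum>m\<in>A. monomial m (z m J))"
  proof
    fix J
    have "f J = finite_sum_characters A (\<lambda>m. z m J)"
    proof (rule group_algebra_eqI)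
      fix m show "Poly_Mapping.lookup (coeffs (f J)) m =
          Poly_Mapping.lookup (coeffs (finite_sum_characters A (\<lambda>m. z m J))) m"
        using keys[of m J] by (auto simp: lookup_finite_sum_characters[OF finA] z_def)
    qed
    then show "c J = (\<Sum>m\<in>A. monomial m (z m J))" using f(3) Fract_finite_sum_characters by metis
  qed
  ultimately show "c \<in> ?R" using finA by (intro CollectI exI[of _ A] exI[of _ z]) simp
next
  fix c assume "c \<in> ?R"
  then obtain A z where c: "c = (\<lambda>J. \<Sum>m\<in>A. monomial m (z m J))" and A: "finite A" "A \<subseteq> M"
    and z: "\<forall>m\<in>A. z m \<in> evaluation_complex I (\<lambda>J. F J + dual_cone M \<sigma>) m p" by blast
  have zne: "J \<subseteq> I \<and> int (card J) = p \<and> m \<in> F J + dual_cone M \<sigma>" if "m \<in> A" "z m J \<noteq> 0" for m J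
    using z that by (simp add: evaluation_complex_def)
  have cJ: "c J = Fract (finite_sum_characters A (\<lambda>m. z m J)) 1" for J
    by (simp add: c Fract_finite_sum_characters)
  show "c \<in> C p (chart M \<sigma>)"
  proof (rule direct_sumI)
    fix J assume J: "J \<subseteq> I" "int (card J) = p"
    have "finite_sum_characters A (\<lambda>m. z m J) \<in> chart_module M \<sigma> (F J)"
      unfolding chart_module_def by (rule finite_sum_characters_mem[OF A(1)]) (use zne A in blast)
    then show "c J \<in> toric_sheaf M \<Sigma> (F J) (chart M \<sigma>)"
      unfolding toric_sheaf_chart[OF F_nef[OF J(1)] \<sigma>] cJ by blast
  next
    fix J assume J: "\<not> (J \<subseteq> I \<and> int (card J) = p)"
    have "finite_sum_characters A (\<lambda>m. z m J) = 0"
    proof (rule group_algebra_eqI)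
      fix m show "Poly_Mapping.lookup (coeffs (finite_sum_characters A (\<lambda>m. z m J))) m =
          Poly_Mapping.lookup (coeffs 0) m"
        using zne[of m J] J by (auto simp: lookup_finite_sum_characters[OF A(1)] zero_group_algebra.rep_eq)
    qed
    then show "c J = 0" by (simp add: cJ fract_collapse)
  qed
qed

end

end

section \<open>The torus action\<close>

lemma lookup_scale:
  "Poly_Mapping.lookup (coeffs (scale t f)) m = t m * Poly_Mapping.lookup (coeffs f) m"
  by (simp add: scale_def lookup_mapp when_def in_keys_iff)

lemma scale_zero: "scale t 0 = 0"
  by (rule group_algebra_eqI) (simp add: lookup_scale zero_group_algebra.rep_eq)

lemma scale_add: "scale t (f + g) = scale t f + scale t g"
  by (rule group_algebra_eqI)
    (simp add: lookup_scale plus_group_algebra.rep_eq lookup_add distrib_left)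

lemma scale_uminus: "scale t (- f) = - scale t f"
  by (rule group_algebra_eqI) (simp add: lookup_scale uminus_group_algebra.rep_eq)

lemma scale_mem: "f \<in> span_characters S \<Longrightarrow> scale t f \<in> span_characters S"
  by (auto simp: span_characters_def in_keys_iff lookup_scale)

text \<open>Finite supersets of the supports are allowed so that a product and its scaled version
  can be expanded over the same index sets.\<close>

lemma lookup_times:
  fixes f g :: "'a::euclidean_space \<Rightarrow>\<^sub>0 complex"
  assumes "finite A" "Poly_Mapping.keys f \<subseteq> A" "finite B" "Poly_Mapping.keys g \<subseteq> B"
  shows "Poly_Mapping.lookup (f * g) k = (\<Sum>x\<in>A. \<Sum>y\<in>B.
    if k = x + y then Poly_Mapping.lookup f x * Poly_Mapping.lookup g y else 0)"
proof -
  have "(\<Sum>y. Poly_Mapping.lookup g y when k = x + y) =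
      (\<Sum>y\<in>B. Poly_Mapping.lookup g y when k = x + y)" for x
    by (rule Sum_any.expand_superset) (use assms in \<open>auto simp: in_keys_iff when_def\<close>)
  then have "Poly_Mapping.lookup (f * g) k =
      (\<Sum>x. Poly_Mapping.lookup f x * (\<Sum>y\<in>B. Poly_Mapping.lookup g y when k = x + y))"
    by (simp add: lookup_mult)
  also have "\<dots> = (\<Sum>x\<in>A. Poly_Mapping.lookup f x *
      (\<Sum>y\<in>B. Poly_Mapping.lookup g y when k = x + y))"
    by (rule Sum_any.expand_superset) (use assms in \<open>auto simp: in_keys_iff\<close>)
  also have "\<dots> = (\<Sum>x\<in>A. \<Sum>y\<in>B.
      if k = x + y then Poly_Mapping.lookup f x * Poly_Mapping.lookup g y else 0)"
    unfolding sum_distrib_left by (intro sum.cong refl) (simp add: when_def)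
  finally show ?thesis .
qed

section \<open>The torus acting on Laurent polynomials, rational functions and local rings\<close>

context lattice_space
begin

abbreviation "CM \<equiv> span_characters M"

lemma CM_closed:
  "0 \<in> CM" "f \<in> CM \<Longrightarrow> - f \<in> CM"
  "f \<in> CM \<Longrightarrow> g \<in> CM \<Longrightarrow> f + g \<in> CM" "f \<in> CM \<Longrightarrow> g \<in> CM \<Longrightarrow> f * g \<in> CM"
  by (auto intro: span_characters_zero span_characters_uminus span_characters_add
      span_characters_mult lattice_closed)

lemma chart_ring_subset: "chart_ring M \<sigma> \<subseteq> CM"
  unfolding chart_ring_def by (rule span_characters_mono) auto

lemma chart_module_subset: "chart_module M \<sigma> D \<subseteq> CM"
  unfolding chart_module_def by (rule span_characters_mono) auto

text \<open>A torus element is multiplicative on exponents in \<open>M\<close> only, which is why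
  both factors have to lie in \<open>CM\<close>.\<close>

lemma scale_mult:
  assumes t: "t \<in> torus M" and f: "f \<in> CM" and g: "g \<in> CM"
  shows "scale t (f * g) = scale t f * scale t g"
proof (rule group_algebra_eqI)
  fix k
  let ?A = "Poly_Mapping.keys (coeffs f)" and ?B = "Poly_Mapping.keys (coeffs g)"
  have AB: "?A \<subseteq> M" "?B \<subseteq> M" using f g by (auto simp: span_characters_def)
  have tm: "t (x + y) = t x * t y" if "x \<in> ?A" "y \<in> ?B" for x y
  proof -
    have "x \<in> M" "y \<in> M" using AB that by blast+
    then show ?thesis using t by (simp add: torus_def)
  qed
  have keys: "Poly_Mapping.keys (coeffs (scale t f)) \<subseteq> ?A" "Poly_Mapping.keys (coeffs (scale t g)) \<subseteq> ?B"
    by (auto simp: in_keys_iff lookup_scale)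
  have "Poly_Mapping.lookup (coeffs (scale t (f * g))) k = (\<Sum>x\<in>?A. \<Sum>y\<in>?B. t k *
      (if k = x + y then Poly_Mapping.lookup (coeffs f) x * Poly_Mapping.lookup (coeffs g) y else 0))"
    using lookup_times[of ?A "coeffs f" ?B "coeffs g" k]
    by (simp add: lookup_scale times_group_algebra.rep_eq sum_distrib_left)
  also have "\<dots> = (\<Sum>x\<in>?A. \<Sum>y\<in>?B. if k = x + y then
      Poly_Mapping.lookup (coeffs (scale t f)) x * Poly_Mapping.lookup (coeffs (scale t g)) y else 0)"
    by (intro sum.cong refl) (simp add: lookup_scale tm)
  also have "\<dots> = Poly_Mapping.lookup (coeffs (scale t f * scale t g)) k"
    using lookup_times[of ?A "coeffs (scale t f)" ?B "coeffs (scale t g)" k] keys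
    by (simp add: times_group_algebra.rep_eq)
  finally show "Poly_Mapping.lookup (coeffs (scale t (f * g))) k =
      Poly_Mapping.lookup (coeffs (scale t f * scale t g)) k" .
qed

lemma torus_inverse: "t \<in> torus M \<Longrightarrow> (\<lambda>m. inverse (t m)) \<in> torus M"
  by (simp add: torus_def)

lemma scale_inverse:
  assumes t: "t \<in> torus M" and f: "f \<in> CM"
  shows "scale (\<lambda>m. inverse (t m)) (scale t f) = f"
proof (rule group_algebra_eqI)
  fix m
  have "t m \<noteq> 0 \<or> Poly_Mapping.lookup (coeffs f) m = 0"
    using t f by (auto simp: torus_def span_characters_def in_keys_iff)
  then show "Poly_Mapping.lookup (coeffs (scale (\<lambda>m. inverse (t m)) (scale t f))) m =
      Poly_Mapping.lookup (coeffs f) m"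
    by (auto simp: lookup_scale)
qed

lemma scale_inverse':
  assumes t: "t \<in> torus M" and f: "f \<in> CM"
  shows "scale t (scale (\<lambda>m. inverse (t m)) f) = f"
  using scale_inverse[OF torus_inverse[OF t] f] by simp

lemma scale_nonzero:
  assumes "t \<in> torus M" "f \<in> CM" "f \<noteq> 0"
  shows "scale t f \<noteq> 0"
  using scale_inverse[OF assms(1,2)] assms(3) scale_zero by metis

lemma scale_one:
  assumes "t \<in> torus M"
  shows "scale t 1 = 1"
proof -
  have "t (0 + 0) = t 0 * t 0" "t 0 \<noteq> 0"
    using assms lattice_closed(1) unfolding torus_def by blast+
  then have "t 0 = 1" by simp
  then have "scale t (character 0) = character 0"
    by (intro group_algebra_eqI) (simp add: lookup_scale character_def lookup_one when_def)
  then show ?thesis by (simp add: character_zero)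
qed

text \<open>Characters are eigenvectors with nonzero eigenvalues, so every span of characters is
  stable; the inverse torus element gives surjectivity.\<close>

lemma scale_span:
  assumes t: "t \<in> torus M" and "S \<subseteq> M"
  shows "scale t ` span_characters S = span_characters S"
proof (intro equalityI subsetI)
  fix f assume f: "f \<in> span_characters S"
  then have "f \<in> CM" using span_characters_mono[OF assms(2)] by blast
  then have "f = scale t (scale (\<lambda>m. inverse (t m)) f)" using scale_inverse'[OF t] by simp
  then show "f \<in> scale t ` span_characters S" using scale_mem[OF f] by blast
qed (auto intro: scale_mem)

lemma scale_chart_ring: "t \<in> torus M \<Longrightarrow> scale t ` chart_ring M \<sigma> = chart_ring M \<sigma>"
  unfolding chart_ring_def by (rule scale_span) auto

lemma scale_chart_module: "t \<in> torus M \<Longrightarrow> scale t ` chart_module M \<sigma> D = chart_module M \<sigma> D"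
  unfolding chart_module_def by (rule scale_span) auto

lemma inj_on_scale: "t \<in> torus M \<Longrightarrow> inj_on (scale t) CM"
  by (rule inj_on_inverseI[of _ "scale (\<lambda>m. inverse (t m))"]) (rule scale_inverse)

text \<open>Justifies the definite description in \<open>torus_act\<close>: two representations of a
  fraction are related by cross-multiplication, which the multiplicative and injective
  \<open>scale t\<close> preserves.\<close>

lemma torus_act_Fract:
  assumes t: "t \<in> torus M" and f: "f \<in> CM" and g: "g \<in> CM" "g \<noteq> 0"
  shows "torus_act M t (Fract f g) = Fract (scale t f) (scale t g)"
  unfolding torus_act_def
proof (rule the_equality)
  show "\<exists>f'\<in>CM. \<exists>g'\<in>CM. g' \<noteq> 0 \<and> Fract f g = Fract f' g' \<and>
      Fract (scale t f) (scale t g) = Fract (scale t f') (scale t g')"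
    using f g by blast
next
  fix r assume "\<exists>f'\<in>CM. \<exists>g'\<in>CM. g' \<noteq> 0 \<and> Fract f g = Fract f' g' \<and> r = Fract (scale t f') (scale t g')"
  then obtain f' g' where *: "f' \<in> CM" "g' \<in> CM" "g' \<noteq> 0" "Fract f g = Fract f' g'"
      "r = Fract (scale t f') (scale t g')" by blast
  then have "f * g' = f' * g" using g(2) by (simp add: eq_fract)
  then have "scale t f * scale t g' = scale t f' * scale t g"
    using scale_mult[OF t] f g * by metis
  then show "r = Fract (scale t f) (scale t g)"
    using * g scale_nonzero[OF t] by (simp add: eq_fract)
qed

text \<open>The fraction field of \<open>CM\<close> inside that of the ambient group algebra. All
  stalks and local rings of the variety lie in it, and the action is a field automorphism
  there.\<close>

definition rationals_on_torus :: "'a rational set" where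
  "rationals_on_torus = {Fract f g | f g. f \<in> CM \<and> g \<in> CM \<and> g \<noteq> 0}"

lemma rationals_cases:
  assumes "q \<in> rationals_on_torus"
  obtains f g where "q = Fract f g" "f \<in> CM" "g \<in> CM" "g \<noteq> 0"
  using assms by (auto simp: rationals_on_torus_def)

lemma rationals_zero: "0 \<in> rationals_on_torus"
proof -
  have "1 \<in> CM" using character_mem_span[of 0 M] by (simp add: character_zero lattice_closed)
  then show ?thesis
    unfolding rationals_on_torus_def
    by (intro CollectI exI[of _ 0] exI[of _ 1]) (simp add: fract_collapse CM_closed)
qed

lemma torus_act_zero: "t \<in> torus M \<Longrightarrow> torus_act M t 0 = 0"
proof -
  assume t: "t \<in> torus M"
  have 1: "1 \<in> CM" using character_mem_span[of 0 M] by (simp add: character_zero lattice_closed)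
  show ?thesis
    using torus_act_Fract[OF t CM_closed(1) 1] by (simp add: fract_collapse scale_zero)
qed

lemma torus_act_uminus:
  assumes t: "t \<in> torus M" and "q \<in> rationals_on_torus"
  shows "- q \<in> rationals_on_torus \<and> torus_act M t (- q) = - torus_act M t q"
proof -
  obtain f g where q: "q = Fract f g" "f \<in> CM" "g \<in> CM" "g \<noteq> 0"
    using assms(2) by (rule rationals_cases)
  have "- q = Fract (- f) g" "- f \<in> CM" using q CM_closed by simp_all
  then show ?thesis
    using q torus_act_Fract[OF t, of f g] torus_act_Fract[OF t, of "- f" g]
    unfolding rationals_on_torus_def by (auto simp: scale_uminus)
qed

lemma torus_act_add:
  assumes t: "t \<in> torus M" and "q \<in> rationals_on_torus" "r \<in> rationals_on_torus"
  shows "q + r \<in> rationals_on_torus \<and> torus_act M t (q + r) = torus_act M t q + torus_act M t r"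
proof -
  obtain f g where q: "q = Fract f g" "f \<in> CM" "g \<in> CM" "g \<noteq> 0"
    using assms(2) by (rule rationals_cases)
  obtain f' g' where r: "r = Fract f' g'" "f' \<in> CM" "g' \<in> CM" "g' \<noteq> 0"
    using assms(3) by (rule rationals_cases)
  have sum: "q + r = Fract (f * g' + f' * g) (g * g')" using q r by simp
  have mem: "f * g' + f' * g \<in> CM" "g * g' \<in> CM" "g * g' \<noteq> 0" "f * g' \<in> CM" "f' * g \<in> CM"
    using q r CM_closed by simp_all
  have "torus_act M t (q + r) = Fract (scale t (f * g' + f' * g)) (scale t (g * g'))"
    unfolding sum by (rule torus_act_Fract[OF t mem(1-3)])
  also have "\<dots> = Fract (scale t f) (scale t g) + Fract (scale t f') (scale t g')"
    using scale_nonzero[OF t] q r by (simp add: scale_add scale_mult[OF t])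
  also have "\<dots> = torus_act M t q + torus_act M t r"
    using q r torus_act_Fract[OF t] by simp
  finally show ?thesis using sum mem unfolding rationals_on_torus_def by blast
qed

lemma torus_act_inverse:
  assumes t: "t \<in> torus M" and "q \<in> rationals_on_torus"
  shows "torus_act M (\<lambda>m. inverse (t m)) (torus_act M t q) = q"
proof -
  obtain f g where q: "q = Fract f g" "f \<in> CM" "g \<in> CM" "g \<noteq> 0"
    using assms(2) by (rule rationals_cases)
  then show ?thesis
    using torus_act_Fract[OF t, of f g] scale_nonzero[OF t, of g] scale_inverse[OF t]
      torus_act_Fract[OF torus_inverse[OF t], of "scale t f" "scale t g"]
      scale_mem[of f M t] scale_mem[of g M t]
    by simp
qed

lemma torus_act_inverse':
  assumes t: "t \<in> torus M" and "q \<in> rationals_on_torus"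
  shows "torus_act M t (torus_act M (\<lambda>m. inverse (t m)) q) = q"
  using torus_act_inverse[OF torus_inverse[OF t] assms(2)] by simp

lemma localize_subset_rationals:
  assumes "G \<subseteq> CM" "S \<subseteq> CM" "0 \<notin> S"
  shows "localize G S \<subseteq> rationals_on_torus"
  using assms unfolding localize_def rationals_on_torus_def by blast

lemma torus_act_localize:
  assumes t: "t \<in> torus M" and GS: "G \<subseteq> CM" "S \<subseteq> CM" "0 \<notin> S"
  shows "torus_act M t ` localize G S = localize (scale t ` G) (scale t ` S)"
proof -
  have act: "torus_act M t (Fract f g) = Fract (scale t f) (scale t g)" if "f \<in> G" "g \<in> S" for f g
  proof (rule torus_act_Fract[OF t])
    show "f \<in> CM" "g \<in> CM" "g \<noteq> 0" using that GS by auto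
  qed
  show ?thesis
  proof (intro equalityI subsetI)
    fix q assume "q \<in> torus_act M t ` localize G S"
    then obtain f g where "q = torus_act M t (Fract f g)" "f \<in> G" "g \<in> S"
      unfolding localize_def by blast
    then have "q = Fract (scale t f) (scale t g)" "f \<in> G" "g \<in> S" using act by simp_all
    then show "q \<in> localize (scale t ` G) (scale t ` S)" unfolding localize_def by blast
  next
    fix q assume "q \<in> localize (scale t ` G) (scale t ` S)"
    then obtain f g where "q = Fract (scale t f) (scale t g)" "f \<in> G" "g \<in> S"
      unfolding localize_def by blast
    then have "q = torus_act M t (Fract f g)" "Fract f g \<in> localize G S"
      using act unfolding localize_def by auto
    then show "q \<in> torus_act M t ` localize G S" by blast
  qed
qed

text \<open>Scaling restricts to an automorphism of the chart ring. Membership in the image of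
  \<open>P\<close> is therefore tested by applying the inverse torus element, which reduces each
  ideal property to the one of \<open>P\<close>.\<close>

lemma scale_prime:
  assumes t: "t \<in> torus M" and P: "P \<in> spectrum (chart_ring M \<sigma>)"
  shows "scale t ` P \<in> spectrum (chart_ring M \<sigma>)"
proof -
  let ?R = "chart_ring M \<sigma>" and ?i = "scale (\<lambda>m. inverse (t m))"
  note R = is_subring_chart_ring[of \<sigma>]
  have P': "P \<subseteq> ?R" "0 \<in> P" "\<forall>a\<in>P. \<forall>b\<in>P. a + b \<in> P" "\<forall>a\<in>P. \<forall>x\<in>?R. a * x \<in> P" "1 \<notin> P"
    "\<forall>a\<in>?R. \<forall>b\<in>?R. a * b \<in> P \<longrightarrow> a \<in> P \<or> b \<in> P"
    using P unfolding spectrum_iff[OF R] ideal_of_def by simp_all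
  have RC: "a \<in> CM" if "a \<in> ?R" for a using that chart_ring_subset by blast
  have iR: "?i a \<in> ?R" if "a \<in> ?R" for a using that scale_mem unfolding chart_ring_def by blast
  have mem: "a \<in> scale t ` P \<longleftrightarrow> ?i a \<in> P" if "a \<in> ?R" for a
  proof
    assume "a \<in> scale t ` P"
    then obtain p where "a = scale t p" "p \<in> P" by blast
    then show "?i a \<in> P" using scale_inverse[OF t, of p] RC P'(1) by auto
  next
    assume "?i a \<in> P"
    moreover have "a = scale t (?i a)" using scale_inverse'[OF t RC[OF that]] by simp
    ultimately show "a \<in> scale t ` P" by blast
  qed
  have sub: "scale t ` P \<subseteq> ?R" using P'(1) scale_mem unfolding chart_ring_def by blast
  have R': "a + b \<in> ?R" "a * b \<in> ?R" "1 \<in> ?R" if "a \<in> ?R" "b \<in> ?R" for a b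
    using that R by (simp_all add: is_subring_def)
  have imult: "?i (a * b) = ?i a * ?i b" if "a \<in> ?R" "b \<in> ?R" for a b
    by (rule scale_mult[OF torus_inverse[OF t]]) (use that RC in simp_all)
  have "ideal_of ?R (scale t ` P)"
    unfolding ideal_of_def
  proof (intro conjI ballI sub)
    show "0 \<in> scale t ` P" using P'(2) scale_zero[of t] by (metis imageI)
  next
    fix a b assume ab: "a \<in> scale t ` P" "b \<in> scale t ` P"
    then have "a \<in> ?R" "b \<in> ?R" using sub by blast+
    then show "a + b \<in> scale t ` P" using ab mem R' P'(3) by (simp add: scale_add)
  next
    fix a x assume a: "a \<in> scale t ` P" and x: "x \<in> ?R"
    then have "a \<in> ?R" using sub by blast
    then show "a * x \<in> scale t ` P" using a x mem R' P'(4) iR imult by simp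
  qed
  moreover have "1 \<notin> scale t ` P"
    using mem[of 1] R scale_one[OF torus_inverse[OF t]] P'(5) by (simp add: is_subring_def)
  moreover have "a \<in> scale t ` P \<or> b \<in> scale t ` P"
    if "a \<in> ?R" "b \<in> ?R" "a * b \<in> scale t ` P" for a b
    using that mem R' P'(6) iR imult by simp
  ultimately show ?thesis unfolding spectrum_iff[OF R] by blast
qed

lemma scale_complement:
  assumes t: "t \<in> torus M" and P: "P \<in> spectrum (chart_ring M \<sigma>)"
  shows "scale t ` (chart_ring M \<sigma> - P) = chart_ring M \<sigma> - scale t ` P"
proof -
  have "P \<subseteq> CM" using spectrum_multiplicative(4)[OF is_subring_chart_ring P] chart_ring_subset by blast
  moreover have "chart_ring M \<sigma> - P \<subseteq> CM" using chart_ring_subset by blast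
  ultimately show ?thesis
    using inj_on_image_set_diff[OF inj_on_scale[OF t]] scale_chart_ring[OF t] by simp
qed

lemma complement_subset:
  assumes "P \<in> spectrum (chart_ring M \<sigma>)"
  shows "chart_ring M \<sigma> - P \<subseteq> CM" "0 \<notin> chart_ring M \<sigma> - P"
proof -
  show "chart_ring M \<sigma> - P \<subseteq> CM" using chart_ring_subset by blast
  show "0 \<notin> chart_ring M \<sigma> - P" by (rule spectrum_multiplicative(3)[OF is_subring_chart_ring assms])
qed

lemma torus_act_stalk:
  assumes t: "t \<in> torus M" and P: "P \<in> spectrum (chart_ring M \<sigma>)"
  shows "torus_act M t ` stalk \<sigma> D P = stalk \<sigma> D (scale t ` P)"
  unfolding stalk_def torus_act_localize[OF t chart_module_subset complement_subset[OF P]]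
    scale_chart_module[OF t] scale_complement[OF t P] ..

lemma torus_act_point:
  assumes t: "t \<in> torus M" and P: "P \<in> spectrum (chart_ring M \<sigma>)"
  shows "torus_act M t ` point M \<sigma> P = point M \<sigma> (scale t ` P)"
  unfolding point_def torus_act_localize[OF t chart_ring_subset complement_subset[OF P]]
    scale_chart_ring[OF t] scale_complement[OF t P] ..

lemma stalk_subset_rationals:
  "P \<in> spectrum (chart_ring M \<sigma>) \<Longrightarrow> stalk \<sigma> D P \<subseteq> rationals_on_torus"
  unfolding stalk_def by (rule localize_subset_rationals[OF chart_module_subset complement_subset])

lemma point_subset_rationals:
  "P \<in> spectrum (chart_ring M \<sigma>) \<Longrightarrow> point M \<sigma> P \<subseteq> rationals_on_torus"
  unfolding point_def by (rule localize_subset_rationals[OF chart_ring_subset complement_subset])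

end

section \<open>Equivariance of the sheaves and of the differential\<close>

context normal_fan_space
begin

lemma toric_sheaf_subset_rationals:
  assumes "U \<subseteq> topspace X" "f \<in> toric_sheaf M \<Sigma> D U"
  shows "f \<in> rationals_on_torus"
proof (cases "U = {}")
  case True
  then show ?thesis using assms(2) toric_sheaf_empty_open rationals_zero by auto
next
  case False
  then obtain x where x: "x \<in> U" "x \<in> topspace X" using assms(1) by blast
  then obtain \<sigma> P where P: "\<sigma> \<in> \<Sigma>" "P \<in> spectrum (chart_ring M \<sigma>)" "x = point M \<sigma> P"
    using topspace_toric_variety by blast
  then have "f \<in> stalk \<sigma> D P" using toric_sheafD[OF assms(2)] x by blast
  then show ?thesis using stalk_subset_rationals[OF P(2)] by blast
qed

lemma translate_topspace:
  assumes t: "t \<in> torus M" and U: "U \<subseteq> topspace X"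
  shows "translate M t U \<subseteq> topspace X"
proof
  fix y assume "y \<in> translate M t U"
  then obtain x where x: "x \<in> U" "y = torus_act M t ` x" by (auto simp: translate_def)
  then have "x \<in> topspace X" using U by blast
  then obtain \<sigma> P where P: "\<sigma> \<in> \<Sigma>" "P \<in> spectrum (chart_ring M \<sigma>)" "x = point M \<sigma> P"
    using topspace_toric_variety by blast
  then have "y = point M \<sigma> (scale t ` P)" using x torus_act_point[OF t P(2)] by simp
  then show "y \<in> topspace X" using topspace_toric_variety P(1) scale_prime[OF t P(2)] by blast
qed

lemma topspace_point_inverse:
  assumes t: "t \<in> torus M" and x: "x \<in> topspace X"
  shows "torus_act M (\<lambda>m. inverse (t m)) ` torus_act M t ` x = x"
proof -
  obtain \<sigma> P where P: "P \<in> spectrum (chart_ring M \<sigma>)" "x = point M \<sigma> P"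
    using topspace_toric_variety x by blast
  have "torus_act M (\<lambda>m. inverse (t m)) (torus_act M t q) = q" if "q \<in> x" for q
    using torus_act_inverse[OF t] point_subset_rationals[OF P(1)] that P(2) by blast
  then show ?thesis by (simp add: image_image cong: image_cong)
qed

lemma translate_inverse:
  assumes t: "t \<in> torus M" and U: "U \<subseteq> topspace X"
  shows "translate M (\<lambda>m. inverse (t m)) (translate M t U) = U"
proof -
  have "torus_act M (\<lambda>m. inverse (t m)) ` torus_act M t ` x = x" if "x \<in> U" for x
    using topspace_point_inverse[OF t] U that by blast
  then show ?thesis by (simp add: translate_def image_image[of _ "\<lambda>x. torus_act M t ` x"] cong: image_cong)
qed

text \<open>A prime \<open>P\<close> over the translated set comes from its preimage under the torus
  element, whose point lies in \<open>U\<close>; the action carries the stalk at the latter onto the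
  stalk at \<open>P\<close>.\<close>

lemma torus_act_toric_sheaf:
  assumes t: "t \<in> torus M" and U: "U \<subseteq> topspace X" and f: "f \<in> toric_sheaf M \<Sigma> D U"
  shows "torus_act M t f \<in> toric_sheaf M \<Sigma> D (translate M t U)"
  unfolding toric_sheaf_def
proof (intro CollectI conjI ballI impI)
  assume "translate M t U = {}"
  then have "U = {}" by (simp add: translate_def)
  then have "f = 0" using f toric_sheaf_empty_open[of f D] by simp
  then show "torus_act M t f = 0" using torus_act_zero[OF t] by simp
next
  fix \<sigma> P assume P: "\<sigma> \<in> \<Sigma>" "P \<in> spectrum (chart_ring M \<sigma>)" "point M \<sigma> P \<in> translate M t U"
  let ?i = "\<lambda>m. inverse (t m)"
  have i: "?i \<in> torus M" by (rule torus_inverse[OF t])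
  obtain x where x: "x \<in> U" "point M \<sigma> P = torus_act M t ` x" using P(3) by (auto simp: translate_def)
  have "x \<in> topspace X" using x U by blast
  then have "x = torus_act M ?i ` point M \<sigma> P" using topspace_point_inverse[OF t, of x] x(2) by simp
  then have "point M \<sigma> (scale ?i ` P) \<in> U" using torus_act_point[OF i P(2)] x(1) by simp
  then have "f \<in> stalk \<sigma> D (scale ?i ` P)" by (rule toric_sheafD[OF f P(1) scale_prime[OF i P(2)]])
  then have "torus_act M t f \<in> stalk \<sigma> D (scale t ` scale ?i ` P)"
    using torus_act_stalk[OF t scale_prime[OF i P(2)]] by blast
  moreover have "scale t ` scale ?i ` P = P"
  proof -
    have "scale t (scale ?i p) = p" if "p \<in> P" for p
      using scale_inverse'[OF t] that spectrum_multiplicative(4)[OF is_subring_chart_ring P(2)]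
        chart_ring_subset by blast
    then show ?thesis by (simp add: image_image cong: image_cong)
  qed
  ultimately show "torus_act M t f \<in> localize (chart_module M \<sigma> D) (chart_ring M \<sigma> - P)"
    by (simp add: stalk_def)
qed

text \<open>One inclusion is \<open>torus_act_toric_sheaf\<close>, and the other is the same lemma
  for the inverse torus element applied to the translated set.\<close>

lemma torus_equivariant_toric_sheaf: "torus_equivariant M X (toric_sheaf M \<Sigma> D)"
  unfolding torus_equivariant_def
proof (intro ballI allI impI equalityI subsetI)
  fix t U f assume t: "t \<in> torus M" and "openin X U" and f: "f \<in> toric_sheaf M \<Sigma> D (translate M t U)"
  then have U: "U \<subseteq> topspace X" by (simp add: openin_subset)
  let ?i = "\<lambda>m. inverse (t m)"
  have "torus_act M ?i f \<in> toric_sheaf M \<Sigma> D (translate M ?i (translate M t U))"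
    by (rule torus_act_toric_sheaf[OF torus_inverse[OF t] translate_topspace[OF t U] f])
  moreover have "f = torus_act M t (torus_act M ?i f)"
    using torus_act_inverse'[OF t toric_sheaf_subset_rationals[OF translate_topspace[OF t U] f]] by simp
  ultimately show "f \<in> torus_act M t ` toric_sheaf M \<Sigma> D U"
    unfolding translate_inverse[OF t U] by (rule rev_image_eqI)
next
  fix t U f assume t: "t \<in> torus M" and "openin X U" and "f \<in> torus_act M t ` toric_sheaf M \<Sigma> D U"
  then show "f \<in> toric_sheaf M \<Sigma> D (translate M t U)"
    using torus_act_toric_sheaf[OF t openin_subset] by blast
qed

lemma koszul_diff_torus_act:
  assumes t: "t \<in> torus M" and "\<And>J. c J \<in> rationals_on_torus"
  shows "koszul_diff I (\<lambda>J. torus_act M t (c J)) = (\<lambda>J. torus_act M t (koszul_diff I c J))"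
  by (rule koszul_diff_additive[of rationals_on_torus])
    (use assms in \<open>simp_all add: rationals_zero torus_act_zero torus_act_uminus torus_act_add\<close>)

end

text \<open>Exactness for all integers \<open>p\<close> includes both ends of the sequence: terms of
  negative degree and of degree above \<open>card I\<close> are zero, so \<open>p = 0\<close> is
  surjectivity onto the sheaf of the union and \<open>p = card I\<close> is injectivity at the full
  intersection.\<close>

theorem theorem12:
  fixes M \<Delta> :: "'a::euclidean_space set"
    and I :: "'i::linorder set" and D :: "'i \<Rightarrow> 'a set"
  assumes "is_lattice M"
    and "lattice_polyhedron M \<Delta>" and "aff_dim \<Delta> = int (dim M)"
    and "\<Sigma> = normal_fan M \<Delta>" and "X = toric_variety M \<Sigma>"
    and "sigma_family M \<Sigma> I D"
    and "F = intersection_functor I D"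
    and "L = (\<lambda>J. toric_sheaf M \<Sigma> (F J))"
    and "C = direct_sum_sheaf I L"
  shows
    \<comment> \<open>the sequence is exact in every degree\<close>
    "(\<forall>p. sheaf_exact X (C (p + 1)) (koszul_diff I) (C p) (koszul_diff I) (C (p - 1))) \<and>
     \<comment> \<open>its summands are zero or globally generated line bundles\<close>
     (\<forall>J. J \<subseteq> I \<longrightarrow>
        (if F J = {} then (\<forall>U. openin X U \<longrightarrow> L J U = {0})
         else line_bundle X (L J) \<and> globally_generated X (L J))) \<and>
     \<comment> \<open>it is equivariant for the torus\<close>
     (\<forall>J. J \<subseteq> I \<longrightarrow> torus_equivariant M X (L J)) \<and>
     (\<forall>t\<in>torus M. \<forall>p U. openin X U \<longrightarrow> (\<forall>c\<in>C p U.
        koszul_diff I (\<lambda>J. torus_act M t (c J)) = (\<lambda>J. torus_act M t (koszul_diff I c J)))) \<and>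
     \<comment> \<open>over the charts it is induced by the evaluation complexes\<close>
     (\<forall>\<sigma>\<in>\<Sigma>. \<forall>p.
        C p (chart M \<sigma>) =
          {\<lambda>J. \<Sum>m\<in>A. monomial m (z m J) | A z. finite A \<and> A \<subseteq> M \<and>
             (\<forall>m\<in>A. z m \<in> evaluation_complex I (\<lambda>J. F J + dual_cone M \<sigma>) m p)}) \<and>
     (\<forall>\<sigma>\<in>\<Sigma>. \<forall>m\<in>M. \<forall>p. \<forall>z\<in>evaluation_complex I (\<lambda>J. F J + dual_cone M \<sigma>) m p.
        z \<in> functor_complex I F p \<and>
        koszul_diff I z \<in> evaluation_complex I (\<lambda>J. F J + dual_cone M \<sigma>) m (p - 1) \<and>
        koszul_diff I (\<lambda>J. monomial m (z J)) = (\<lambda>J. monomial m (koszul_diff I z J)))"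
proof -
  interpret normal_fan_space M \<Delta> \<Sigma>
    using assms(1,4) by (simp add: normal_fan_space_def lattice_space_def normal_fan_space_axioms_def)
  note S = assms(6)
  have I: "finite I" using S by (simp add: sigma_family_def)
  have F: "F J \<in> nef_polyhedra M \<Sigma>" if "J \<subseteq> I" for J
    using intersection_functor_nef[OF S that] assms(7) by simp
  have C: "C = direct_sum_sheaf I (\<lambda>J. toric_sheaf M \<Sigma> (intersection_functor I D J))"
    using assms(7-9) by simp
  have X: "X = toric_variety M \<Sigma>" by (rule assms(5))
  have exact: "sheaf_exact X (C (p + 1)) (koszul_diff I) (C p) (koszul_diff I) (C (p - 1))" for p
    unfolding C X by (rule sheaf_exact_koszul[OF S])
  have summands: "if F J = {} then (\<forall>U. openin X U \<longrightarrow> L J U = {0})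
      else line_bundle X (L J) \<and> globally_generated X (L J)" if "J \<subseteq> I" for J
    using toric_sheaf_of_empty line_bundle_toric_sheaf[OF F[OF that]]
      globally_generated_toric_sheaf[OF F[OF that]]
    by (simp add: assms(8) X)
  have equivariant: "torus_equivariant M X (L J)" for J
    unfolding assms(8) X by (rule torus_equivariant_toric_sheaf)
  have diff_equivariant:
    "koszul_diff I (\<lambda>J. torus_act M t (c J)) = (\<lambda>J. torus_act M t (koszul_diff I c J))"
    if t: "t \<in> torus M" and U: "openin X U" and c: "c \<in> C p U" for t p U c
  proof (rule koszul_diff_torus_act[OF t])
    fix J
    \<comment> \<open>The action is known to be additive only on this field, so every component,
      including the zero ones outside degree \<open>p\<close>, has to be placed in it.\<close>
    show "c J \<in> rationals_on_torus"
    proof (cases "J \<subseteq> I \<and> int (card J) = p")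
      case True
      then have "c J \<in> toric_sheaf M \<Sigma> (intersection_functor I D J) U"
        using direct_sum_mem[OF S] c unfolding C by blast
      then show ?thesis
        using toric_sheaf_subset_rationals openin_subset[OF U] unfolding X by blast
    next
      case False
      then have "c J = 0" using direct_sum_zero[OF S] c unfolding C by blast
      then show ?thesis using rationals_zero by simp
    qed
  qed
  have charts: "C p (chart M \<sigma>) = {\<lambda>J. \<Sum>m\<in>A. monomial m (z m J) | A z. finite A \<and> A \<subseteq> M \<and>
      (\<forall>m\<in>A. z m \<in> evaluation_complex I (\<lambda>J. F J + dual_cone M \<sigma>) m p)}" if "\<sigma> \<in> \<Sigma>" for \<sigma> p
    unfolding C assms(7) by (rule chart_sections[OF S that])
  have evaluation: "z \<in> functor_complex I F p \<and>
      koszul_diff I z \<in> evaluation_complex I (\<lambda>J. F J + dual_cone M \<sigma>) m (p - 1) \<and>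
      koszul_diff I (\<lambda>J. monomial m (z J)) = (\<lambda>J. monomial m (koszul_diff I z J))"
    if z: "z \<in> evaluation_complex I (\<lambda>J. F J + dual_cone M \<sigma>) m p" for \<sigma> m p z
  proof (intro conjI)
    have "F J \<noteq> {}" if "m \<in> F J + dual_cone M \<sigma>" for J
      using that by (auto elim: set_plus_elim)
    then show "z \<in> functor_complex I F p"
      using z unfolding functor_complex_def evaluation_complex_def by blast
    show "koszul_diff I z \<in> evaluation_complex I (\<lambda>J. F J + dual_cone M \<sigma>) m (p - 1)"
      by (rule evaluation_complex_diff[OF I assms(7) z])
  qed (rule koszul_diff_monomial)
  show ?thesis
    by (intro conjI allI impI ballI exact summands equivariant diff_equivariant charts
        evaluation[THEN conjunct1] evaluation[THEN conjunct2, THEN conjunct1]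
        evaluation[THEN conjunct2, THEN conjunct2])
qed

end
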